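(* Let $K$ be a perfect field of characteristic $p>0$. Let $A_1=K\langle x,\partial \mid \partial x-x\partial=1\rangle$ be the first Weyl algebra over $K$, and let $Z=K[X,Y]$ be its centre, the polynomial algebra in $X:=x^p$ and $Y:=\partial^p$. Then the restriction map $$\mathrm{res}:\mathrm{Aut}_K(A_1)\to \mathrm{Aut}_K(Z),\qquad \sigma\mapsto \sigma|_Z,$$ is a group monomorphism whose image is $\Gamma:=\{\tau\in\mathrm{Aut}_K(Z)\mid \mathcal{J}(\tau)=1\}$.
   Context: For $\tau\in\mathrm{Aut}_K(Z)$, $\mathcal{J}(\tau)=\det\begin{pmatrix}\partial\tau(X)/\partial X & \partial\tau(X)/\partial Y\\ \partial\tau(Y)/\partial X & \partial\tau(Y)/\partial Y\end{pmatrix}$ is the Jacobian of $\tau$. The restriction $\sigma|_Z$ is an automorphism of $Z$ since any automorphism preserves the centre. *)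

theory Defs
  imports "HOL-Library.Poly_Mapping" "HOL-Computational_Algebra.Polynomial"
begin

text \<open>The first Weyl algebra A_1 over a field K, in its normal-ordered (PBW) basis:
  an element is a finitely supported family of coefficients, where the coefficient
  at (i,j) is the coefficient of the monomial x^i d^j.\<close>
type_synonym 'k weyl = "(nat \<times> nat) \<Rightarrow>\<^sub>0 'k"

text \<open>Multiplication: (x^a d^b)(x^c d^d) = sum_k k! (b choose k)(c choose k) x^(a+c-k) d^(b+d-k),
  which is the multiplication determined by the relation d x - x d = 1.\<close>
definition weyl_mult :: "'k::field weyl \<Rightarrow> 'k weyl \<Rightarrow> 'k weyl" where
  "weyl_mult f g =
     (\<Sum>m\<in>Poly_Mapping.keys f. \<Sum>n\<in>Poly_Mapping.keys g. \<Sum>k\<in>{..min (snd m) (fst n)}.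
        Poly_Mapping.single (fst m + fst n - k, snd m + snd n - k)
          (Poly_Mapping.lookup f m * Poly_Mapping.lookup g n *
           of_nat (fact k * (snd m choose k) * (fst n choose k))))"

definition weyl_const :: "'k::field \<Rightarrow> 'k weyl" where
  "weyl_const c = Poly_Mapping.single (0,0) c"

definition weyl_aut :: "('k::field weyl \<Rightarrow> 'k weyl) \<Rightarrow> bool" where
  "weyl_aut \<sigma> \<longleftrightarrow> bij \<sigma>
     \<and> (\<forall>f g. \<sigma> (f + g) = \<sigma> f + \<sigma> g)
     \<and> (\<forall>f g. \<sigma> (weyl_mult f g) = weyl_mult (\<sigma> f) (\<sigma> g))
     \<and> (\<forall>c. \<sigma> (weyl_const c) = weyl_const c)"

definition weyl_centre :: "'k::field weyl set" where
  "weyl_centre = {a. \<forall>b. weyl_mult a b = weyl_mult b a}"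

text \<open>The polynomial algebra Z = K[X,Y] is modelled as 'k poly poly (polynomials in Y
  whose coefficients are polynomials in X).\<close>
definition varX :: "'k::field poly poly" where "varX = [:[:0, 1:]:]"
definition varY :: "'k::field poly poly" where "varY = [:0, 1:]"
definition zconst :: "'k::field \<Rightarrow> 'k poly poly" where "zconst c = [:[:c:]:]"

definition z_aut :: "('k::field poly poly \<Rightarrow> 'k poly poly) \<Rightarrow> bool" where
  "z_aut \<tau> \<longleftrightarrow> bij \<tau>
     \<and> (\<forall>f g. \<tau> (f + g) = \<tau> f + \<tau> g)
     \<and> (\<forall>f g. \<tau> (f * g) = \<tau> f * \<tau> g)
     \<and> (\<forall>c. \<tau> (zconst c) = zconst c)"

definition dX :: "'k::field poly poly \<Rightarrow> 'k poly poly" where "dX q = map_poly pderiv q"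
definition dY :: "'k::field poly poly \<Rightarrow> 'k poly poly" where "dY q = pderiv q"

definition jacobian :: "('k::field poly poly \<Rightarrow> 'k poly poly) \<Rightarrow> 'k poly poly" where
  "jacobian \<tau> = dX (\<tau> varX) * dY (\<tau> varY) - dY (\<tau> varX) * dX (\<tau> varY)"

text \<open>The K-algebra embedding Z = K[X,Y] \<rightarrow> A_1 with X \<mapsto> x^p, Y \<mapsto> d^p
  (x^p and d^p commute, so X^i Y^j \<mapsto> x^(p i) d^(p j)).\<close>
definition z_emb :: "nat \<Rightarrow> 'k::field poly poly \<Rightarrow> 'k weyl" where
  "z_emb p q = (\<Sum>j\<le>degree q. \<Sum>i\<le>degree (coeff q j).
      Poly_Mapping.single (p * i, p * j) (coeff (coeff q j) i))"

definition res :: "nat \<Rightarrow> ('k::field weyl \<Rightarrow> 'k weyl) \<Rightarrow> 'k poly poly \<Rightarrow> 'k poly poly" where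
  "res p \<sigma> q = (THE r. z_emb p r = \<sigma> (z_emb p q))"

end

theory Submission
  imports Defs "HOL-Computational_Algebra.Primes"
begin

text \<open>
  Every automorphism \<open>\<tau>\<close> of \<open>K[X,Y]\<close> is a product of elementary and linear ones (Jung, van der Kulk). Transporting
  the translation \<open>Y \<mapsto> Y + t\<close> by \<open>\<tau>\<close> gives a homomorphism \<open>K[X,Y] \<rightarrow> K[X,Y][t]\<close> fixing \<open>\<tau> X\<close>; its top
  part for the weights dictated by the Newton polygon of \<open>\<tau> X\<close> is non-trivial and fixes the top form
  of \<open>\<tau> X\<close>. This forces that form to be a scalar multiple of a power of \<open>X\<^sup>a - \<beta> Y\<^sup>b\<close> with \<open>a\<close>, \<open>b\<close> coprime, and
  a Mason-type degree count, valid in every positive characteristic, excludes \<open>a, b \<ge> 2\<close>. Hence an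
  elementary automorphism lowers the degree of \<open>\<tau> X\<close>.

  An elementary automorphism \<open>X \<mapsto> X + f(Y)\<close> lifts to the Weyl algebra: the \<open>p\<close>-th power of
  \<open>x + c d\<^sup>n\<close> is \<open>X + c\<^sup>p Y\<^sup>n + r(Y)\<close> with \<open>r\<close> of degree less than \<open>n\<close>, so over a perfect field induction on
  the degree reaches every \<open>f\<close>. Consequently every \<open>\<tau>\<close> is, up to a lifting automorphism of Jacobian 1,
  a dilation \<open>X \<mapsto> c X\<close> with \<open>c\<close> the Jacobian of \<open>\<tau>\<close>. Leading symbols show that \<open>u\<^sup>p = (\<gamma> x)\<^sup>p\<close> forces
  \<open>u = \<gamma> x\<close>; therefore the dilation lifts only if \<open>c = 1\<close>, and an automorphism that is trivial on the
  centre is trivial.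
\<close>

section \<open>Homomorphisms out of the bivariate polynomial ring\<close>

text \<open>In characteristic p the derivation d/dY kills p-th powers and cannot be exponentiated,
  so the translation itself, a homomorphism into K[X,Y][t], plays the part that a locally nilpotent
  derivation has in characteristic 0. K is not assumed algebraically closed, so \<beta> has to be
  produced inside K; it is a quotient of iterated leading coefficients of the transported action.
  The Jacobian of a restriction is never computed from the Weyl relation. Reduction by liftable maps
  of Jacobian 1 turns both inclusions for the image into the single question which dilations lift.
  Scalars of A_1 reappear on the centre as p-th powers, which is where perfectness enters. Products
  in A_1 deviate from commutative ones only in lower terms: for weights of positive sum leading
  symbols multiply as ordinary polynomials, and the Frobenius map of K[X,Y] gives the leading part
  of a p-th power.\<close>

locale unital_ring_hom =
  fixes f :: "'a::ring_1 \<Rightarrow> 'b::ring_1"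
  assumes add: "f (x + y) = f x + f y"
    and mult: "f (x * y) = f x * f y"
    and one [simp]: "f 1 = 1"
begin

lemma zero [simp]: "f 0 = 0"
  using add[of 0 0] by simp

lemma minus: "f (- x) = - f x"
  using add[of x "- x"] by (simp add: eq_neg_iff_add_eq_0 add.commute)

lemma diff: "f (x - y) = f x - f y"
  using add[of x "- y"] by (simp add: minus)

lemma power: "f (x ^ n) = f x ^ n"
  by (induction n) (simp_all add: mult)

lemma sum: "f (sum g A) = (\<Sum>a\<in>A. f (g a))"
  by (induction A rule: infinite_finite_induct) (simp_all add: add)

end

lemma unital_ring_hom_comp:
  "unital_ring_hom f \<Longrightarrow> unital_ring_hom g \<Longrightarrow> unital_ring_hom (\<lambda>x. g (f x))"
  by (simp add: unital_ring_hom_def)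

lemma unital_ring_hom_map_poly:
  fixes f :: "'a::comm_ring_1 \<Rightarrow> 'b::comm_ring_1"
  assumes "unital_ring_hom f"
  shows "unital_ring_hom (map_poly f)"
proof -
  interpret unital_ring_hom f by fact
  show ?thesis
    by unfold_locales
      (auto intro!: poly_eqI simp: coeff_map_poly add mult coeff_mult sum)
qed

lemma unital_ring_hom_poly: "unital_ring_hom (\<lambda>q. poly q (a::'a::comm_ring_1))"
  by unfold_locales auto

lemma unital_ring_hom_const: "unital_ring_hom (\<lambda>c::'a::comm_ring_1. [:c:])"
  by unfold_locales (auto simp: one_pCons)

lemma unital_ring_hom_zconst: "unital_ring_hom (zconst :: 'k::field \<Rightarrow> _)"
  by unfold_locales (auto simp: zconst_def one_pCons)

lemma zconst_simps [simp]:
  "zconst 0 = 0" "zconst 1 = 1" "zconst (c + d) = zconst c + zconst d"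
  "zconst (c * d) = zconst c * zconst d" "zconst (- c) = - zconst c"
  "zconst c = 0 \<longleftrightarrow> c = 0" "zconst c = zconst d \<longleftrightarrow> c = d"
  "zconst (c ^ n) = zconst c ^ n" "zconst (of_nat n) = of_nat n"
  by (simp_all add: zconst_def one_pCons poly_const_pow of_nat_poly)

lemma bivariate_induct [case_names const X Y add mult]:
  fixes q :: "'k::field poly poly"
  assumes "\<And>c. P (zconst c)" "P varX" "P varY"
    and add: "\<And>f g. P f \<Longrightarrow> P g \<Longrightarrow> P (f + g)"
    and mult: "\<And>f g. P f \<Longrightarrow> P g \<Longrightarrow> P (f * g)"
  shows "P q"
proof -
  have coef: "P [:c:]" for c :: "'k poly"
  proof (induction c)
    case 0
    then show ?case using assms(1)[of 0] by simp
  next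
    case (pCons a c)
    have "[:pCons a c:] = zconst a + varX * [:c:]"
      by (simp add: zconst_def varX_def)
    then show ?case using assms pCons by metis
  qed
  show ?thesis
  proof (induction q)
    case 0
    then show ?case using assms(1)[of 0] by simp
  next
    case (pCons a q)
    have "pCons a q = [:a:] + varY * q"
      by (simp add: varY_def)
    then show ?case using assms pCons coef by metis
  qed
qed

lemma bivariate_hom_unique:
  fixes f g :: "'k::field poly poly \<Rightarrow> 'r::ring_1"
  assumes "unital_ring_hom f" "unital_ring_hom g"
    and "\<And>c. f (zconst c) = g (zconst c)" "f varX = g varX" "f varY = g varY"
  shows "f q = g q"
  by (induction q rule: bivariate_induct)
    (use assms in \<open>auto simp: unital_ring_hom.add unital_ring_hom.mult\<close>)

text \<open>The homomorphism X \<mapsto> a, Y \<mapsto> b with \<iota> as structure map. The free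
  choice of target lets one definition serve substitutions inside K[X,Y] and maps into
  K[X,Y][t].\<close>

definition bieval :: "('k::field \<Rightarrow> 'r::comm_ring_1) \<Rightarrow> 'r \<Rightarrow> 'r \<Rightarrow> 'k poly poly \<Rightarrow> 'r" where
  "bieval \<iota> a b q = poly (map_poly (\<lambda>c. poly (map_poly \<iota> c) a) q) b"

lemma unital_ring_hom_bieval: "unital_ring_hom \<iota> \<Longrightarrow> unital_ring_hom (bieval \<iota> a b)"
  unfolding bieval_def
  by (intro unital_ring_hom_comp[OF _ unital_ring_hom_poly] unital_ring_hom_map_poly)

lemma bieval_simps [simp]:
  assumes "unital_ring_hom \<iota>"
  shows "bieval \<iota> a b (zconst c) = \<iota> c" "bieval \<iota> a b varX = a" "bieval \<iota> a b varY = b"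
proof -
  interpret unital_ring_hom \<iota> by fact
  show "bieval \<iota> a b (zconst c) = \<iota> c" "bieval \<iota> a b varX = a" "bieval \<iota> a b varY = b"
    by (auto simp: bieval_def zconst_def varX_def varY_def map_poly_pCons)
qed

text \<open>Y is the outer variable, so the coefficient of X^i Y^j is extracted with
  \<open>j\<close> before \<open>i\<close>; \<open>cf\<close> restores the usual order of the
  exponents.\<close>

abbreviation cf :: "'k::zero poly poly \<Rightarrow> nat \<Rightarrow> nat \<Rightarrow> 'k" where
  "cf q i j \<equiv> coeff (coeff q j) i"

definition mon :: "'k::zero \<Rightarrow> nat \<Rightarrow> nat \<Rightarrow> 'k poly poly" where
  "mon c i j = monom (monom c i) j"

definition supp :: "'k::zero poly poly \<Rightarrow> (nat \<times> nat) set" where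
  "supp q = {(i, j). cf q i j \<noteq> 0}"

lemma cf_eqI: "(\<And>i j. cf p i j = cf q i j) \<Longrightarrow> p = q"
  by (simp add: poly_eq_iff)

lemma cf_mon: "cf (mon c a b) i j = (if i = a \<and> j = b then c else 0)"
  by (auto simp: mon_def)

lemma in_supp: "(i, j) \<in> supp q \<longleftrightarrow> cf q i j \<noteq> 0"
  by (simp add: supp_def)

lemma finite_supp [simp]: "finite (supp q)"
proof (rule finite_subset)
  show "supp q \<subseteq> (\<lambda>(j, i). (i, j)) ` (SIGMA j:{..degree q}. {..degree (coeff q j)})"
    by (force simp: supp_def image_iff intro: le_degree)
qed auto

lemma supp_eq_empty [simp]: "supp q = {} \<longleftrightarrow> q = 0"
  by (auto simp: supp_def poly_eq_iff)

lemma cf_sum: "cf (sum g S) i j = (\<Sum>s\<in>S. cf (g s) i j)"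
  by (simp add: coeff_sum)

lemma cf_sum_mon:
  "finite S \<Longrightarrow> cf (\<Sum>(a,b)\<in>S. mon (c a b) a b) i j = (if (i, j) \<in> S then c i j else 0)"
proof -
  assume "finite S"
  have "cf (\<Sum>(a,b)\<in>S. mon (c a b) a b) i j = (\<Sum>s\<in>S. if (i, j) = s then c i j else 0)"
    by (auto simp: cf_sum cf_mon case_prod_unfold intro!: sum.cong)
  also have "\<dots> = (if (i, j) \<in> S then c i j else 0)"
    using \<open>finite S\<close> by (simp add: sum.delta)
  finally show ?thesis .
qed

lemma sum_mon_supp: "(\<Sum>(i,j)\<in>supp q. mon (cf q i j) i j) = (q :: 'k::comm_monoid_add poly poly)"
  by (rule cf_eqI) (auto simp: cf_sum_mon in_supp)

lemma mon_eq: "mon (c::'k::field) i j = zconst c * varX ^ i * varY ^ j"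
proof -
  have "varX ^ i = [:monom (1::'k) i:]"
    by (simp add: varX_def poly_const_pow monom_altdef)
  moreover have "varY ^ j = (monom 1 j :: 'k poly poly)"
    by (simp add: varY_def monom_altdef)
  ultimately show ?thesis
    by (simp add: mon_def zconst_def smult_monom)
qed

lemma bieval_expand:
  assumes "unital_ring_hom \<iota>"
  shows "bieval \<iota> a b q = (\<Sum>(i,j)\<in>supp q. \<iota> (cf q i j) * a ^ i * b ^ j)"
proof -
  interpret unital_ring_hom "bieval \<iota> a b" by (rule unital_ring_hom_bieval) fact
  have "bieval \<iota> a b q = bieval \<iota> a b (\<Sum>(i,j)\<in>supp q. mon (cf q i j) i j)"
    by (simp add: sum_mon_supp)
  also have "\<dots> = (\<Sum>(i,j)\<in>supp q. \<iota> (cf q i j) * a ^ i * b ^ j)"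
    by (simp add: sum case_prod_unfold mon_eq mult power assms)
  finally show ?thesis .
qed

section \<open>Binary forms and polynomial curves\<close>

text \<open>The binary form v^d f(u/v), written without division. The formal degree \<open>d\<close>
  is kept apart from \<open>degree f\<close>, so that factors of f can be split off with degrees of
  their own.\<close>

definition homogenize :: "('k::field \<Rightarrow> 'r::comm_ring_1) \<Rightarrow> 'k poly \<Rightarrow> nat \<Rightarrow> 'r \<Rightarrow> 'r \<Rightarrow> 'r" where
  "homogenize \<iota> f d u v = (\<Sum>k\<le>d. \<iota> (coeff f k) * u ^ k * v ^ (d - k))"

lemma homogenize_hom:
  "unital_ring_hom \<phi> \<Longrightarrow> \<phi> (homogenize \<iota> f d u v) = homogenize (\<lambda>c. \<phi> (\<iota> c)) f d (\<phi> u) (\<phi> v)"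
  by (simp add: homogenize_def unital_ring_hom.sum unital_ring_hom.mult unital_ring_hom.power)

text \<open>Shifting the coefficients of g multiplies the form by u, raising only its formal degree
  multiplies it by v; T - \<beta> combines the two.\<close>

lemma homogenize_linear_factor:
  assumes "unital_ring_hom \<iota>" "degree g \<le> e"
  shows "homogenize \<iota> ([:- \<beta>, 1:] * g) (Suc e) u v = (u - \<iota> \<beta> * v) * homogenize \<iota> g e u v"
proof -
  interpret unital_ring_hom \<iota> by fact
  have 1: "homogenize \<iota> (pCons 0 g) (Suc e) u v = u * homogenize \<iota> g e u v"
    unfolding homogenize_def sum.atMost_Suc_shift by (simp add: sum_distrib_left mult_ac)
  have 0: "coeff g (Suc e) = 0" using assms by (simp add: coeff_eq_0)
  have 2: "homogenize \<iota> g (Suc e) u v = v * homogenize \<iota> g e u v"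
    unfolding homogenize_def
    by (simp add: 0 sum_distrib_left Suc_diff_le mult_ac)
  have "[:- \<beta>, 1:] * g = pCons 0 g - smult \<beta> g"
    by simp
  then have "homogenize \<iota> ([:- \<beta>, 1:] * g) (Suc e) u v
      = homogenize \<iota> (pCons 0 g) (Suc e) u v - \<iota> \<beta> * homogenize \<iota> g (Suc e) u v"
    by (simp add: homogenize_def sum_distrib_left sum_subtractf diff mult algebra_simps)
  then show ?thesis by (simp add: 1 2 algebra_simps)
qed

lemma homogenize_linear_power:
  assumes "unital_ring_hom \<iota>" "degree g \<le> e"
  shows "homogenize \<iota> ([:- \<beta>, 1:] ^ r * g) (r + e) u v = (u - \<iota> \<beta> * v) ^ r * homogenize \<iota> g e u v"
proof (induction r)
  case (Suc r)
  have "degree ([:- \<beta>, 1:] ^ r * g) \<le> degree ([:- \<beta>, 1:] ^ r) + degree g"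
    by (rule degree_mult_le)
  then have "degree ([:- \<beta>, 1:] ^ r * g) \<le> r + e"
    using assms(2) by (simp add: degree_linear_power)
  from homogenize_linear_factor[OF assms(1) this] show ?case
    by (simp only: power_Suc mult.assoc add_Suc Suc)
qed simp

lemma homogenize_const [simp]: "homogenize \<iota> f 0 u v = \<iota> (coeff f 0)"
  by (simp add: homogenize_def)

lemma homogenize_id:
  assumes "degree f \<le> d" "v \<noteq> 0"
  shows "homogenize (\<lambda>c. c) f d u v = v ^ d * poly f (u / v)"
proof -
  have "poly f (u / v) = (\<Sum>k\<le>d. coeff f k * (u / v) ^ k)"
    unfolding poly_altdef
    by (rule sum.mono_neutral_left) (use assms in \<open>auto simp: coeff_eq_0\<close>)
  then show ?thesis
    using assms
    by (auto simp: homogenize_def sum_distrib_left power_divide power_diff intro!: sum.cong)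
qed

lemma degree_power_bound: "degree p \<le> n \<Longrightarrow> degree (p ^ k) \<le> n * k"
  by (rule order.trans[OF degree_power_le]) simp

lemma coeff_mult_bound:
  fixes p q :: "'a::comm_ring_1 poly"
  assumes "degree p \<le> m" "degree q \<le> l"
  shows "coeff (p * q) (m + l) = coeff p m * coeff q l"
proof -
  have "coeff (p * q) (m + l) = (\<Sum>i\<le>m + l. if i = m then coeff p m * coeff q l else 0)"
    unfolding coeff_mult
  proof (rule sum.cong[OF refl])
    fix i assume "i \<in> {..m + l}"
    then show "coeff p i * coeff q (m + l - i) = (if i = m then coeff p m * coeff q l else 0)"
      using assms by (cases i m rule: linorder_cases) (auto simp: coeff_eq_0)
  qed
  then show ?thesis by simp
qed

lemma coeff_power_bound:
  fixes p :: "'a::comm_ring_1 poly"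
  assumes "degree p \<le> n"
  shows "coeff (p ^ k) (n * k) = coeff p n ^ k"
proof (induction k)
  case (Suc k)
  show ?case
    using coeff_mult_bound[OF assms degree_power_bound[OF assms, of k]] Suc by simp
qed simp

lemma degree_pderiv_less:
  fixes f :: "'a::idom poly"
  assumes "degree f > 0"
  shows "degree (pderiv f) < degree f"
proof -
  have "degree (pderiv f) \<le> degree f - 1"
    by (rule degree_le) (auto simp: coeff_pderiv coeff_eq_0)
  then show ?thesis using assms by simp
qed

lemma coeff_homogenize:
  fixes u v :: "'r::comm_ring_1 poly"
  assumes "degree u \<le> n" "degree v \<le> n"
  shows "coeff (homogenize (\<lambda>c. [:\<iota> c:]) f d u v) (n * d) = homogenize \<iota> f d (coeff u n) (coeff v n)"
proof -
  have "coeff (u ^ k * v ^ (d - k)) (n * d) = coeff u n ^ k * coeff v n ^ (d - k)"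
    if "k \<le> d" for k
    using coeff_mult_bound[OF degree_power_bound[OF assms(1), of k]
        degree_power_bound[OF assms(2), of "d - k"]] that assms
    by (simp add: coeff_power_bound flip: distrib_left)
  then show ?thesis
    by (auto simp: homogenize_def coeff_sum mult.assoc intro!: sum.cong)
qed

text \<open>Passing to coefficients of top degree preserves the vanishing of a binary form, and reflects
  the non-vanishing of every other one.\<close>
lemma homogenize_descend:
  fixes u v :: "'r::idom poly"
  assumes \<iota>: "unital_ring_hom \<iota>" "\<And>c. \<iota> c = 0 \<Longrightarrow> c = 0"
    and f: "coeff f 0 \<noteq> 0" "coeff f d \<noteq> 0"
    and uv: "u \<noteq> 0" "v \<noteq> 0" "max (degree u) (degree v) = n"
    and small: "coeff (homogenize (\<lambda>c. [:\<iota> c:]) f d u v) (n * d) = 0"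
  obtains u' v' where "u' \<noteq> 0" "v' \<noteq> 0" "homogenize \<iota> f d u' v' = 0"
    "\<And>g e. coeff (homogenize (\<lambda>c. [:\<iota> c:]) g e u v) (n * e) = homogenize \<iota> g e u' v'"
proof (rule that)
  interpret unital_ring_hom \<iota> by fact
  have le: "degree u \<le> n" "degree v \<le> n" using uv by auto
  show H: "coeff (homogenize (\<lambda>c. [:\<iota> c:]) g e u v) (n * e) = homogenize \<iota> g e (coeff u n) (coeff v n)" for g e
    using le by (rule coeff_homogenize)
  show 0: "homogenize \<iota> f d (coeff u n) (coeff v n) = 0"
    using small H by simp
  have nz: "coeff u n \<noteq> 0 \<or> coeff v n \<noteq> 0"
    using uv by (metis leading_coeff_0_iff max_def)
  \<comment> \<open>If one of the two top coefficients were 0, the form would reduce to an end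
    coefficient of f times a power of the other, which is non-zero. Vanishing therefore forces both
    to be non-zero.\<close>
  have d: "homogenize \<iota> f d 0 w = \<iota> (coeff f 0) * w ^ d" for w
  proof -
    have "homogenize \<iota> f d 0 w = (\<Sum>k\<le>d. if k = 0 then \<iota> (coeff f 0) * w ^ d else 0)"
      unfolding homogenize_def by (rule sum.cong) auto
    then show ?thesis by simp
  qed
  have d': "homogenize \<iota> f d w 0 = \<iota> (coeff f d) * w ^ d" for w
  proof -
    have "homogenize \<iota> f d w 0 = (\<Sum>k\<le>d. if k = d then \<iota> (coeff f d) * w ^ d else 0)"
      unfolding homogenize_def by (rule sum.cong) auto
    then show ?thesis by simp
  qed
  show "coeff u n \<noteq> 0"
    using 0 nz d[of "coeff v n"] f \<iota>(2) by force
  show "coeff v n \<noteq> 0"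
    using 0 nz d'[of "coeff u n"] f \<iota>(2) by force
qed

text \<open>A form of positive degree can have a t-free value only if its top term in t cancels.
  Passing to leading coefficients in t, then Y, then X turns this cancellation into a root \<beta>
  of f in K. For the cofactor g of the full power of T - \<beta> nothing cancels, so its value has
  t-degree at least n * degree g; as a factor of a t-free element it has t-degree 0, and g is
  constant.\<close>

lemma binary_form_pure_power:
  fixes U V :: "'k::field poly poly poly"
  assumes f: "coeff f 0 \<noteq> 0" "degree f = d" "d > 0"
    and UV: "U \<noteq> 0" "V \<noteq> 0" "degree U > 0 \<or> degree V > 0"
    and H: "homogenize (\<lambda>c. [:zconst c:]) f d U V \<noteq> 0" "degree (homogenize (\<lambda>c. [:zconst c:]) f d U V) = 0"
  obtains c \<beta> where "c \<noteq> 0" "\<beta> \<noteq> 0" "f = smult c ([:- \<beta>, 1:] ^ d)" "degree (U - [:zconst \<beta>:] * V) = 0"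
proof -
  define n where "n = max (degree U) (degree V)"
  have n: "n > 0" using UV by (auto simp: n_def)
  have fd: "coeff f d \<noteq> 0" using f by (metis leading_coeff_neq_0 degree_0 less_numeral_extra(3))
  have hom: "unital_ring_hom (\<lambda>c::'k. c)" "unital_ring_hom (\<lambda>c::'k. [:c:])"
    "unital_ring_hom (\<lambda>c::'k. [:[:c:]:])" "unital_ring_hom (zconst :: 'k \<Rightarrow> _)"
    by (auto simp: unital_ring_hom_def one_pCons unital_ring_hom_zconst)
  have zc: "(zconst :: 'k \<Rightarrow> _) = (\<lambda>c. [:[:c:]:])" by (simp add: zconst_def fun_eq_iff)
  have "coeff (homogenize (\<lambda>c. [:zconst c:]) f d U V) (n * d) = 0"
    by (rule coeff_eq_0) (use H n f in simp)
  from homogenize_descend[OF hom(4) _ f(1) fd UV(1,2) n_def[symmetric] this] obtain u1 v1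
    where 1: "u1 \<noteq> 0" "v1 \<noteq> 0" "homogenize zconst f d u1 v1 = 0"
      "\<And>g e. coeff (homogenize (\<lambda>c. [:zconst c:]) g e U V) (n * e) = homogenize zconst g e u1 v1" by auto
  have "coeff (homogenize (\<lambda>c::'k. [:[:c:]:]) f d u1 v1) (max (degree u1) (degree v1) * d) = 0"
    using 1(3) by (simp add: zc)
  from homogenize_descend[OF hom(2) _ f(1) fd 1(1,2) refl this] obtain u2 v2
    where 2: "u2 \<noteq> 0" "v2 \<noteq> 0" "homogenize (\<lambda>c. [:c:]) f d u2 v2 = 0"
      "\<And>g e. coeff (homogenize zconst g e u1 v1) (max (degree u1) (degree v1) * e) = homogenize (\<lambda>c. [:c:]) g e u2 v2"
    by (auto simp: zc)
  have "coeff (homogenize (\<lambda>c::'k. [:c:]) f d u2 v2) (max (degree u2) (degree v2) * d) = 0"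
    using 2(3) by simp
  from homogenize_descend[OF hom(1) _ f(1) fd 2(1,2) refl this] obtain u3 v3
    where 3: "u3 \<noteq> 0" "v3 \<noteq> 0" "homogenize (\<lambda>c. c) f d u3 v3 = 0"
      "\<And>g e. coeff (homogenize (\<lambda>c. [:c:]) g e u2 v2) (max (degree u2) (degree v2) * e) = homogenize (\<lambda>c. c) g e u3 v3"
    by auto
  define \<beta> where "\<beta> = u3 / v3"
  have \<beta>: "\<beta> \<noteq> 0" using 3 by (simp add: \<beta>_def)
  have root: "poly f \<beta> = 0" using 3 f by (simp add: homogenize_id \<beta>_def)
  have f0: "f \<noteq> 0" using f by auto
  define r where "r = order \<beta> f"
  from order_decomp[OF f0, of \<beta>] obtain g where g: "f = [:- \<beta>, 1:] ^ r * g" "\<not> [:- \<beta>, 1:] dvd g"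
    by (auto simp: r_def)
  have r: "r > 0" using root f0 by (simp add: r_def order_gt_0_iff)
  have g0: "poly g \<beta> \<noteq> 0" using g(2) by (simp add: poly_eq_0_iff_dvd)
  have "g \<noteq> 0" using g0 by auto
  then have d: "d = r + degree g"
    using f(2) g(1) by (simp add: degree_mult_eq degree_linear_power)
  \<comment> \<open>The form of g at (u3, v3) is a non-zero multiple of g(\<beta>). The three
    descents are now read backwards, from a non-zero leading coefficient to a non-zero form.\<close>
  have "homogenize (\<lambda>c. c) g (degree g) u3 v3 \<noteq> 0"
    using 3 g0 by (simp add: homogenize_id \<beta>_def)
  then have "homogenize (\<lambda>c. [:c:]) g (degree g) u2 v2 \<noteq> 0"
    using 3(4)[of g "degree g"] by auto
  then have "homogenize zconst g (degree g) u1 v1 \<noteq> 0"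
    using 2(4)[of g "degree g"] by auto
  then have ge: "coeff (homogenize (\<lambda>c. [:zconst c:]) g (degree g) U V) (n * degree g) \<noteq> 0"
    using 1(4)[of g "degree g"] by auto
  have hom3: "unital_ring_hom (\<lambda>c::'k. [:zconst c:])"
    by (rule unital_ring_hom_comp[OF hom(4) unital_ring_hom_const])
  have eq: "homogenize (\<lambda>c. [:zconst c:]) f d U V
      = (U - [:zconst \<beta>:] * V) ^ r * homogenize (\<lambda>c. [:zconst c:]) g (degree g) U V"
    unfolding g(1) d by (rule homogenize_linear_power[OF hom3]) simp
  then have nz: "(U - [:zconst \<beta>:] * V) ^ r \<noteq> 0" "homogenize (\<lambda>c. [:zconst c:]) g (degree g) U V \<noteq> 0"
    using H(1) by auto
  have "degree ((U - [:zconst \<beta>:] * V) ^ r) = 0" "degree (homogenize (\<lambda>c. [:zconst c:]) g (degree g) U V) = 0"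
    using H(2) nz unfolding eq by (simp_all add: degree_mult_eq)
  moreover have "n * degree g \<le> degree (homogenize (\<lambda>c. [:zconst c:]) g (degree g) U V)"
    using ge by (rule le_degree)
  ultimately have "degree g = 0" and h: "degree (U - [:zconst \<beta>:] * V) = 0"
    using n r nz by (auto simp: degree_power_eq)
  then obtain c where c: "g = [:c:]" by (metis degree_eq_zeroE)
  have "f = smult c ([:- \<beta>, 1:] ^ d)" using g(1) d c by simp
  moreover have "c \<noteq> 0" using \<open>g \<noteq> 0\<close> c by auto
  ultimately show thesis using that \<beta> h by blast
qed

section \<open>Derivations and polynomial points on the curves u^a = \<beta> v^b + const\<close>

locale derivation =
  fixes D :: "'a::comm_ring_1 \<Rightarrow> 'a"
  assumes add: "D (f + g) = D f + D g"
    and mult: "D (f * g) = D f * g + f * D g"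
begin

lemma zero [simp]: "D 0 = 0"
  using add[of 0 0] by simp

lemma one [simp]: "D 1 = 0"
  using mult[of 1 1] by simp

lemma diff: "D (f - g) = D f - D g"
  using add[of "f - g" g] by (simp add: algebra_simps)

lemma power: "D (f ^ n) = of_nat n * f ^ (n - 1) * D f"
proof (induction n)
  case (Suc n)
  have "D (f ^ Suc n) = D f * f ^ n + f * (of_nat n * f ^ (n - 1) * D f)"
    by (simp only: power_Suc mult Suc)
  then show ?case
    by (cases n) (simp_all add: algebra_simps)
qed simp

lemma sum: "D (sum g A) = (\<Sum>a\<in>A. D (g a))"
  by (induction A rule: infinite_finite_induct) (simp_all add: add)

end

lemma derivation_pderiv: "derivation (pderiv :: 'a::idom poly \<Rightarrow> _)"
  by unfold_locales (auto simp: pderiv_add pderiv_mult)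

lemma derivation_map_poly:
  assumes "derivation D"
  shows "derivation (map_poly D)"
proof -
  interpret derivation D by fact
  show ?thesis
    by unfold_locales
      (auto intro!: poly_eqI simp: coeff_map_poly add coeff_mult sum mult sum.distrib)
qed

text \<open>The equations k c_k = 0 kill every coefficient whose index is not divisible by p. The
  coefficients of g are those of f unchanged, so no p-th roots are taken.\<close>

lemma pderiv_eq_0_imp_pcompose:
  fixes f :: "'a::idom poly"
  assumes "pderiv f = 0" "CHAR('a) = p" "p > 0"
  obtains g where "f = pcompose g (monom 1 p)"
proof (rule that)
  have dv: "p dvd k" if "coeff f k \<noteq> 0" for k
  proof (cases k)
    case (Suc j)
    have "of_nat (Suc j) * coeff f (Suc j) = 0"
      using assms(1) by (metis coeff_pderiv coeff_0)
    then show ?thesis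
      using that Suc of_nat_eq_0_iff_char_dvd[where 'a = 'a, of "Suc j"] assms(2) by auto
  qed simp
  have comp: "pcompose (monom c k) (monom 1 p) = monom c (p * k)" for c :: 'a and k
  proof (induction k)
    case (Suc k)
    then show ?case
      by (simp add: monom_Suc pcompose_pCons mult_monom algebra_simps)
  qed (simp add: monom_0)
  have "f = (\<Sum>k\<le>degree f. monom (coeff f k) k)"
    by (simp add: poly_as_sum_of_monoms)
  also have "\<dots> = (\<Sum>k\<le>degree f. pcompose (monom (coeff f k) (k div p)) (monom 1 p))"
  proof (rule sum.cong[OF refl])
    fix k
    show "monom (coeff f k) k = pcompose (monom (coeff f k) (k div p)) (monom 1 p)"
      using dv[of k] by (cases "coeff f k = 0") (auto simp: comp)
  qed
  finally show "f = pcompose (\<Sum>k\<le>degree f. monom (coeff f k) (k div p)) (monom 1 p)"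
    by (simp add: pcompose_sum)
qed

text \<open>A Mason-type argument: the curves \<open>u ^ a = \<beta> * v ^ b + const\<close> with \<open>a\<close> and \<open>b\<close> coprime and at
  least 2 carry no non-constant polynomial point through the generic point \<open>(x, y)\<close>.\<close>
lemma no_polynomial_curve:
  fixes X Y :: "'r::idom poly" and x y \<beta> :: 'r
  assumes Dx: "derivation Dx" "Dx x = 1" "Dx y = 0" "Dx \<beta> = 0"
    and Dy: "derivation Dy" "Dy x = 0" "Dy y = 1" "Dy \<beta> = 0"
    and \<beta>: "\<beta> \<noteq> 0"
    and ab: "coprime a b" "a \<ge> 2" "b \<ge> 2"
    and char: "CHAR('r) > 0"
    and eq: "X ^ a - [:\<beta>:] * Y ^ b = [:x ^ a - \<beta> * y ^ b:]"
  shows "degree X = 0 \<and> degree Y = 0"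
  using eq
proof (induction "degree X + degree Y" arbitrary: X Y rule: less_induct)
  case less
  define ax where "ax = (of_nat a :: 'r)"
  define bx where "bx = (of_nat b :: 'r)"
  have xy: "x \<noteq> 0" "y \<noteq> 0"
    using Dx(1,2) Dy(1,3) derivation.zero by fastforce+
  note dp = derivation_map_poly[OF Dx(1)] derivation_map_poly[OF Dy(1)]
  interpret Dx: derivation Dx by fact
  interpret Dy: derivation Dy by fact
  interpret DX: derivation "map_poly Dx" by (rule dp)
  interpret DY: derivation "map_poly Dy" by (rule dp)
  interpret DT: derivation "pderiv :: 'r poly \<Rightarrow> _" by (rule derivation_pderiv)
  have const: "map_poly Dx [:c:] = [:Dx c:]" "map_poly Dy [:c:] = [:Dy c:]" for c
    by (auto simp: map_poly_pCons)
  have ofn: "(of_nat n :: 'r poly) = [:of_nat n:]" for n by (simp add: of_nat_poly)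
  \<comment> \<open>The equation is differentiated in three directions: \<open>Dx\<close> and
    \<open>Dy\<close> act on the coefficients, \<open>pderiv\<close> on t. The right-hand sides for
    x and y are scalar multiples of pure powers, non-zero unless p divides the exponent.\<close>
  have eqx: "[:ax:] * X ^ (a - 1) * map_poly Dx X - [:\<beta> * bx:] * Y ^ (b - 1) * map_poly Dx Y
      = [:ax * x ^ (a - 1):]"
  proof -
    have "map_poly Dx ([:\<beta>:] * Y ^ b) = [:\<beta> * bx:] * Y ^ (b - 1) * map_poly Dx Y"
      unfolding DX.mult DX.power const Dx ofn by (simp add: bx_def mult.commute)
    moreover have "map_poly Dx (X ^ a) = [:ax:] * X ^ (a - 1) * map_poly Dx X"
      unfolding DX.power ofn by (simp add: ax_def)
    moreover have "Dx (x ^ a - \<beta> * y ^ b) = ax * x ^ (a - 1)"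
      by (simp add: Dx Dx.diff Dx.mult Dx.power ax_def)
    ultimately show ?thesis
      using arg_cong[OF less.prems, of "map_poly Dx"] by (simp only: DX.diff const)
  qed
  have eqy: "[:ax:] * X ^ (a - 1) * map_poly Dy X - [:\<beta> * bx:] * Y ^ (b - 1) * map_poly Dy Y
      = [:- \<beta> * bx * y ^ (b - 1):]"
  proof -
    have "map_poly Dy ([:\<beta>:] * Y ^ b) = [:\<beta> * bx:] * Y ^ (b - 1) * map_poly Dy Y"
      unfolding DY.mult DY.power const Dy ofn by (simp add: bx_def mult.commute)
    moreover have "map_poly Dy (X ^ a) = [:ax:] * X ^ (a - 1) * map_poly Dy X"
      unfolding DY.power ofn by (simp add: ax_def)
    moreover have "Dy (x ^ a - \<beta> * y ^ b) = - \<beta> * bx * y ^ (b - 1)"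
      by (simp add: Dy Dy.diff Dy.mult Dy.power bx_def)
    ultimately show ?thesis
      using arg_cong[OF less.prems, of "map_poly Dy"] by (simp only: DY.diff const)
  qed
  have eqt: "[:ax:] * X ^ (a - 1) * pderiv X = [:\<beta> * bx:] * Y ^ (b - 1) * pderiv Y"
  proof -
    have "pderiv ([:\<beta>:] * Y ^ b) = [:\<beta> * bx:] * Y ^ (b - 1) * pderiv Y"
      unfolding DT.mult DT.power pderiv_singleton ofn by (simp add: bx_def mult.commute)
    moreover have "pderiv (X ^ a) = [:ax:] * X ^ (a - 1) * pderiv X"
      unfolding DT.power ofn by (simp add: ax_def)
    ultimately show ?thesis
      using arg_cong[OF less.prems, of pderiv] by (simp only: DT.diff pderiv_singleton) simp
  qed
  have one0: "(of_nat 1 :: 'r) \<noteq> 0" by simp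
  \<comment> \<open>Coprime exponents cannot both be divisible by the characteristic.\<close>
  have ab0: "ax \<noteq> 0 \<or> bx \<noteq> 0"
  proof (rule ccontr)
    assume "\<not> (ax \<noteq> 0 \<or> bx \<noteq> 0)"
    then have "CHAR('r) dvd a" "CHAR('r) dvd b"
      by (auto simp: ax_def bx_def of_nat_eq_0_iff_char_dvd)
    then have "CHAR('r) dvd 1" using ab(1) by (metis coprime_common_divisor)
    then show False using one0 of_nat_eq_0_iff_char_dvd[where 'a='r, of 1] by blast
  qed
  have unit: "degree Z = 0" if "Z ^ n dvd [:c:]" "c \<noteq> 0" "n > 0" for Z :: "'r poly" and n c
  proof -
    have "Z dvd [:c:]" using that(1,3) by (meson dvd_power dvd_trans)
    from dvd_imp_degree_le[OF this] that(2) show ?thesis by simp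
  qed
  have both: "degree X = 0 \<longleftrightarrow> degree Y = 0"
  proof -
    have "degree Y = 0" if "degree X = 0"
    proof -
      obtain c where c: "X = [:c:]" using \<open>degree X = 0\<close> by (metis degree_eq_zeroE)
      have "[:\<beta>:] * Y ^ b = X ^ a - [:x ^ a - \<beta> * y ^ b:]"
        using less.prems by (simp only: algebra_simps)
      also have "\<dots> = [:c ^ a - (x ^ a - \<beta> * y ^ b):]"
        by (simp add: c poly_const_pow)
      finally have "[:\<beta>:] * Y ^ b = [:c ^ a - (x ^ a - \<beta> * y ^ b):]" .
      then have "degree ([:\<beta>:] * Y ^ b) = 0" by (metis degree_pCons_0)
      then have "degree (Y ^ b) = 0" using \<beta> by simp
      then show ?thesis using ab by (cases "Y = 0") (auto simp: degree_power_eq)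
    qed
    moreover have "degree X = 0" if "degree Y = 0"
    proof -
      obtain c where c: "Y = [:c:]" using \<open>degree Y = 0\<close> by (metis degree_eq_zeroE)
      have "X ^ a = [:x ^ a - \<beta> * y ^ b:] + [:\<beta>:] * Y ^ b"
        using less.prems by (simp only: algebra_simps)
      also have "\<dots> = [:x ^ a - \<beta> * y ^ b + \<beta> * c ^ b:]"
        by (simp add: c poly_const_pow)
      finally have "X ^ a = [:x ^ a - \<beta> * y ^ b + \<beta> * c ^ b:]" .
      then have "degree (X ^ a) = 0" by (metis degree_pCons_0)
      then show ?thesis using ab by (cases "X = 0") (auto simp: degree_power_eq)
    qed
    ultimately show ?thesis by blast
  qed
  consider "ax = 0" | "bx = 0" | "ax \<noteq> 0" "bx \<noteq> 0" "pderiv X = 0" | "ax \<noteq> 0" "bx \<noteq> 0" "pderiv X \<noteq> 0"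
    by blast
  then show ?case
  proof cases
    case 1
    \<comment> \<open>With p dividing a, the y-equation loses its X-term and exhibits Y^(b-1) as a
      divisor of a non-zero constant. The next case is the mirror image.\<close>
    then have "[:- \<beta> * bx * y ^ (b - 1):] = Y ^ (b - 1) * (- ([:\<beta> * bx:] * map_poly Dy Y))"
      using eqy by (simp add: mult_ac)
    then have "Y ^ (b - 1) dvd [:- \<beta> * bx * y ^ (b - 1):]" by (metis dvd_triv_left)
    then have "degree Y = 0"
      by (rule unit) (use 1 ab0 \<beta> xy ab in auto)
    then show ?thesis using both by simp
  next
    case 2
    then have "[:ax * x ^ (a - 1):] = X ^ (a - 1) * ([:ax:] * map_poly Dx X)"
      using eqx by (simp add: algebra_simps)
    then have "X ^ (a - 1) dvd [:ax * x ^ (a - 1):]" by (metis dvd_triv_left)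
    then have "degree X = 0"
      by (rule unit) (use 2 ab0 \<beta> xy ab in auto)
    then show ?thesis using both by simp
  next
    case 3
    \<comment> \<open>Here X and Y are both polynomials in t^p. Replacing t^p by t keeps the
      equation and divides the degrees by p, which is what the induction is for.\<close>
    show ?thesis
    proof (rule ccontr)
      assume "\<not> ?thesis"
      then have deg: "degree X > 0" "degree Y > 0" using both by auto
      then have "Y ^ (b - 1) \<noteq> 0" by auto
      then have Yt: "pderiv Y = 0" using eqt 3 \<beta> by auto
      define p where "p = CHAR('r)"
      from pderiv_eq_0_imp_pcompose[OF 3(3) refl char] obtain X1
        where X1: "X = pcompose X1 (monom 1 p)" by (auto simp: p_def)
      from pderiv_eq_0_imp_pcompose[OF Yt refl char] obtain Y1
        where Y1: "Y = pcompose Y1 (monom 1 p)" by (auto simp: p_def)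
      have p1: "p > 1" using char CHAR_not_1[where 'a = 'r] unfolding p_def by linarith
      have dX: "degree X = degree X1 * p" "degree Y = degree Y1 * p"
        by (simp_all add: X1 Y1 degree_pcompose degree_monom_eq)
      have pw: "pcompose Z W ^ n = pcompose (Z ^ n) W" for Z W :: "'r poly" and n
        by (induction n) (simp_all add: pcompose_1 pcompose_mult)
      have "pcompose (X1 ^ a - [:\<beta>:] * Y1 ^ b - [:x ^ a - \<beta> * y ^ b:]) (monom 1 p) = 0"
        using less.prems by (simp add: X1 Y1 pw pcompose_diff pcompose_smult)
      then have "X1 ^ a - [:\<beta>:] * Y1 ^ b - [:x ^ a - \<beta> * y ^ b:] = 0"
        by (rule pcompose_eq_0) (use p1 in \<open>simp add: degree_monom_eq\<close>)
      then have "degree X1 = 0 \<and> degree Y1 = 0"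
        using deg p1 dX by (intro less.hyps) (auto intro!: add_strict_mono)
      then show False using deg dX by simp
    qed
  next
    case 4
    show ?thesis
    proof (rule ccontr)
      assume "\<not> ?thesis"
      then have deg: "degree X > 0" "degree Y > 0" using both by auto
      then have nz: "X \<noteq> 0" "Y \<noteq> 0" by auto
      then have Yt: "pderiv Y \<noteq> 0" using eqt 4 \<beta> by auto
      \<comment> \<open>Eliminating X^(a-1) between the x-equation and the t-equation shows that
        Y^(b-1) divides dX/dt up to a non-zero t-free factor. The symmetric elimination bounds X by
        dY/dt, and for a, b \<ge> 2 the two strict degree inequalities contradict each
        other.\<close>
      have "[:ax * x ^ (a - 1):] * pderiv X
        = ([:ax:] * X ^ (a - 1) * pderiv X) * map_poly Dx X
          - [:\<beta> * bx:] * Y ^ (b - 1) * map_poly Dx Y * pderiv X"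
        unfolding eqx[symmetric] by (simp only: algebra_simps)
      also have "\<dots> = Y ^ (b - 1) * ([:\<beta> * bx:] * (pderiv Y * map_poly Dx X - map_poly Dx Y * pderiv X))"
        unfolding eqt by (simp only: algebra_simps)
      finally have "Y ^ (b - 1) dvd [:ax * x ^ (a - 1):] * pderiv X" by (metis dvd_triv_left)
      then have "degree (Y ^ (b - 1)) \<le> degree ([:ax * x ^ (a - 1):] * pderiv X)"
        by (rule dvd_imp_degree_le) (use 4 xy in auto)
      then have "(b - 1) * degree Y \<le> degree (pderiv X)"
        using nz 4 xy by (simp add: degree_power_eq)
      moreover have "degree (pderiv X) < degree X"
        using deg 4 by (metis degree_pderiv_less)
      ultimately have less1: "(b - 1) * degree Y < degree X" by simp
      have "[:- \<beta> * bx * y ^ (b - 1):] * pderiv Y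
        = [:ax:] * X ^ (a - 1) * map_poly Dy X * pderiv Y
          - ([:\<beta> * bx:] * Y ^ (b - 1) * pderiv Y) * map_poly Dy Y"
        unfolding eqy[symmetric] by (simp only: algebra_simps)
      also have "\<dots> = X ^ (a - 1) * ([:ax:] * (map_poly Dy X * pderiv Y - pderiv X * map_poly Dy Y))"
        unfolding eqt[symmetric] by (simp only: algebra_simps)
      finally have "X ^ (a - 1) dvd [:- \<beta> * bx * y ^ (b - 1):] * pderiv Y" by (metis dvd_triv_left)
      then have "degree (X ^ (a - 1)) \<le> degree ([:- \<beta> * bx * y ^ (b - 1):] * pderiv Y)"
        by (rule dvd_imp_degree_le) (use 4 xy Yt \<beta> in auto)
      then have "(a - 1) * degree X \<le> degree (pderiv Y)"
        using nz 4 xy \<beta> by (simp add: degree_power_eq)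
      moreover have "degree (pderiv Y) < degree Y"
        using deg Yt by (metis degree_pderiv_less)
      ultimately have less2: "(a - 1) * degree X < degree Y" by simp
      have "degree Y \<le> (b - 1) * degree Y" "degree X \<le> (a - 1) * degree X"
        using ab by auto
      with less1 less2 show False by linarith
    qed
  qed
qed

section \<open>Weighted top parts\<close>

text \<open>\<open>T a f g\<close> is to be read as: all weights occurring in \<open>f\<close> are at most \<open>a\<close>, and \<open>g\<close> is the part of
  weight exactly \<open>a\<close>.\<close>
locale top_part =
  fixes T :: "real \<Rightarrow> 'a::comm_ring_1 \<Rightarrow> 'a \<Rightarrow> bool"
  assumes zero [simp]: "T a 0 0"
    and one: "T 0 1 1"
    and add: "T a f f' \<Longrightarrow> T a g g' \<Longrightarrow> T a (f + g) (f' + g')"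
    and mult: "T a f f' \<Longrightarrow> T b g g' \<Longrightarrow> T (a + b) (f * g) (f' * g')"
    and unique: "T a f f' \<Longrightarrow> T a f f'' \<Longrightarrow> f' = f''"
begin

lemma sum: "(\<And>s. s \<in> S \<Longrightarrow> T a (g s) (h s)) \<Longrightarrow> T a (sum g S) (sum h S)"
  by (induction S rule: infinite_finite_induct) (auto intro: add)

lemma power: "T a f f' \<Longrightarrow> T (real n * a) (f ^ n) (f' ^ n)"
  by (induction n) (auto simp: one algebra_simps dest: mult)

end

text \<open>Scalars carry weight 0. The bound \<open>a\<close> need not be sharp: above the actual
  weight the top part is 0, which is what makes the relation additive.\<close>

definition const_top :: "real \<Rightarrow> 'a::comm_ring_1 \<Rightarrow> 'a \<Rightarrow> bool" where
  "const_top a c d \<longleftrightarrow> (a < 0 \<longrightarrow> c = 0) \<and> d = (if a = 0 then c else 0)"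

lemma top_part_const_top: "top_part const_top"
  by unfold_locales (auto simp: const_top_def)

text \<open>Adjoins a variable of weight \<open>w\<close>; it is applied to X, to Y and then to t.
  Weights are real because the weight of t arises as a quotient, possibly a negative one.\<close>

definition lift_top :: "real \<Rightarrow> (real \<Rightarrow> 'a \<Rightarrow> 'a \<Rightarrow> bool) \<Rightarrow> real \<Rightarrow> 'a::zero poly \<Rightarrow> 'a poly \<Rightarrow> bool" where
  "lift_top w T a f g \<longleftrightarrow> (\<forall>k. T (a - real k * w) (coeff f k) (coeff g k))"

abbreviation bi_top :: "real \<Rightarrow> real \<Rightarrow> real \<Rightarrow> 'k::field poly poly \<Rightarrow> 'k poly poly \<Rightarrow> bool" where
  "bi_top w\<^sub>1 w\<^sub>2 \<equiv> lift_top w\<^sub>2 (lift_top w\<^sub>1 const_top)"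

lemma bi_top_iff:
  "bi_top w\<^sub>1 w\<^sub>2 a f g \<longleftrightarrow> (\<forall>i j. (cf f i j \<noteq> 0 \<longrightarrow> w\<^sub>1 * real i + w\<^sub>2 * real j \<le> a)
    \<and> cf g i j = (if w\<^sub>1 * real i + w\<^sub>2 * real j = a then cf f i j else 0))"
proof -
  have "const_top (a - real j * w\<^sub>2 - real i * w\<^sub>1) c d \<longleftrightarrow>
      (c \<noteq> 0 \<longrightarrow> w\<^sub>1 * real i + w\<^sub>2 * real j \<le> a) \<and> d = (if w\<^sub>1 * real i + w\<^sub>2 * real j = a then c else 0)"
    for i j :: nat and c d :: 'a
    by (auto simp: const_top_def algebra_simps)
  then show ?thesis by (auto simp: lift_top_def)
qed

lemma top_part_lift_top:
  assumes "top_part T"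
  shows "top_part (lift_top w T)"
proof -
  interpret top_part T by fact
  show ?thesis
  proof
    fix a b :: real and f f' f'' g g' :: "'a poly"
    show "lift_top w T a 0 0" by (simp add: lift_top_def)
    have "T (0 - real k * w) (coeff 1 k) (coeff 1 k)" for k
      by (cases k) (auto simp: one)
    then show "lift_top w T 0 1 1" by (simp add: lift_top_def)
    show "lift_top w T a (f + g) (f' + g')" if "lift_top w T a f f'" "lift_top w T a g g'"
      using that by (simp add: lift_top_def add)
    show "f' = f''" if "lift_top w T a f f'" "lift_top w T a f f''"
      using that by (auto simp: lift_top_def poly_eq_iff intro: unique)
    show "lift_top w T (a + b) (f * g) (f' * g')" if fg: "lift_top w T a f f'" "lift_top w T b g g'"
      unfolding lift_top_def coeff_mult
    proof (intro allI sum)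
      fix k i :: nat assume i: "i \<in> {..k}"
      have "T ((a - real i * w) + (b - real (k - i) * w)) (coeff f i * coeff g (k - i)) (coeff f' i * coeff g' (k - i))"
        using fg by (intro mult) (auto simp: lift_top_def)
      then show "T (a + b - real k * w) (coeff f i * coeff g (k - i)) (coeff f' i * coeff g' (k - i))"
        using i by (simp add: of_nat_diff algebra_simps)
    qed
  qed
qed

lemma top_part_bi_top: "top_part (bi_top w\<^sub>1 w\<^sub>2)"
  by (intro top_part_lift_top top_part_const_top)

definition homogeneous_part :: "real \<Rightarrow> real \<Rightarrow> real \<Rightarrow> 'k::field poly poly \<Rightarrow> 'k poly poly" where
  "homogeneous_part w\<^sub>1 w\<^sub>2 a f = (\<Sum>(i,j)\<in>supp f \<inter> {(i,j). w\<^sub>1 * real i + w\<^sub>2 * real j = a}. mon (cf f i j) i j)"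

lemma cf_homogeneous_part:
  "cf (homogeneous_part w\<^sub>1 w\<^sub>2 a f) i j = (if w\<^sub>1 * real i + w\<^sub>2 * real j = a then cf f i j else 0)"
proof -
  have "cf (homogeneous_part w\<^sub>1 w\<^sub>2 a f) i j
      = (if (i, j) \<in> supp f \<inter> {(i,j). w\<^sub>1 * real i + w\<^sub>2 * real j = a} then cf f i j else 0)"
    unfolding homogeneous_part_def by (rule cf_sum_mon) simp
  then show ?thesis by (auto simp: in_supp)
qed

lemma homogeneous_part_0 [simp]: "homogeneous_part w\<^sub>1 w\<^sub>2 a 0 = 0"
  by (rule cf_eqI) (simp add: cf_homogeneous_part)

lemma bi_top_homogeneous_part:
  assumes "\<And>i j. cf f i j \<noteq> 0 \<Longrightarrow> w\<^sub>1 * real i + w\<^sub>2 * real j \<le> a"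
  shows "bi_top w\<^sub>1 w\<^sub>2 a f (homogeneous_part w\<^sub>1 w\<^sub>2 a f)"
  using assms by (auto simp: bi_top_iff cf_homogeneous_part)

text \<open>Meaningful for non-zero f only, since \<open>Max\<close> of the empty set is
  unspecified.\<close>

definition weight :: "real \<Rightarrow> real \<Rightarrow> 'k::field poly poly \<Rightarrow> real" where
  "weight w\<^sub>1 w\<^sub>2 f = Max ((\<lambda>(i,j). w\<^sub>1 * real i + w\<^sub>2 * real j) ` supp f)"

lemma weight_ge: "cf f i j \<noteq> 0 \<Longrightarrow> w\<^sub>1 * real i + w\<^sub>2 * real j \<le> weight w\<^sub>1 w\<^sub>2 f"
  unfolding weight_def by (rule Max_ge) (auto simp: in_supp image_iff intro!: bexI[of _ "(i,j)"])

lemma weight_attained: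
  assumes "f \<noteq> 0"
  obtains i j where "cf f i j \<noteq> 0" "w\<^sub>1 * real i + w\<^sub>2 * real j = weight w\<^sub>1 w\<^sub>2 f"
proof -
  have "weight w\<^sub>1 w\<^sub>2 f \<in> (\<lambda>(i,j). w\<^sub>1 * real i + w\<^sub>2 * real j) ` supp f"
    unfolding weight_def by (rule Max_in) (use assms in auto)
  then show thesis using that by (auto simp: in_supp)
qed

lemma homogeneous_part_weight_nonzero:
  "f \<noteq> 0 \<Longrightarrow> homogeneous_part w\<^sub>1 w\<^sub>2 (weight w\<^sub>1 w\<^sub>2 f) f \<noteq> 0"
  by (metis weight_attained cf_homogeneous_part coeff_0)

abbreviation pconst :: "'k::field \<Rightarrow> 'k poly poly poly" where
  "pconst c \<equiv> [:zconst c:]"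

lemma unital_ring_hom_pconst: "unital_ring_hom (\<lambda>c. pconst c)"
  by (rule unital_ring_hom_comp[OF unital_ring_hom_zconst unital_ring_hom_const])

text \<open>For each monomial c X^i Y^j the bound \<open>a\<close> is shared out among the factors,
  leaving \<open>a - (real i * w\<^sub>1 + real j * w\<^sub>2)\<close> for the scalar c;
  \<open>const_top\<close> keeps c in the top part exactly when this rest is 0.\<close>

lemma top_part_bieval:
  assumes T: "top_part T" and \<iota>: "unital_ring_hom \<iota>" "\<And>b c d. const_top b c d \<Longrightarrow> T b (\<iota> c) (\<iota> d)"
    and f: "bi_top w\<^sub>1 w\<^sub>2 a f f'" and XY: "T w\<^sub>1 X X'" "T w\<^sub>2 Y Y'"
  shows "T a (bieval \<iota> X Y f) (bieval \<iota> X' Y' f')"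
proof -
  interpret top_part T by fact
  interpret \<iota>: unital_ring_hom \<iota> by fact
  have sub: "supp f' \<subseteq> supp f"
    using f by (auto simp: bi_top_iff supp_def split: if_splits)
  have "bieval \<iota> X' Y' f' = (\<Sum>(i,j)\<in>supp f. \<iota> (cf f' i j) * X' ^ i * Y' ^ j)"
    unfolding bieval_expand[OF \<iota>(1)]
    by (rule sum.mono_neutral_left) (use sub in \<open>auto simp: in_supp\<close>)
  moreover have "T a (\<iota> (cf f i j) * X ^ i * Y ^ j) (\<iota> (cf f' i j) * X' ^ i * Y' ^ j)" for i j
  proof -
    define b where "b = a - (real i * w\<^sub>1 + real j * w\<^sub>2)"
    have "const_top b (cf f i j) (cf f' i j)"
      using f[unfolded bi_top_iff, rule_format, of j i]
      by (auto simp: const_top_def b_def algebra_simps)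
    from mult[OF mult[OF \<iota>(2)[OF this] power[OF XY(1), of i]] power[OF XY(2), of j]]
    show ?thesis by (simp add: b_def)
  qed
  ultimately show ?thesis
    unfolding bieval_expand[OF \<iota>(1), of X Y f] by (auto intro!: sum)
qed

lemma lift_top_const:
  assumes "top_part T" "T a c d"
  shows "lift_top w T a [:c:] [:d:]"
  unfolding lift_top_def
proof
  interpret top_part T by fact
  fix k show "T (a - real k * w) (coeff [:c:] k) (coeff [:d:] k)"
    using assms by (cases k) auto
qed

lemma bi_top_zconst: "const_top a c d \<Longrightarrow> bi_top w\<^sub>1 w\<^sub>2 a (zconst c) (zconst d)"
  unfolding zconst_def
  by (intro lift_top_const top_part_lift_top top_part_const_top)

lemma z_autD:
  assumes "z_aut \<tau>"
  shows "unital_ring_hom \<tau>" "bij \<tau>" "\<tau> (zconst c) = zconst c"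
proof -
  have "\<tau> (zconst 1) = zconst 1" using assms unfolding z_aut_def by blast
  then show "unital_ring_hom \<tau>" "bij \<tau>" "\<tau> (zconst c) = zconst c"
    using assms by (auto simp: z_aut_def unital_ring_hom_def)
qed

lemma z_autI:
  assumes "unital_ring_hom \<tau>" "\<And>c. \<tau> (zconst c) = zconst c" "bij \<tau>"
  shows "z_aut \<tau>"
  using assms by (auto simp: z_aut_def unital_ring_hom_def)

lemma z_aut_inv: "z_aut \<tau> \<Longrightarrow> z_aut (inv \<tau>)"
proof -
  assume \<tau>: "z_aut \<tau>"
  interpret unital_ring_hom \<tau> using z_autD(1)[OF \<tau>] .
  have i: "inv \<tau> (\<tau> q) = q" "\<tau> (inv \<tau> q) = q" for q
    using z_autD(2)[OF \<tau>] by (auto simp: bij_is_inj bij_is_surj surj_f_inv_f)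
  show ?thesis
  proof (rule z_autI)
    show "unital_ring_hom (inv \<tau>)"
      by unfold_locales (metis i add, metis i mult, metis i one)
    show "inv \<tau> (zconst c) = zconst c" for c using i z_autD(3)[OF \<tau>] by metis
    show "bij (inv \<tau>)" using z_autD(2)[OF \<tau>] by (rule bij_imp_bij_inv)
  qed
qed

lemma z_aut_comp: "z_aut \<sigma> \<Longrightarrow> z_aut \<tau> \<Longrightarrow> z_aut (\<sigma> \<circ> \<tau>)"
  by (auto simp: z_aut_def intro: bij_comp)

text \<open>The automorphism \<open>\<tau>\<close> transports the translation \<open>Y \<mapsto> Y + t\<close> to an action fixing \<open>\<tau> X\<close>; its part of
  top weight, for the smallest weight of \<open>t\<close> that keeps it non-trivial, fixes the top part of \<open>\<tau> X\<close>.\<close>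
lemma homogeneous_action:
  fixes \<tau> :: "'k::field poly poly \<Rightarrow> 'k poly poly"
  assumes \<tau>: "z_aut \<tau>" and P: "bi_top w\<^sub>1 w\<^sub>2 a (\<tau> varX) P'"
  obtains X Y :: "'k poly poly poly"
  where "coeff X 0 = varX" "coeff Y 0 = varY" "degree X > 0 \<or> degree Y > 0"
    "bieval (\<lambda>c. pconst c) X Y P' = [:P':]"
proof -
  interpret \<tau>: unital_ring_hom \<tau> using z_autD(1)[OF \<tau>] .
  note hom_inv = z_autD(1)[OF z_aut_inv[OF \<tau>]]
  have inv: "inv \<tau> (\<tau> q) = q" "\<tau> (inv \<tau> q) = q" for q
    using z_autD(2)[OF \<tau>] by (auto simp: bij_is_inj bij_is_surj surj_f_inv_f)
  define sh where "sh = bieval (\<lambda>c::'k. pconst c) [:varX:] [:varY, 1:]"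
  have hom_sh: "unital_ring_hom sh"
    unfolding sh_def by (rule unital_ring_hom_bieval[OF unital_ring_hom_pconst])
  have sh: "sh varX = [:varX:]" "sh varY = [:varY, 1:]" "sh (zconst c) = pconst c" for c
    by (simp_all add: sh_def unital_ring_hom_pconst)
  \<comment> \<open>The conjugate of Y \<mapsto> Y + t by \<tau>: it fixes \<tau> X, sends \<tau> Y
    to \<tau> Y + t, and is the identity at t = 0.\<close>
  define \<phi> where "\<phi> = (\<lambda>q. map_poly \<tau> (sh (inv \<tau> q)))"
  have hom_\<phi>: "unital_ring_hom \<phi>"
    unfolding \<phi>_def
    by (intro unital_ring_hom_comp[OF hom_inv] unital_ring_hom_comp[OF hom_sh]
        unital_ring_hom_map_poly z_autD(1) \<tau>)
  have \<phi>: "\<phi> (zconst c) = pconst c" "\<phi> (\<tau> varX) = [:\<tau> varX:]" "\<phi> (\<tau> varY) = [:\<tau> varY, 1:]" for c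
    by (simp_all add: \<phi>_def inv sh z_autD(3)[OF z_aut_inv[OF \<tau>]] z_autD(3)[OF \<tau>] map_poly_pCons)
  have \<phi>0: "coeff (\<phi> q) 0 = q" for q
  proof -
    have "coeff (sh q) 0 = q" for q
      by (induction q rule: bivariate_induct)
        (simp_all add: sh unital_ring_hom.add[OF hom_sh] unital_ring_hom.mult[OF hom_sh] coeff_mult)
    then show ?thesis by (simp add: \<phi>_def coeff_map_poly inv)
  qed
  have \<phi>_eq: "\<phi> q = bieval (\<lambda>c. pconst c) (\<phi> varX) (\<phi> varY) q" for q
    by (rule bivariate_hom_unique[OF hom_\<phi> unital_ring_hom_bieval[OF unital_ring_hom_pconst]])
      (simp_all add: \<phi> unital_ring_hom_pconst)
  have nonconst: "degree (\<phi> varX) > 0 \<or> degree (\<phi> varY) > 0"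
  proof (rule ccontr)
    assume *: "\<not> ?thesis"
    then obtain x y where xy: "\<phi> varX = [:x:]" "\<phi> varY = [:y:]"
      by (meson degree_eq_zeroE neq0_conv)
    have "\<exists>c. \<phi> q = [:c:]" for q
      by (induction q rule: bivariate_induct)
        (auto simp: \<phi> xy unital_ring_hom.add[OF hom_\<phi>] unital_ring_hom.mult[OF hom_\<phi>])
    from this[of "\<tau> varY"] show False by (simp add: \<phi>)
  qed
  \<comment> \<open>\<open>W w Z\<close> collects the weights of t at which some t^k-coefficient of
    Z, with k > 0, just reaches the bound \<open>w\<close>. Their minimum \<omega> is the largest
    weight of t for which no term exceeds its bound, and at \<omega> some term containing t survives
    in the top part.\<close>
  define W where "W = (\<lambda>w Z. (\<lambda>k. (w - weight w\<^sub>1 w\<^sub>2 (coeff Z k)) / real k)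
      ` {k. k > 0 \<and> coeff Z k \<noteq> (0 :: 'k poly poly)})"
  have finW: "finite (W w Z)" for w Z
    unfolding W_def
    by (rule finite_imageI, rule finite_subset[of _ "{..degree Z}"]) (auto intro: le_degree)
  have neW: "W w Z \<noteq> {}" if "degree Z > 0" for w Z
  proof -
    have "coeff Z (degree Z) \<noteq> 0" using that by auto
    then show ?thesis using that unfolding W_def by blast
  qed
  define S where "S = W w\<^sub>1 (\<phi> varX) \<union> W w\<^sub>2 (\<phi> varY)"
  define \<omega> where "\<omega> = Min S"
  have S: "finite S" "S \<noteq> {}" using finW neW nonconst by (auto simp: S_def)
  define hat where "hat = (\<lambda>w (Z :: 'k poly poly poly). \<Sum>k\<le>degree Z. monom (homogeneous_part w\<^sub>1 w\<^sub>2 (w - real k * \<omega>) (coeff Z k)) k)"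
  have coeff_hat: "coeff (hat w Z) k = homogeneous_part w\<^sub>1 w\<^sub>2 (w - real k * \<omega>) (coeff Z k)" for w Z k
    by (auto simp: hat_def coeff_sum coeff_eq_0 intro: le_degree)
  have top: "lift_top \<omega> (bi_top w\<^sub>1 w\<^sub>2) w Z (hat w Z)"
    if W: "W w Z \<subseteq> S" and Z0: "\<And>i j. cf (coeff Z 0) i j \<noteq> 0 \<Longrightarrow> w\<^sub>1 * real i + w\<^sub>2 * real j \<le> w" for w Z
    unfolding lift_top_def[of \<omega>] coeff_hat
  proof (intro allI bi_top_homogeneous_part)
    fix k i j assume nz: "cf (coeff Z k) i j \<noteq> 0"
    show "w\<^sub>1 * real i + w\<^sub>2 * real j \<le> w - real k * \<omega>"
    proof (cases "k = 0")
      case False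
      have "coeff Z k \<noteq> 0" using nz by auto
      then have "(w - weight w\<^sub>1 w\<^sub>2 (coeff Z k)) / real k \<in> S"
        using False W by (auto simp: W_def)
      then have "\<omega> \<le> (w - weight w\<^sub>1 w\<^sub>2 (coeff Z k)) / real k"
        using S by (simp add: \<omega>_def)
      then have "real k * \<omega> \<le> w - weight w\<^sub>1 w\<^sub>2 (coeff Z k)"
        using False by (simp add: field_simps)
      then show ?thesis using weight_ge[OF nz, of w\<^sub>1 w\<^sub>2] by linarith
    qed (use nz Z0 in auto)
  qed
  have pos: "degree (hat w Z) > 0" if \<omega>W: "\<omega> \<in> W w Z" for w Z
  proof -
    obtain k where k: "k > 0" "coeff Z k \<noteq> 0" "\<omega> = (w - weight w\<^sub>1 w\<^sub>2 (coeff Z k)) / real k"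
      using \<omega>W by (auto simp: W_def)
    then have "w - real k * \<omega> = weight w\<^sub>1 w\<^sub>2 (coeff Z k)" by simp
    then have "coeff (hat w Z) k \<noteq> 0"
      using k by (simp add: coeff_hat homogeneous_part_weight_nonzero)
    then show ?thesis using k le_degree[of "hat w Z" k] by simp
  qed
  define X where "X = hat w\<^sub>1 (\<phi> varX)"
  define Y where "Y = hat w\<^sub>2 (\<phi> varY)"
  have cfX: "cf (varX :: 'k poly poly) i j = (if i = 1 \<and> j = 0 then 1 else 0)" for i j
    by (cases i; cases j) (auto simp: varX_def coeff_pCons split: nat.splits)
  have cfY: "cf (varY :: 'k poly poly) i j = (if i = 0 \<and> j = 1 then 1 else 0)" for i j
    by (cases i; cases j) (auto simp: varY_def coeff_pCons split: nat.splits)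
  have TX: "lift_top \<omega> (bi_top w\<^sub>1 w\<^sub>2) w\<^sub>1 (\<phi> varX) X"
    unfolding X_def by (rule top) (auto simp: S_def \<phi>0 cfX split: if_splits)
  have TY: "lift_top \<omega> (bi_top w\<^sub>1 w\<^sub>2) w\<^sub>2 (\<phi> varY) Y"
    unfolding Y_def by (rule top) (auto simp: S_def \<phi>0 cfY split: if_splits)
  interpret T3: top_part "lift_top \<omega> (bi_top w\<^sub>1 w\<^sub>2)"
    by (rule top_part_lift_top[OF top_part_bi_top])
  show thesis
  proof (rule that)
    show "coeff X 0 = varX" "coeff Y 0 = varY"
      by (auto intro!: cf_eqI simp: X_def Y_def coeff_hat \<phi>0 cf_homogeneous_part cfX cfY)
    have "\<omega> \<in> S" using S by (simp add: \<omega>_def)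
    then show "degree X > 0 \<or> degree Y > 0"
      using pos[of w\<^sub>1 "\<phi> varX"] pos[of w\<^sub>2 "\<phi> varY"] unfolding S_def X_def Y_def by (metis UnE)
    \<comment> \<open>Since \<tau> X is fixed by \<phi>, its top part can be read off in two ways:
      from the substitution and from the t-free element itself.\<close>
    have "lift_top \<omega> (bi_top w\<^sub>1 w\<^sub>2) a [:\<tau> varX:] (bieval (\<lambda>c. pconst c) X Y P')"
      using top_part_bieval[OF top_part_lift_top[OF top_part_bi_top] unital_ring_hom_pconst
          lift_top_const[OF top_part_bi_top bi_top_zconst] P TX TY] \<phi>_eq[of "\<tau> varX"] \<phi>(2) by simp
    moreover have "lift_top \<omega> (bi_top w\<^sub>1 w\<^sub>2) a [:\<tau> varX:] [:P':]"
      by (rule lift_top_const[OF top_part_bi_top P])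
    ultimately show "bieval (\<lambda>c. pconst c) X Y P' = [:P':]" by (rule T3.unique)
  qed
qed

section \<open>The top form of a coordinate\<close>

lemma derivation_dX: "derivation (dX :: 'k::field poly poly \<Rightarrow> _)"
  using derivation_map_poly[OF derivation_pderiv] by (simp add: dX_def[abs_def])

lemma derivation_dY: "derivation (dY :: 'k::field poly poly \<Rightarrow> _)"
  using derivation_pderiv by (simp add: dY_def[abs_def])

lemma dX_dY_simps [simp]:
  "dX (zconst c) = 0" "dY (zconst c) = 0" "dX varX = 1" "dX varY = 0" "dY varX = 0" "dY varY = 1"
  by (simp_all add: dX_def dY_def zconst_def varX_def varY_def map_poly_pCons pderiv_pCons one_pCons)

text \<open>Writing t for one of the variables merely rearranges K[X,Y] as a polynomial ring in t. A
  substitution for that variable then becomes a \<open>pcompose\<close>, whose degree is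
  known.\<close>

lemma coeff_pconst_powers:
  fixes q :: "'k::field poly poly"
  shows "cf (coeff (bieval (\<lambda>c. pconst c) [:varX:] [:0, 1:] q) j) i 0 = cf q i j"
    and "cf (coeff (bieval (\<lambda>c. pconst c) [:0, 1:] [:varY:] q) i) 0 j = cf q i j"
proof -
  have t: "[:0, 1:] ^ n = monom (1 :: 'k poly poly) n" for n
    by (simp add: monom_altdef)
  have m1: "pconst c * [:varX:] ^ a * [:0, 1:] ^ b = monom (mon c a 0) b" for c :: 'k and a b
    by (simp add: t poly_const_pow mon_eq smult_monom)
  have m2: "pconst c * [:0, 1:] ^ a * [:varY:] ^ b = monom (mon c 0 b) a" for c :: 'k and a b
    by (simp add: t poly_const_pow mon_eq smult_monom mult_ac)
  have "(\<Sum>s\<in>supp q. cf (coeff (monom (mon (cf q (fst s) (snd s)) (fst s) 0) (snd s)) j) i 0)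
      = (\<Sum>s\<in>supp q. if s = (i, j) then cf q i j else 0)"
    by (rule sum.cong) (auto simp: cf_mon)
  then show "cf (coeff (bieval (\<lambda>c. pconst c) [:varX:] [:0, 1:] q) j) i 0 = cf q i j"
    unfolding bieval_expand[OF unital_ring_hom_pconst] case_prod_unfold m1 by (simp add: coeff_sum in_supp)
  have "(\<Sum>s\<in>supp q. cf (coeff (monom (mon (cf q (fst s) (snd s)) 0 (snd s)) (fst s)) i) 0 j)
      = (\<Sum>s\<in>supp q. if s = (i, j) then cf q i j else 0)"
    by (rule sum.cong) (auto simp: cf_mon)
  then show "cf (coeff (bieval (\<lambda>c. pconst c) [:0, 1:] [:varY:] q) i) 0 j = cf q i j"
    unfolding bieval_expand[OF unital_ring_hom_pconst] case_prod_unfold m2 by (simp add: coeff_sum in_supp)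
qed

lemma unital_ring_hom_pcompose: "unital_ring_hom (\<lambda>f. pcompose f (g :: 'a::comm_ring_1 poly))"
  by unfold_locales (simp_all add: pcompose_add pcompose_mult pcompose_1)

text \<open>With X fixed, the substitution Y \<mapsto> Z multiplies the degree of q in Y by the
  t-degree of Z, so a t-free value leaves no Y in q.\<close>

lemma bieval_const_left:
  assumes "degree (bieval (\<lambda>c::'k::field. pconst c) [:varX:] Z q) = 0" "degree Z > 0" "cf q i j \<noteq> 0"
  shows "j = 0"
proof -
  let ?r = "bieval (\<lambda>c::'k. pconst c) [:varX:] [:0, 1:]"
  have "bieval (\<lambda>c::'k. pconst c) [:varX:] Z q = pcompose (?r q) Z"
    by (rule bivariate_hom_unique[OF unital_ring_hom_bieval[OF unital_ring_hom_pconst]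
      unital_ring_hom_comp[OF unital_ring_hom_bieval[OF unital_ring_hom_pconst] unital_ring_hom_pcompose]])
      (simp_all add: unital_ring_hom_pconst pcompose_pCons)
  then have "degree (?r q) = 0" using assms(1,2) by (simp add: degree_pcompose)
  then show ?thesis
    using assms(3) coeff_pconst_powers(1)[of q j i] by (cases j) (auto simp: coeff_eq_0)
qed

lemma bieval_const_right:
  assumes "degree (bieval (\<lambda>c::'k::field. pconst c) Z [:varY:] q) = 0" "degree Z > 0" "cf q i j \<noteq> 0"
  shows "i = 0"
proof -
  let ?r = "bieval (\<lambda>c::'k. pconst c) [:0, 1:] [:varY:]"
  have "bieval (\<lambda>c::'k. pconst c) Z [:varY:] q = pcompose (?r q) Z"
    by (rule bivariate_hom_unique[OF unital_ring_hom_bieval[OF unital_ring_hom_pconst]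
      unital_ring_hom_comp[OF unital_ring_hom_bieval[OF unital_ring_hom_pconst] unital_ring_hom_pcompose]])
      (simp_all add: unital_ring_hom_pconst pcompose_pCons)
  then have "degree (?r q) = 0" using assms(1,2) by (simp add: degree_pcompose)
  then show ?thesis
    using assms(3) coeff_pconst_powers(2)[of q i j] by (cases i) (auto simp: coeff_eq_0)
qed

lemma varX_dvdI:
  fixes q :: "'k::field poly poly"
  assumes "\<And>i j. cf q i j \<noteq> 0 \<Longrightarrow> i > 0"
  shows "varX dvd q"
proof -
  have "varX dvd (\<Sum>(i,j)\<in>supp q. mon (cf q i j) i j)"
    unfolding mon_eq by (rule dvd_sum) (use assms in \<open>auto simp: in_supp intro!: dvd_mult2[OF dvd_mult[OF dvd_power]]\<close>)
  then show ?thesis by (simp add: sum_mon_supp)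
qed

lemma varY_dvdI:
  fixes q :: "'k::field poly poly"
  assumes "\<And>i j. cf q i j \<noteq> 0 \<Longrightarrow> j > 0"
  shows "varY dvd q"
proof -
  have "varY dvd (\<Sum>(i,j)\<in>supp q. mon (cf q i j) i j)"
    unfolding mon_eq by (rule dvd_sum) (use assms in \<open>auto simp: in_supp intro!: dvd_mult[OF dvd_power]\<close>)
  then show ?thesis by (simp add: sum_mon_supp)
qed

lemma line_lattice_points:
  fixes a b d i j :: nat
  assumes "coprime a b" "a > 0" "b > 0" "b * i + a * j = a * b * d"
  obtains k where "k \<le> d" "i = a * k" "j = b * (d - k)"
proof -
  have "a dvd b * i"
    using assms(4) by (metis dvd_add_left_iff dvd_triv_left mult.assoc)
  then have "a dvd i" using assms(1) by (simp add: coprime_dvd_mult_right_iff)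
  then obtain k where k: "i = a * k" by auto
  have "a * (b * k + j) = a * (b * d)" using assms(4) by (simp add: k algebra_simps)
  then have e: "b * k + j = b * d" using assms(2) by (simp only: mult_cancel1) auto
  then have "b * k \<le> b * d" by linarith
  then have "k \<le> d" using assms(3) by simp
  moreover have "j = b * (d - k)" using e by (simp add: diff_mult_distrib2)
  ultimately show thesis using that k by blast
qed

text \<open>The weights n and m put (m, 0) and (0, n) on one line. Under the action a divisor of the
  top form Q becomes a divisor of the t-free element Q, hence t-free. Since X and Y both move,
  neither divides Q; so Q meets both axes, and the bounds m and n pin its support to the segment
  between these two points, where Q is a binary form in X^a and Y^b.\<close>

lemma coordinate_top_form:
  fixes \<tau> :: "'k::field poly poly \<Rightarrow> 'k poly poly"
  assumes \<tau>: "z_aut \<tau>" and char: "CHAR('k) > 0" and mn: "m > 0" "n > 0"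
    and bd': "\<forall>i j. cf (\<tau> varX) i j \<noteq> 0 \<longrightarrow> i \<le> m \<and> j \<le> n"
    and att: "\<exists>j. cf (\<tau> varX) m j \<noteq> 0" "\<exists>i. cf (\<tau> varX) i n \<noteq> 0"
  obtains c \<beta> k where "c \<noteq> 0" "\<beta> \<noteq> 0" "n = k * m"
      "bi_top n m (real (m * n)) (\<tau> varX) (zconst c * (varX - zconst \<beta> * varY ^ k) ^ m)"
    | c \<beta> k where "c \<noteq> 0" "\<beta> \<noteq> 0" "m = k * n"
      "bi_top n m (real (m * n)) (\<tau> varX) (zconst c * (varX ^ k - zconst \<beta> * varY) ^ n)"
proof -
  note bd = bd'[rule_format]
  define P where "P = \<tau> varX"
  define D where "D = weight n m P"
  define Q where "Q = homogeneous_part n m D P"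
  have top: "bi_top n m D P Q"
    unfolding Q_def D_def by (rule bi_top_homogeneous_part) (rule weight_ge)
  have cfQ: "cf Q i j = (if real (n * i + m * j) = D then cf P i j else 0)" for i j
    by (simp add: Q_def cf_homogeneous_part)
  have P0: "P \<noteq> 0" using att by (auto simp: P_def)
  have Q0: "Q \<noteq> 0" unfolding Q_def D_def using P0 by (rule homogeneous_part_weight_nonzero)
  obtain j0 where j0: "cf P m j0 \<noteq> 0" using att by (auto simp: P_def)
  obtain i0 where i0: "cf P i0 n \<noteq> 0" using att by (auto simp: P_def)
  have D1: "real (n * m + m * j0) \<le> D" using weight_ge[OF j0, of n m] by (simp add: D_def)
  have D2: "real (n * i0 + m * n) \<le> D" using weight_ge[OF i0, of n m] by (simp add: D_def)
  from homogeneous_action[OF \<tau> top[unfolded P_def]] obtain X Y where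
    XY: "coeff X 0 = varX" "coeff Y 0 = varY" "degree X > 0 \<or> degree Y > 0"
      "bieval (\<lambda>c. pconst c) X Y Q = [:Q:]" .
  define E where "E = bieval (\<lambda>c::'k. pconst c) X Y"
  have homE: "unital_ring_hom E"
    unfolding E_def by (rule unital_ring_hom_bieval[OF unital_ring_hom_pconst])
  have E: "E varX = X" "E varY = Y" "E (zconst c) = pconst c" "E Q = [:Q:]" for c
    using XY by (simp_all add: E_def unital_ring_hom_pconst)
  \<comment> \<open>If Q were a polynomial in X alone, comparing its weight with that of the
    monomials attaining m and n would force Y^n to occur in Q as well.\<close>
  have notx: "\<not> (\<forall>i j. cf Q i j \<noteq> 0 \<longrightarrow> j = 0)"
  proof
    assume *: "\<forall>i j. cf Q i j \<noteq> 0 \<longrightarrow> j = 0"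
    obtain i j where ij: "cf Q i j \<noteq> 0" using Q0 by (metis cf_eqI coeff_0)
    then have "j = 0" using * by blast
    then have "real (n * i) = D" "i \<le> m"
      using ij bd[of j i] by (auto simp: cfQ P_def split: if_splits)
    then have "n * m + m * j0 \<le> n * i" "n * i0 + m * n \<le> n * i" using D1 D2 by linarith+
    moreover have "n * i \<le> n * m" using \<open>i \<le> m\<close> by simp
    ultimately have "n * i = n * m" "n * i0 = 0" using mult.commute[of n m] by linarith+
    then have "i0 = 0" "D = real (n * i0 + m * n)" using mn \<open>real (n * i) = D\<close> by auto
    then have "cf Q i0 n \<noteq> 0" using i0 by (simp add: cfQ)
    then show False using * mn by auto
  qed
  have noty: "\<not> (\<forall>i j. cf Q i j \<noteq> 0 \<longrightarrow> i = 0)"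
  proof
    assume *: "\<forall>i j. cf Q i j \<noteq> 0 \<longrightarrow> i = 0"
    obtain i j where ij: "cf Q i j \<noteq> 0" using Q0 by (metis cf_eqI coeff_0)
    then have "i = 0" using * by blast
    then have "real (m * j) = D" "j \<le> n"
      using ij bd[of j i] by (auto simp: cfQ P_def split: if_splits)
    then have "n * m + m * j0 \<le> m * j" "n * i0 + m * n \<le> m * j" using D1 D2 by linarith+
    moreover have "m * j \<le> m * n" using \<open>j \<le> n\<close> by simp
    ultimately have "m * j = m * n" "m * j0 = 0" using mult.commute[of n m] by linarith+
    then have "j0 = 0" "D = real (n * m + m * j0)" using mn \<open>real (m * j) = D\<close> by auto
    then have "cf Q m j0 \<noteq> 0" using j0 by (simp add: cfQ)
    then show False using * mn by auto
  qed
  have const: "Z = [:coeff Z 0:]" if "degree Z = 0" for Z :: "'k poly poly poly"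
    using that by (metis degree_eq_zeroE coeff_pCons_0)
  have degX: "degree X > 0"
  proof (rule ccontr)
    assume "\<not> ?thesis"
    then have "X = [:varX:]" "degree Y > 0" using XY const[of X] by auto
    then show False using XY(4) notx bieval_const_left[of Y Q] by auto
  qed
  have degY: "degree Y > 0"
  proof (rule ccontr)
    assume "\<not> ?thesis"
    then have "Y = [:varY:]" "degree X > 0" using XY const[of Y] by auto
    then show False using XY(4) noty bieval_const_right[of X Q] by auto
  qed
  have unit: "degree (E q) = 0" if "q dvd Q" for q
  proof -
    obtain r where "Q = q * r" using \<open>q dvd Q\<close> by auto
    then have "E q * E r = [:Q:]" using E(4) by (simp add: unital_ring_hom.mult[OF homE])
    then have "E q dvd [:Q:]" by (metis dvd_triv_left)
    from dvd_imp_degree_le[OF this] show ?thesis using Q0 by simp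
  qed
  obtain J where J: "cf Q 0 J \<noteq> 0"
    using varX_dvdI[of Q] unit[of varX] degX E by (metis less_irrefl neq0_conv)
  obtain I where I: "cf Q I 0 \<noteq> 0"
    using varY_dvdI[of Q] unit[of varY] degY E by (metis less_irrefl neq0_conv)
  have Jn: "J = n" "D = real (m * n)"
  proof -
    have "real (m * J) = D" "J \<le> n" using J bd[of J 0] by (auto simp: cfQ P_def split: if_splits)
    then have "m * n \<le> m * J" using D2 by (metis add_leD2 of_nat_le_iff)
    then show "J = n" using mn \<open>J \<le> n\<close> by simp
    then show "D = real (m * n)" using \<open>real (m * J) = D\<close> by simp
  qed
  have Im: "I = m"
    using I Jn mn by (auto simp: cfQ split: if_splits simp flip: of_nat_mult)
  define d where "d = gcd m n"
  define a where "a = m div d"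
  define b where "b = n div d"
  have d: "d > 0" "m = a * d" "n = b * d" and ab: "coprime a b" "a > 0" "b > 0"
    using mn div_gcd_coprime[of m n] by (auto simp: d_def a_def b_def div_greater_zero_iff)
  have onl: "\<exists>k\<le>d. i = a * k \<and> j = b * (d - k)" if "cf Q i j \<noteq> 0" for i j
  proof -
    have "real (n * i + m * j) = real (m * n)"
      using that Jn by (simp add: cfQ split: if_splits)
    then have "n * i + m * j = m * n" by (simp only: of_nat_eq_iff)
    then have "d * (b * i + a * j) = d * (a * b * d)" by (simp add: d algebra_simps)
    then have "b * i + a * j = a * b * d" using d(1) by (simp only: mult_cancel1) auto
    from line_lattice_points[OF ab this] show ?thesis by metis
  qed
  \<comment> \<open>The coefficients of Q along the segment, read as a polynomial in T = X^a /
    Y^b.\<close>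
  define f where "f = (\<Sum>k\<le>d. monom (cf Q (a * k) (b * (d - k))) k)"
  have cof: "coeff f k = (if k \<le> d then cf Q (a * k) (b * (d - k)) else 0)" for k
    by (auto simp: f_def coeff_sum)
  have f0: "coeff f 0 \<noteq> 0" using J Jn d by (simp add: cof)
  have "coeff f d \<noteq> 0" using I Im d by (simp add: cof)
  moreover have "degree f \<le> d" by (rule degree_le) (simp add: cof)
  ultimately have fd: "degree f = d" by (simp add: le_antisym le_degree)
  have Qf: "Q = homogenize zconst f d (varX ^ a) (varY ^ b)"
  proof -
    let ?g = "\<lambda>k. (a * k, b * (d - k))"
    have "Q = (\<Sum>(i,j)\<in>supp Q. mon (cf Q i j) i j)" by (simp add: sum_mon_supp)
    also have "\<dots> = (\<Sum>(i,j)\<in>?g ` {..d}. mon (cf Q i j) i j)"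
    proof (rule sum.mono_neutral_left)
      show "supp Q \<subseteq> ?g ` {..d}"
      proof
        fix s assume "s \<in> supp Q"
        then have "cf Q (fst s) (snd s) \<noteq> 0" by (cases s) (simp add: in_supp)
        from onl[OF this] obtain k where "k \<le> d" "fst s = a * k" "snd s = b * (d - k)" by blast
        then show "s \<in> ?g ` {..d}" by (intro image_eqI[of _ _ k]) (auto simp: prod_eq_iff)
      qed
    qed (auto simp: in_supp mon_def)
    also have "\<dots> = (\<Sum>k\<le>d. mon (cf Q (a * k) (b * (d - k))) (a * k) (b * (d - k)))"
      by (subst sum.reindex) (use ab in \<open>auto simp: inj_on_def\<close>)
    also have "\<dots> = homogenize zconst f d (varX ^ a) (varY ^ b)"
      by (simp add: homogenize_def cof mon_eq power_mult)
    finally show ?thesis .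
  qed
  have EQ: "homogenize (\<lambda>c. pconst c) f d (X ^ a) (Y ^ b) = [:Q:]"
    using E(4) unfolding Qf homogenize_hom[OF homE] by (simp add: E unital_ring_hom.power[OF homE])
  have nzXY: "X \<noteq> 0" "Y \<noteq> 0" using degX degY by auto
  obtain c \<beta> where c\<beta>: "c \<noteq> 0" "\<beta> \<noteq> 0" "f = smult c ([:- \<beta>, 1:] ^ d)"
    "degree (X ^ a - pconst \<beta> * Y ^ b) = 0"
  proof (rule binary_form_pure_power[OF f0 fd d(1)])
    show "X ^ a \<noteq> 0" "Y ^ b \<noteq> 0" using nzXY by auto
    show "degree (X ^ a) > 0 \<or> degree (Y ^ b) > 0" using nzXY degX ab by (simp add: degree_power_eq)
    show "homogenize (\<lambda>c. pconst c) f d (X ^ a) (Y ^ b) \<noteq> 0" unfolding EQ using Q0 by simp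
    show "degree (homogenize (\<lambda>c. pconst c) f d (X ^ a) (Y ^ b)) = 0" unfolding EQ by simp
  qed
  have Qc: "Q = zconst c * (varX ^ a - zconst \<beta> * varY ^ b) ^ d"
    using homogenize_linear_power[OF unital_ring_hom_zconst, of "[:c:]" 0 \<beta> d "varX ^ a" "varY ^ b"]
    by (simp add: Qf c\<beta>(3) mult.commute)
  have c0: "coeff (Z ^ k) 0 = coeff Z 0 ^ k" for Z :: "'k poly poly poly" and k
    by (induction k) (simp_all add: coeff_mult)
  \<comment> \<open>At t = 0 the action is the identity, so this t-free element equals its initial
    value; that is the equation of the curve excluded above.\<close>
  have "X ^ a - pconst \<beta> * Y ^ b = [:varX ^ a - zconst \<beta> * varY ^ b:]"
    using const[OF c\<beta>(4)] XY by (simp add: c0 coeff_mult)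
  then have curve: "X ^ a - [:zconst \<beta>:] * Y ^ b = [:varX ^ a - zconst \<beta> * varY ^ b:]" .
  have "\<not> (a \<ge> 2 \<and> b \<ge> 2)"
    using no_polynomial_curve[OF derivation_dX _ _ _ derivation_dY _ _ _ _ ab(1) _ _ _ curve]
      degX c\<beta> char by auto
  then consider "a = 1" | "b = 1" using ab by linarith
  then show thesis
  proof cases
    case 1
    then have "n = b * m" "Q = zconst c * (varX - zconst \<beta> * varY ^ b) ^ m"
      using d Qc by auto
    then show thesis using that(1)[of c \<beta> b] c\<beta> top Jn by (simp add: P_def)
  next
    case 2
    then have "m = a * n" "Q = zconst c * (varX ^ a - zconst \<beta> * varY) ^ n"
      using d Qc by auto
    then show thesis using that(2)[of c \<beta> a] c\<beta> top Jn by (simp add: P_def)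
  qed
qed

section \<open>Tameness of plane automorphisms\<close>

text \<open>As Y is the outer variable, \<open>map_poly (\<lambda>c. [:c:]) f\<close> is f(Y),
  whereas \<open>[:f:]\<close> is f(X).\<close>

definition elementaryX :: "'k::field poly \<Rightarrow> 'k poly poly \<Rightarrow> 'k poly poly" where
  "elementaryX f = bieval zconst (varX + map_poly (\<lambda>c. [:c:]) f) varY"

definition elementaryY :: "'k::field poly \<Rightarrow> 'k poly poly \<Rightarrow> 'k poly poly" where
  "elementaryY f = bieval zconst varX (varY + [:f:])"

definition rotation :: "'k::field poly poly \<Rightarrow> 'k poly poly" where
  "rotation = bieval zconst (- varY) varX"

text \<open>The inverse factor on Y reflects the Weyl relation, which makes d scale inversely to
  x.\<close>

definition diagonal :: "'k::field \<Rightarrow> 'k poly poly \<Rightarrow> 'k poly poly" where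
  "diagonal \<alpha> = bieval zconst (zconst \<alpha> * varX) (zconst (inverse \<alpha>) * varY)"

definition dilation :: "'k::field \<Rightarrow> 'k poly poly \<Rightarrow> 'k poly poly" where
  "dilation c = bieval zconst (zconst c * varX) varY"

lemmas unital_ring_hom_subst = unital_ring_hom_bieval[OF unital_ring_hom_zconst]

lemma unital_ring_hom_generators:
  "unital_ring_hom (elementaryX f)" "unital_ring_hom (elementaryY f)" "unital_ring_hom rotation"
  "unital_ring_hom (diagonal \<alpha>)" "unital_ring_hom (dilation c)"
  by (simp_all add: elementaryX_def elementaryY_def rotation_def diagonal_def dilation_def
      unital_ring_hom_subst)

lemma generators_zconst [simp]:
  "elementaryX f (zconst a) = zconst a" "elementaryY f (zconst a) = zconst a"
  "rotation (zconst a) = zconst a" "diagonal \<alpha> (zconst a) = zconst a" "dilation c (zconst a) = zconst a"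
  by (simp_all add: elementaryX_def elementaryY_def rotation_def diagonal_def dilation_def
      unital_ring_hom_zconst)

lemma generators_var [simp]:
  "elementaryX f varX = varX + map_poly (\<lambda>c. [:c:]) f" "elementaryX f varY = varY"
  "elementaryY f varX = varX" "elementaryY f varY = varY + [:f:]"
  "rotation varX = - varY" "rotation varY = varX"
  "diagonal \<alpha> varX = zconst \<alpha> * varX" "diagonal \<alpha> varY = zconst (inverse \<alpha>) * varY"
  "dilation c varX = zconst c * varX" "dilation c varY = varY"
  by (simp_all add: elementaryX_def elementaryY_def rotation_def diagonal_def dilation_def
      unital_ring_hom_zconst)

lemma elementary_monom:
  "map_poly (\<lambda>c. [:c:]) (monom \<beta> k) = zconst \<beta> * varY ^ k" "[:monom \<beta> k:] = zconst \<beta> * varX ^ k"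
  using mon_eq[of \<beta> 0 k] mon_eq[of \<beta> k 0]
  by (simp_all add: mon_def map_poly_monom monom_0)

lemma bi_top_subst:
  fixes f :: "'k::field poly poly"
  assumes "bi_top w\<^sub>1 w\<^sub>2 a f f'" "bi_top w\<^sub>1 w\<^sub>2 w\<^sub>1 F F'" "bi_top w\<^sub>1 w\<^sub>2 w\<^sub>2 G G'"
  shows "bi_top w\<^sub>1 w\<^sub>2 a (bieval zconst F G f) (bieval zconst F' G' f')"
  by (rule top_part_bieval[OF top_part_bi_top unital_ring_hom_zconst bi_top_zconst assms])

lemma bi_top_mon: "w\<^sub>1 * real i + w\<^sub>2 * real j = a \<Longrightarrow> bi_top w\<^sub>1 w\<^sub>2 a (mon c i j) (mon c i j)"
  by (auto simp: bi_top_iff cf_mon)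

lemma varX_mon: "varX = mon 1 1 0" and varY_mon: "varY = mon 1 0 1"
  by (simp_all add: mon_eq)

text \<open>For \<open>w\<^sub>1 = real k * w\<^sub>2\<close> the polynomial X + \<beta> Y^k is
  homogeneous, so the substitution respects weights and its effect on the top part depends on the
  top part alone.\<close>

lemma bi_top_elementaryX:
  assumes "bi_top w\<^sub>1 w\<^sub>2 a f f'" "w\<^sub>1 = real k * w\<^sub>2"
  shows "bi_top w\<^sub>1 w\<^sub>2 a (elementaryX (monom \<beta> k) f) (elementaryX (monom \<beta> k) f')"
proof -
  have "bi_top w\<^sub>1 w\<^sub>2 w\<^sub>1 (mon 1 1 0 + mon \<beta> 0 k) (mon 1 1 0 + mon \<beta> 0 k)"
    by (rule top_part.add[OF top_part_bi_top bi_top_mon bi_top_mon]) (use assms in auto)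
  moreover have "bi_top w\<^sub>1 w\<^sub>2 w\<^sub>2 (mon 1 0 1) (mon 1 0 1)"
    by (rule bi_top_mon) simp
  ultimately show ?thesis
    using bi_top_subst[OF assms(1)] unfolding elementaryX_def elementary_monom
    by (simp add: mon_eq)
qed

lemma bi_top_elementaryY:
  assumes "bi_top w\<^sub>1 w\<^sub>2 a f f'" "w\<^sub>2 = real k * w\<^sub>1"
  shows "bi_top w\<^sub>1 w\<^sub>2 a (elementaryY (monom \<beta> k) f) (elementaryY (monom \<beta> k) f')"
proof -
  have "bi_top w\<^sub>1 w\<^sub>2 w\<^sub>2 (mon 1 0 1 + mon \<beta> k 0) (mon 1 0 1 + mon \<beta> k 0)"
    by (rule top_part.add[OF top_part_bi_top bi_top_mon bi_top_mon]) (use assms in auto)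
  moreover have "bi_top w\<^sub>1 w\<^sub>2 w\<^sub>1 (mon 1 1 0) (mon 1 1 0)"
    by (rule bi_top_mon) simp
  ultimately show ?thesis
    using bi_top_subst[OF assms(1)] unfolding elementaryY_def elementary_monom
    by (simp add: mon_eq)
qed

lemma degree_eq_oneE:
  fixes f :: "'a::zero poly"
  assumes "degree f = 1"
  obtains a b where "f = [:a, b:]" "b \<noteq> 0"
proof (rule that)
  show "f = [:coeff f 0, coeff f 1:]"
    by (rule poly_eqI) (use assms in \<open>auto simp: coeff_pCons coeff_eq_0 split: nat.splits\<close>)
  show "coeff f 1 \<noteq> 0"
    using assms by (metis leading_coeff_0_iff degree_0 zero_neq_one)
qed

lemma pcompose_map_const:
  fixes g :: "'k::field poly" and F :: "'k poly poly"
  assumes "unital_ring_hom \<phi>" "\<And>c. \<phi> (zconst c) = zconst c" "\<phi> varX = F"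
  shows "\<phi> [:g:] = pcompose (map_poly (\<lambda>c. [:c:]) g) F"
proof (induction g)
  case (pCons a g)
  have "[:pCons a g:] = zconst a + varX * [:g:]"
    by (simp add: zconst_def varX_def)
  then have "\<phi> [:pCons a g:] = \<phi> (zconst a) + \<phi> varX * \<phi> [:g:]"
    by (simp only: unital_ring_hom.add[OF assms(1)] unital_ring_hom.mult[OF assms(1)])
  then show ?case
    by (simp add: pCons assms map_poly_pCons pcompose_pCons) (simp add: zconst_def)
qed (simp add: unital_ring_hom.zero[OF assms(1)])

text \<open>The preimage F of X satisfies g(F) = X. Degrees in Y put F into K[X], and then degrees
  in X multiply to 1.\<close>

lemma coordinate_in_X_linear:
  fixes \<tau> :: "'k::field poly poly \<Rightarrow> 'k poly poly"
  assumes \<tau>: "z_aut \<tau>" and g: "\<tau> varX = [:g:]"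
  shows "degree g = 1"
proof -
  define F where "F = inv \<tau> varX"
  have inv: "inv \<tau> (\<tau> q) = q" for q
    using z_autD(2)[OF \<tau>] by (simp add: bij_is_inj)
  have comp: "pcompose (map_poly (\<lambda>c. [:c:]) g) F = varX"
    using pcompose_map_const[OF z_autD(1)[OF z_aut_inv[OF \<tau>]] z_autD(3)[OF z_aut_inv[OF \<tau>]], of F g]
    by (simp add: F_def inv flip: g)
  have dg: "degree (map_poly (\<lambda>c. [:c:]) g) = degree g"
    by (rule degree_map_poly) simp
  have "degree g * degree F = 0"
    using arg_cong[OF comp, of degree] by (simp add: degree_pcompose dg varX_def)
  moreover have "degree g \<noteq> 0"
  proof
    assume "degree g = 0"
    then obtain c where "g = [:c:]" by (metis degree_eq_zeroE)
    then have "\<tau> varX = \<tau> (zconst c)" using g z_autD(3)[OF \<tau>] by (simp add: zconst_def)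
    then have "varX = zconst c" using z_autD(2)[OF \<tau>] by (simp add: bij_def inj_eq)
    then show False by (simp add: varX_def zconst_def)
  qed
  ultimately obtain h where h: "F = [:h:]" by (metis degree_eq_zeroE mult_eq_0_iff)
  have "pcompose (map_poly (\<lambda>c. [:c:]) g) [:h:] = [:pcompose g h:]" for g
    by (induction g) (simp_all add: map_poly_pCons pcompose_pCons)
  then have "pcompose g h = [:0, 1:]" using comp by (simp add: h varX_def)
  then have "degree g * degree h = 1" by (metis degree_pcompose degree_pCons_eq_if one_neq_zero pCons_eq_0_iff degree_1 One_nat_def degree_0)
  then show ?thesis by simp
qed

text \<open>The inverse fixes X too, so it is a substitution Y \<mapsto> H over K[X]. The degrees of
  \<tau> Y and H in Y multiply to 1, and the leading coefficient of \<tau> Y is a unit of K[X], that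
  is, a scalar.\<close>

lemma shear_of_fixes_X:
  fixes \<tau> :: "'k::field poly poly \<Rightarrow> 'k poly poly"
  assumes \<tau>: "z_aut \<tau>" and X: "\<tau> varX = varX"
  obtains \<gamma> g where "\<gamma> \<noteq> 0" "\<tau> varY = zconst \<gamma> * varY + [:g:]"
proof -
  have inv: "inv \<tau> (\<tau> q) = q" for q
    using z_autD(2)[OF \<tau>] by (simp add: bij_is_inj)
  define G where "G = \<tau> varY"
  define H where "H = inv \<tau> varY"
  have "inv \<tau> q = pcompose q H" for q
  proof (rule bivariate_hom_unique[OF z_autD(1)[OF z_aut_inv[OF \<tau>]] unital_ring_hom_pcompose])
    show "inv \<tau> (zconst c) = pcompose (zconst c) H" for c
      using z_autD(3)[OF z_aut_inv[OF \<tau>]] by (simp add: zconst_def)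
    show "inv \<tau> varX = pcompose varX H" using inv[of varX] X by (simp add: varX_def)
    show "inv \<tau> varY = pcompose varY H" by (simp add: H_def) (simp add: varY_def pcompose_pCons)
  qed
  then have GH: "pcompose G H = [:0, 1:]" using inv[of varY] by (simp add: G_def varY_def)
  have "degree G * degree H = 1"
    using arg_cong[OF GH, of degree] by (simp add: degree_pcompose)
  then have "degree G = 1" "degree H = 1" by auto
  then obtain g0 g1 h0 h1 where G: "G = [:g0, g1:]" and H: "H = [:h0, h1:]"
    by (metis degree_eq_oneE)
  have "g1 * h1 = 1" using GH by (simp add: G H pcompose_pCons)
  then have "g1 dvd 1" by (metis dvd_triv_left)
  then obtain \<gamma> where "g1 = [:\<gamma>:]" "\<gamma> \<noteq> 0"
    by (metis is_unit_polyE dvd_field_iff zero_neq_one)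
  then show thesis using that[of \<gamma> g0] G by (simp add: G_def zconst_def varY_def)
qed

text \<open>The supply \<open>L\<close> of automorphisms stays abstract so that it can become the
  set of liftable automorphisms of Jacobian 1; the automorphism that performs the reduction then has
  both properties by membership.\<close>

locale tame_monoid =
  fixes L :: "('k::field poly poly \<Rightarrow> 'k poly poly) set"
  assumes aut: "e \<in> L \<Longrightarrow> z_aut e"
    and comp: "e \<in> L \<Longrightarrow> e' \<in> L \<Longrightarrow> e \<circ> e' \<in> L"
    and elementaryX: "elementaryX f \<in> L"
    and elementaryY: "elementaryY f \<in> L"
    and rotation: "rotation \<in> L"
    and diagonal: "\<alpha> \<noteq> 0 \<Longrightarrow> diagonal \<alpha> \<in> L"
    and char: "CHAR('k) > 0"
begin

text \<open>The pair (m, n) is a box around the support of \<tau> X. A box that is not tight shrinks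
  at once; for a tight one an elementary substitution turns the top form into a power of a single
  variable, which clears one side of the box.\<close>

lemma reduce_coordinate:
  assumes "z_aut \<tau>" "\<And>i j. cf (\<tau> varX) i j \<noteq> 0 \<Longrightarrow> i \<le> m \<and> j \<le> n"
  shows "\<exists>e\<in>L. \<exists>g. e (\<tau> varX) = [:g:]"
  using assms
proof (induction "m + n" arbitrary: m n \<tau> rule: less_induct)
  case less
  note \<tau> = less.prems(1) and bd = less.prems(2)
  have deg0: "\<exists>g. q = [:g:]" if "\<And>i j. cf q i j \<noteq> 0 \<Longrightarrow> j = 0" for q :: "'k poly poly"
  proof -
    have "q = [:coeff q 0:]"
    proof (rule cf_eqI)
      fix i j show "cf q i j = cf [:coeff q 0:] i j"
        using that[of j i] by (cases j) auto
    qed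
    then show ?thesis ..
  qed
  have id: "elementaryX 0 q = q" for q :: "'k poly poly"
    by (rule bivariate_hom_unique[OF unital_ring_hom_generators(1), of "\<lambda>q. q"])
      (simp_all add: unital_ring_hom_def)
  consider "n = 0" | "m = 0" | "m > 0" "n > 0" "\<forall>j. cf (\<tau> varX) m j = 0"
    | "m > 0" "n > 0" "\<forall>i. cf (\<tau> varX) i n = 0"
    | "m > 0" "n > 0" "\<exists>j. cf (\<tau> varX) m j \<noteq> 0" "\<exists>i. cf (\<tau> varX) i n \<noteq> 0"
    by blast
  then show ?case
  proof cases
    case 1
    then have "\<exists>g. \<tau> varX = [:g:]" using bd by (intro deg0) auto
    then show ?thesis using elementaryX[of 0] id by metis
  next
    case 2
    have "rotation (\<tau> varX) = (\<Sum>s\<in>supp (\<tau> varX). zconst (cf (\<tau> varX) (fst s) (snd s)) * (- varY) ^ fst s * varX ^ snd s)"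
      unfolding rotation_def bieval_expand[OF unital_ring_hom_zconst] case_prod_unfold ..
    also have "\<dots> = (\<Sum>s\<in>supp (\<tau> varX). mon (cf (\<tau> varX) (fst s) (snd s)) (snd s) 0)"
      using 2 by (intro sum.cong) (auto simp: in_supp mon_eq dest!: bd)
    finally have rot: "rotation (\<tau> varX)
      = (\<Sum>s\<in>supp (\<tau> varX). mon (cf (\<tau> varX) (fst s) (snd s)) (snd s) 0)" .
    have "\<exists>g. rotation (\<tau> varX) = [:g:]"
    proof (rule deg0, rule ccontr)
      fix i j assume "cf (rotation (\<tau> varX)) i j \<noteq> 0" "j \<noteq> 0"
      then show False by (simp add: rot cf_sum cf_mon)
    qed
    then show ?thesis using rotation by blast
  next
    case 3
    have "m - 1 + n < m + n" using 3 by simp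
    moreover have "i \<le> m - 1 \<and> j \<le> n" if "cf (\<tau> varX) i j \<noteq> 0" for i j
      using bd[OF that] 3 that by (cases "i = m") auto
    ultimately show ?thesis using less.hyps[of "m - 1" n \<tau>] \<tau> by blast
  next
    case 4
    have "m + (n - 1) < m + n" using 4 by simp
    moreover have "i \<le> m \<and> j \<le> n - 1" if "cf (\<tau> varX) i j \<noteq> 0" for i j
      using bd[OF that] 4 that by (cases "j = n") auto
    ultimately show ?thesis using less.hyps[of m "n - 1" \<tau>] \<tau> by blast
  next
    case 5
    note mn = 5(1,2)
    have step: "\<exists>e\<in>L. \<exists>g. e (\<tau> varX) = [:g:]"
      if e: "e \<in> L" and lt: "m' + n' < m + n"
        and bd': "\<And>i j. cf (e (\<tau> varX)) i j \<noteq> 0 \<Longrightarrow> i \<le> m' \<and> j \<le> n'" for e m' n'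
    proof -
      have "\<exists>e'\<in>L. \<exists>g. e' ((e \<circ> \<tau>) varX) = [:g:]"
        using bd' by (intro less.hyps[OF lt] z_aut_comp[OF aut[OF e] \<tau>]) auto
      then obtain e' g where "e' \<in> L" "(e' \<circ> e) (\<tau> varX) = [:g:]" by auto
      then show ?thesis using comp[OF _ e] by blast
    qed
    show ?thesis
    proof (cases rule: coordinate_top_form[OF \<tau> char mn _ 5(3,4), case_names bd 1 2])
      case bd
      then show ?case using less.prems(2) by blast
    next
      case (1 c \<beta> k)
      \<comment> \<open>The map X \<mapsto> X + \<beta> Y^k sends X - \<beta> Y^k to X.\<close>
      define e where "e = elementaryX (monom \<beta> k)"
      have hom: "unital_ring_hom e" by (simp add: e_def unital_ring_hom_generators)
      interpret e: unital_ring_hom e by fact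
      have "bi_top n m (real (m * n)) (e (\<tau> varX)) (e (zconst c * (varX - zconst \<beta> * varY ^ k) ^ m))"
        unfolding e_def by (rule bi_top_elementaryX[OF 1(4)]) (use 1 in simp)
      also have "e (zconst c * (varX - zconst \<beta> * varY ^ k) ^ m) = mon c m 0"
        by (simp add: e.mult e.power e.diff) (simp add: e_def elementary_monom mon_eq)
      finally have t: "bi_top n m (real (m * n)) (e (\<tau> varX)) (mon c m 0)" .
      show ?thesis
      proof (rule step)
        show "e \<in> L" by (simp add: e_def elementaryX)
        show "m + (n - 1) < m + n" using mn by simp
        fix i j assume nz: "cf (e (\<tau> varX)) i j \<noteq> 0"
        then have le: "real n * real i + real m * real j \<le> real (m * n)"
          and eq: "real n * real i + real m * real j = real (m * n) \<Longrightarrow> i = m \<and> j = 0"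
          using t[unfolded bi_top_iff, rule_format, of i j] t[unfolded bi_top_iff, rule_format, of j i]
          by (auto simp: cf_mon split: if_splits)
        have le': "n * i + m * j \<le> n * m"
          using le by (simp add: mult.commute flip: of_nat_mult of_nat_add)
        then have "n * i \<le> n * m" by linarith
        then have "i \<le> m" using mn by simp
        \<comment> \<open>A monomial with j \<ge> n has weight at least m n, so j = n and i = 0; it
          would then belong to the top form, which is now a multiple of X^m.\<close>
        moreover have "j < n"
        proof (rule ccontr)
          assume "\<not> j < n"
          then have "m * n \<le> m * j" by simp
          then have "n * i = 0" "m * j = m * n" using le' mult.commute[of n m] by linarith+
          then have "i = 0" "j = n" using mn by auto
          then show False using eq mn by simp
        qed
        ultimately show "i \<le> m \<and> j \<le> n - 1" by simp
      qed
    next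
      case (2 c \<beta> k)
      \<comment> \<open>The coefficient is \<beta>^(-1) because Y enters with factor -\<beta>: the
        substitution sends X^k - \<beta> Y to -\<beta> Y.\<close>
      define e where "e = elementaryY (monom (inverse \<beta>) k)"
      have hom: "unital_ring_hom e" by (simp add: e_def unital_ring_hom_generators)
      interpret e: unital_ring_hom e by fact
      have "bi_top n m (real (m * n)) (e (\<tau> varX)) (e (zconst c * (varX ^ k - zconst \<beta> * varY) ^ n))"
        unfolding e_def by (rule bi_top_elementaryY[OF 2(4)]) (use 2 in simp)
      also have "e (zconst c * (varX ^ k - zconst \<beta> * varY) ^ n) = mon (c * (- \<beta>) ^ n) 0 n"
      proof -
        have "e (varX ^ k - zconst \<beta> * varY)
          = varX ^ k - zconst \<beta> * varY - zconst \<beta> * zconst (inverse \<beta>) * varX ^ k"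
          by (simp add: e.mult e.power e.diff) (simp add: e_def elementary_monom algebra_simps)
        also have "zconst \<beta> * zconst (inverse \<beta>) = 1"
          using 2 by (simp flip: zconst_simps(4))
        finally have "e (varX ^ k - zconst \<beta> * varY) = zconst (- \<beta>) * varY" by simp
        moreover have "e (zconst c) = zconst c" by (simp add: e_def)
        ultimately have "e (zconst c * (varX ^ k - zconst \<beta> * varY) ^ n)
          = zconst c * (zconst (- \<beta>) * varY) ^ n"
          by (simp only: e.mult e.power)
        also have "\<dots> = zconst (c * (- \<beta>) ^ n) * varY ^ n"
          by (simp only: power_mult_distrib zconst_simps(4,8) mult.assoc)
        finally show ?thesis by (simp add: mon_eq)
      qed
      finally have t: "bi_top n m (real (m * n)) (e (\<tau> varX)) (mon (c * (- \<beta>) ^ n) 0 n)" .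
      show ?thesis
      proof (rule step)
        show "e \<in> L" by (simp add: e_def elementaryY)
        show "(m - 1) + n < m + n" using mn by simp
        fix i j assume nz: "cf (e (\<tau> varX)) i j \<noteq> 0"
        then have le: "real n * real i + real m * real j \<le> real (m * n)"
          and eq: "real n * real i + real m * real j = real (m * n) \<Longrightarrow> i = 0 \<and> j = n"
          using t[unfolded bi_top_iff, rule_format, of i j] t[unfolded bi_top_iff, rule_format, of j i]
          by (auto simp: cf_mon split: if_splits)
        have le': "n * i + m * j \<le> n * m"
          using le by (simp add: mult.commute flip: of_nat_mult of_nat_add)
        then have "m * j \<le> m * n" using mult.commute[of n m] by linarith
        then have "j \<le> n" using mn by simp
        moreover have "i < m"
        proof (rule ccontr)
          assume "\<not> i < m"
          then have "n * m \<le> n * i" by simp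
          then have "m * j = 0" "n * i = n * m" using le' by linarith+
          then have "j = 0" "i = m" using mn by auto
          then show False using eq mn by simp
        qed
        ultimately show "i \<le> m - 1 \<and> j \<le> n" by simp
      qed
    qed
  qed
qed

text \<open>The theorem of Jung and van der Kulk.\<close>
theorem tame:
  assumes \<tau>: "z_aut \<tau>"
  obtains e c where "e \<in> L" "c \<noteq> 0" "e \<circ> \<tau> = dilation c"
proof -
  define S where "S = supp (\<tau> varX)"
  have "\<exists>e\<in>L. \<exists>g. e (\<tau> varX) = [:g:]"
  proof (rule reduce_coordinate[OF \<tau>])
    fix i j assume "cf (\<tau> varX) i j \<noteq> 0"
    then have "(i, j) \<in> S" by (simp add: S_def in_supp)
    then show "i \<le> Max (insert 0 (fst ` S)) \<and> j \<le> Max (insert 0 (snd ` S))"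
      by (auto simp: S_def intro!: Max_ge simp: image_iff) force+
  qed
  then obtain e1 g where e1: "e1 \<in> L" "(e1 \<circ> \<tau>) varX = [:g:]" by auto
  have "degree g = 1"
    by (rule coordinate_in_X_linear[OF z_aut_comp[OF aut[OF e1(1)] \<tau>] e1(2)])
  then obtain \<beta> \<alpha> where g: "g = [:\<beta>, \<alpha>:]" "\<alpha> \<noteq> 0"
    by (metis degree_eq_oneE)
  have g': "[:g:] = zconst \<beta> + zconst \<alpha> * varX" by (simp add: g zconst_def varX_def)
  \<comment> \<open>A translation removes the constant term of g and a diagonal map its slope. The
    latter rescales Y as well, which is absorbed in \<gamma> below.\<close>
  define e2 where "e2 = diagonal (inverse \<alpha>) \<circ> (elementaryX [:- \<beta> / \<alpha>:] \<circ> e1)"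
  have e2: "e2 \<in> L" using g e1 by (auto simp: e2_def intro!: comp diagonal elementaryX)
  have inv: "zconst \<alpha> * zconst (inverse \<alpha>) = 1" "zconst \<alpha> * zconst (\<beta> / \<alpha>) = zconst \<beta>"
    using g by (simp_all flip: zconst_simps(4))
  have "(e2 \<circ> \<tau>) varX = diagonal (inverse \<alpha>) (elementaryX [:- \<beta> / \<alpha>:] (zconst \<beta> + zconst \<alpha> * varX))"
    using e1(2) by (simp add: e2_def flip: g')
  also have "elementaryX [:- \<beta> / \<alpha>:] (zconst \<beta> + zconst \<alpha> * varX)
      = zconst \<beta> + zconst \<alpha> * (varX - zconst (\<beta> / \<alpha>))"
    by (simp add: unital_ring_hom.add[OF unital_ring_hom_generators(1)]
      unital_ring_hom.mult[OF unital_ring_hom_generators(1)]) (simp add: zconst_def map_poly_pCons)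
  also have "\<dots> = zconst \<alpha> * varX" by (simp add: right_diff_distrib inv)
  also have "diagonal (inverse \<alpha>) (zconst \<alpha> * varX) = varX"
    by (simp add: unital_ring_hom.mult[OF unital_ring_hom_generators(4)] inv flip: mult.assoc)
  finally have X: "(e2 \<circ> \<tau>) varX = varX" .
  from shear_of_fixes_X[OF z_aut_comp[OF aut[OF e2] \<tau>] X] obtain \<gamma> h
    where \<gamma>: "\<gamma> \<noteq> 0" "(e2 \<circ> \<tau>) varY = zconst \<gamma> * varY + [:h:]" .
  \<comment> \<open>After the shear is removed, the diagonal map transfers the factor \<gamma> from
    Y to X, where it remains as the dilation.\<close>
  define e where "e = diagonal \<gamma> \<circ> (elementaryY (smult (- inverse \<gamma>) h) \<circ> e2)"
  have e: "e \<in> L" using \<gamma> e2 by (auto simp: e_def intro!: comp diagonal elementaryY)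
  have fix_X: "elementaryY f [:h:] = [:h:]" for f h :: "'k poly"
    using pcompose_map_const[OF unital_ring_hom_generators(2), of f varX h]
      pcompose_map_const[of "\<lambda>q. q" varX h] by (simp add: unital_ring_hom_def)
  have inv': "zconst \<gamma> * zconst (inverse \<gamma>) = 1"
    using \<gamma> by (simp flip: zconst_simps(4))
  have "elementaryY (smult (- inverse \<gamma>) h) (zconst \<gamma> * varY + [:h:]) = zconst \<gamma> * varY"
    using \<gamma> by (simp add: unital_ring_hom.add[OF unital_ring_hom_generators(2)]
      unital_ring_hom.mult[OF unital_ring_hom_generators(2)] fix_X) (simp add: zconst_def algebra_simps)
  moreover have "diagonal \<gamma> (zconst \<gamma> * varY) = varY"
    by (simp add: unital_ring_hom.mult[OF unital_ring_hom_generators(4)] inv' flip: mult.assoc)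
  ultimately have Y: "e (\<tau> varY) = varY" using \<gamma>(2) by (simp add: e_def)
  have X': "e (\<tau> varX) = zconst \<gamma> * varX" using X by (simp add: e_def)
  have "z_aut (e \<circ> \<tau>)" by (rule z_aut_comp[OF aut[OF e] \<tau>])
  then have "(e \<circ> \<tau>) q = dilation \<gamma> q" for q
    by (rule bivariate_hom_unique[OF z_autD(1) unital_ring_hom_generators(5)])
      (use X' Y z_autD(3)[OF \<open>z_aut (e \<circ> \<tau>)\<close>] in auto)
  then have "e \<circ> \<tau> = dilation \<gamma>" by (rule ext)
  with e \<gamma>(1) show thesis by (rule that)
qed

end

section \<open>The Weyl algebra as a ring\<close>

lemma dX_pCons: "dX (pCons c f) = pCons (pderiv c) (dX f)"
  by (simp add: dX_def map_poly_pCons)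

lemma dY_pCons: "dY (pCons c f) = f + pCons 0 (dY f)"
  by (simp add: dY_def pderiv_pCons)

text \<open>Left multiplication by d on normally ordered symbols: moving d past a polynomial in x
  produces the derivative in X.\<close>

definition left_d :: "'k::field poly poly \<Rightarrow> 'k poly poly" where
  "left_d g = varY * g + dX g"

text \<open>The product of normally ordered symbols: f = \<Sum> f_j(X) Y^j acts as \<Sum> f_j(X)
  \<open>left_d\<close>^j. In this operator form associativity comes down to one commutation rule,
  without binomial sums.\<close>

definition act :: "'k::field poly poly \<Rightarrow> 'k poly poly \<Rightarrow> 'k poly poly" where
  "act f g = (\<Sum>j\<le>degree f. [:coeff f j:] * (left_d ^^ j) g)"

interpretation dX: derivation "dX :: 'k::field poly poly \<Rightarrow> _" by (rule derivation_dX)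
interpretation dY: derivation "dY :: 'k::field poly poly \<Rightarrow> _" by (rule derivation_dY)

lemma left_d_add: "left_d (f + g) = left_d f + left_d g"
  by (simp add: left_d_def dX.add algebra_simps)

lemma left_d_mult: "left_d (f * g) = f * left_d g + dX f * g"
  by (simp add: left_d_def dX.mult algebra_simps)

lemma left_d_0 [simp]: "left_d 0 = 0"
  by (simp add: left_d_def)

lemma left_d_pow_add: "(left_d ^^ j) (f + g) = (left_d ^^ j) f + (left_d ^^ j) g"
  by (induction j) (simp_all add: left_d_add)

lemma left_d_pow_varY: "(left_d ^^ j) (varY * g) = varY * (left_d ^^ j) g"
  by (induction j) (simp_all add: left_d_mult)

lemma act_upto: "degree f \<le> n \<Longrightarrow> act f g = (\<Sum>j\<le>n. [:coeff f j:] * (left_d ^^ j) g)"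
  unfolding act_def by (rule sum.mono_neutral_left) (auto simp: coeff_eq_0)

lemma act_pCons: "act (pCons c f) g = [:c:] * g + act f (left_d g)"
proof -
  have "act (pCons c f) g = (\<Sum>j\<le>Suc (degree f). [:coeff (pCons c f) j:] * (left_d ^^ j) g)"
    by (rule act_upto) (simp add: degree_pCons_le)
  also have "\<dots> = [:c:] * g + act f (left_d g)"
    by (subst sum.atMost_Suc_shift) (simp add: act_def funpow_swap1)
  finally show ?thesis .
qed

lemma act_0 [simp]: "act 0 g = 0"
  by (simp add: act_def)

lemma act_add_right: "act f (g + h) = act f g + act f h"
  by (simp add: act_def left_d_pow_add algebra_simps sum.distrib)

lemma act_add_left: "act (f + g) h = act f h + act g h"
proof -
  define n where "n = max (degree f) (degree g)"
  have "act k h = (\<Sum>j\<le>n. [:coeff k j:] * (left_d ^^ j) h)" if "degree k \<le> n" for k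
    using that by (rule act_upto)
  moreover have "degree (f + g) \<le> n" unfolding n_def by (rule degree_add_le_max)
  ultimately show ?thesis
    by (simp add: n_def smult_add_left sum.distrib)
qed

lemma act_smult_left: "act ([:c:] * f) g = [:c:] * act f g"
proof -
  have "act ([:c:] * f) g = (\<Sum>j\<le>degree f. [:coeff ([:c:] * f) j:] * (left_d ^^ j) g)"
    by (rule act_upto) (simp add: degree_smult_le)
  then show ?thesis
    by (simp only: act_def sum_distrib_left) (simp add: mult.commute)
qed

lemma act_const [simp]: "act [:c:] g = [:c:] * g"
  by (simp add: act_def)

text \<open>Associativity for the left factor d. The Leibniz rule of \<open>dX\<close> accounts for
  the commutator of d with the coefficients of f.\<close>

lemma act_left_d: "act (left_d f) h = left_d (act f h)"
proof (induction f arbitrary: h)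
  case (pCons c f)
  have "left_d (pCons c f) = pCons (pderiv c) ([:c:] + left_d f)"
    by (simp add: left_d_def dX_pCons varY_def)
  then have "act (left_d (pCons c f)) h = [:pderiv c:] * h + ([:c:] * left_d h + left_d (act f (left_d h)))"
    by (simp only: act_pCons act_add_left act_const act_0 pCons add_0_right)
  moreover have "dX [:c:] = [:pderiv c:]" by (simp add: dX_pCons)
  ultimately show ?case
    by (simp only: act_pCons left_d_add left_d_mult) (simp only: ac_simps)
qed simp

lemma act_assoc: "act (act f g) h = act f (act g h)"
proof (induction f arbitrary: g)
  case (pCons c f)
  then show ?case
    by (simp only: act_pCons act_add_left act_smult_left act_left_d)
qed simp

text \<open>In normal order d stands on the right, so Y g is the symbol of g d and the claim is f (g
  d) = (f g) d.\<close>

lemma act_varY: "act f (varY * g) = varY * act f g"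
  by (simp add: act_def left_d_pow_varY sum_distrib_left algebra_simps)

lemma act_one: "act f 1 = f"
proof (induction f)
  case (pCons c f)
  have "act (pCons c f) 1 = [:c:] + act f (varY * 1)"
    by (simp add: act_pCons left_d_def)
  also have "\<dots> = pCons c f"
    unfolding act_varY by (simp add: pCons varY_def)
  finally show ?case .
qed simp

lemma act_one_left: "act 1 g = g"
  by (simp add: one_pCons) (simp flip: one_pCons)

text \<open>Moving x to the left through f leaves the commutator [f, x], whose symbol is the
  derivative of f in Y.\<close>

lemma act_varX: "act f (varX * g) = varX * act f g + act (dY f) g"
proof (induction f arbitrary: g)
  case (pCons c f)
  have "left_d (varX * g) = varX * left_d g + g"
    by (simp add: left_d_mult)
  then have "act (pCons c f) (varX * g)
      = [:c:] * (varX * g) + (varX * act f (left_d g) + act (dY f) (left_d g) + act f g)"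
    by (simp only: act_pCons act_add_right pCons)
  moreover have "act (dY (pCons c f)) g = act f g + act (dY f) (left_d g)"
    by (simp add: dY_pCons act_add_left act_pCons)
  ultimately show ?case
    by (simp only: act_pCons distrib_left ac_simps)
qed (simp add: dY_def)

lemma act_zconst: "act f (zconst c * g) = zconst c * act f g"
proof -
  have "(left_d ^^ j) (zconst c * g) = zconst c * (left_d ^^ j) g" for j
    by (induction j) (simp_all add: left_d_mult)
  then show ?thesis by (simp add: act_def sum_distrib_left algebra_simps)
qed

text \<open>The Weyl algebra as a ring type: an element is represented by its normally ordered symbol, and
  \<open>act f\<close> is left multiplication by \<open>f\<close> on symbols.\<close>
typedef (overloaded) 'k weyl_algebra = "UNIV :: 'k::field poly poly set"
  morphisms symbol of_symbol ..

lemma symbol_of_symbol [simp]: "symbol (of_symbol f) = f"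
  by (simp add: of_symbol_inverse)

instantiation weyl_algebra :: (field) ring_1
begin

definition "0 = of_symbol 0"
definition "1 = of_symbol 1"
definition "a + b = of_symbol (symbol a + symbol b)"
definition "a - b = of_symbol (symbol a - symbol b)"
definition "- a = of_symbol (- symbol a)"
definition "a * b = of_symbol (act (symbol a) (symbol b))"

instance
  by standard
    (auto simp: zero_weyl_algebra_def one_weyl_algebra_def plus_weyl_algebra_def
      minus_weyl_algebra_def uminus_weyl_algebra_def times_weyl_algebra_def symbol_inverse
      act_assoc act_one act_one_left act_add_left act_add_right algebra_simps
      simp flip: symbol_inject)

end

lemma symbol_simps [simp]:
  "symbol 0 = 0" "symbol 1 = 1" "symbol (a + b) = symbol a + symbol b"
  "symbol (a - b) = symbol a - symbol b" "symbol (- a) = - symbol a"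
  by (simp_all add: zero_weyl_algebra_def one_weyl_algebra_def plus_weyl_algebra_def
      minus_weyl_algebra_def uminus_weyl_algebra_def)

lemma symbol_mult: "symbol (a * b) = act (symbol a) (symbol b)"
  by (simp add: times_weyl_algebra_def)

lemma symbol_eqI: "symbol a = symbol b \<Longrightarrow> a = b"
  by (simp add: symbol_inject)

lemma symbol_sum: "symbol (sum f A) = (\<Sum>a\<in>A. symbol (f a))"
  by (induction A rule: infinite_finite_induct) simp_all

definition wc :: "'k::field \<Rightarrow> 'k weyl_algebra" where "wc c = of_symbol (zconst c)"
definition wx :: "'k::field weyl_algebra" where "wx = of_symbol varX"
definition wd :: "'k::field weyl_algebra" where "wd = of_symbol varY"

lemma symbol_gens [simp]: "symbol (wc c) = zconst c" "symbol wx = varX" "symbol wd = varY"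
  by (simp_all add: wc_def wx_def wd_def)

lemma symbol_mult_left:
  "symbol (wc c * a) = zconst c * symbol a" "symbol (wx * a) = varX * symbol a"
  "symbol (wd * a) = varY * symbol a + dX (symbol a)"
  by (simp_all add: symbol_mult zconst_def varX_def)
    (simp add: varY_def act_pCons left_d_def)

lemma symbol_mult_right:
  "symbol (a * wc c) = zconst c * symbol a" "symbol (a * wx) = varX * symbol a + dY (symbol a)"
  "symbol (a * wd) = varY * symbol a"
  using act_zconst[of "symbol a" c 1] act_varX[of "symbol a" 1] act_varY[of "symbol a" 1]
  by (simp_all add: symbol_mult act_one)

lemma unital_ring_hom_wc: "unital_ring_hom (wc :: 'k::field \<Rightarrow> _)"
  by unfold_locales (auto intro!: symbol_eqI simp: symbol_mult_left)

lemma wc_simps [simp]: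
  "wc 0 = 0" "wc 1 = 1" "wc (c + d) = wc c + wc d" "wc (c * d) = wc c * wc d" "wc (- c) = - wc c"
  by (simp_all add: unital_ring_hom.zero[OF unital_ring_hom_wc] unital_ring_hom.one[OF unital_ring_hom_wc]
      unital_ring_hom.add[OF unital_ring_hom_wc] unital_ring_hom.mult[OF unital_ring_hom_wc]
      unital_ring_hom.minus[OF unital_ring_hom_wc])

lemma wc_central: "wc c * a = a * wc c"
  by (rule symbol_eqI) (simp add: symbol_mult_left symbol_mult_right)

lemma wd_wx: "wd * wx - wx * wd = 1"
  by (rule symbol_eqI) (simp add: symbol_mult_left symbol_mult_right)

lemma symbol_wx_power: "symbol (wx ^ i * a) = varX ^ i * symbol a"
  by (induction i) (simp_all add: symbol_mult_left mult.assoc)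

lemma symbol_wd_power: "symbol (a * wd ^ j) = varY ^ j * symbol a"
proof (induction j)
  case (Suc j)
  have "symbol (a * wd ^ Suc j) = symbol ((a * wd ^ j) * wd)"
    by (simp only: power_Suc2 mult.assoc)
  also have "\<dots> = varY * symbol (a * wd ^ j)" by (rule symbol_mult_right)
  finally show ?case by (simp add: Suc mult.assoc)
qed simp

lemma symbol_wx_power_one: "symbol (wx ^ i) = varX ^ i"
  using symbol_wx_power[of i 1] by simp

lemma symbol_wd_power_one: "symbol (wd ^ j) = varY ^ j"
  using symbol_wd_power[of 1 j] by simp

lemma symbol_normal: "symbol (wc c * wx ^ i * wd ^ j) = mon c i j"
  by (simp add: symbol_wx_power_one symbol_wd_power symbol_mult_left mon_eq mult.left_commute mult.commute)

lemma weyl_algebra_expand: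
  "a = (\<Sum>(i,j)\<in>supp (symbol a). wc (cf (symbol a) i j) * wx ^ i * wd ^ j)"
  by (rule symbol_eqI) (simp add: symbol_sum case_prod_unfold symbol_normal sum_mon_supp[unfolded case_prod_unfold])

lemma weyl_algebra_induct [case_names const wx wd add mult]:
  assumes const: "\<And>c. P (wc c)" and gens: "P wx" "P wd"
    and add: "\<And>a b. P a \<Longrightarrow> P b \<Longrightarrow> P (a + b)" and mult: "\<And>a b. P a \<Longrightarrow> P b \<Longrightarrow> P (a * b)"
  shows "P a"
proof -
  have 0: "P 0" "P 1"
    using const[of 0] const[of 1] by simp_all
  have pw: "P (b ^ n)" if "P b" for b n
    by (induction n) (use that 0 mult in auto)
  have sum: "P (sum f A)" if "\<And>s. s \<in> A \<Longrightarrow> P (f s)" for f :: "nat \<times> nat \<Rightarrow> _" and A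
    using that by (induction A rule: infinite_finite_induct) (auto intro: 0 add)
  have "P (\<Sum>(i,j)\<in>supp (symbol a). wc (cf (symbol a) i j) * wx ^ i * wd ^ j)"
    by (rule sum) (auto intro!: mult pw const gens)
  then show ?thesis using weyl_algebra_expand[of a] by simp
qed

lemma weyl_hom_unique:
  assumes "unital_ring_hom f" "unital_ring_hom g"
    and "\<And>c. f (wc c) = g (wc c)" "f wx = g wx" "f wd = g wd"
  shows "f a = g a"
  by (induction a rule: weyl_algebra_induct)
    (use assms in \<open>auto simp: unital_ring_hom.add unital_ring_hom.mult\<close>)

section \<open>Normal ordering for a pair with [v, u] = 1\<close>

lemma commutator_power:
  fixes u v :: "'r::ring_1"
  assumes "v * u - u * v = 1"
  shows "v * u ^ n = u ^ n * v + of_nat n * u ^ (n - 1)"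
proof (induction n)
  case (Suc n)
  have vu: "v * u = u * v + 1" using assms by (simp add: algebra_simps)
  have "v * u ^ Suc n = u * (v * u ^ n) + u ^ n"
    by (simp add: vu algebra_simps flip: mult.assoc)
  also have "\<dots> = u ^ Suc n * v + (u * (of_nat n * u ^ (n - 1)) + u ^ n)"
    by (simp add: Suc algebra_simps)
  also have "u * (of_nat n * u ^ (n - 1)) = of_nat n * u ^ n"
  proof -
    have "u * (of_nat n * u ^ (n - 1)) = of_nat n * (u * u ^ (n - 1))"
      by (metis mult.assoc mult_of_nat_commute)
    then show ?thesis by (cases n) simp_all
  qed
  finally show ?case by (simp add: algebra_simps)
qed simp

text \<open>The recursion of the normal ordering coefficients when one more v crosses: Pascal's rule
  for b + 1 combined with (k + 1) (c choose k + 1) = (c - k) (c choose k).\<close>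

lemma fact_choose_mult_Suc:
  "fact (Suc k) * (Suc b choose Suc k) * (c choose Suc k)
    = fact (Suc k) * (b choose Suc k) * (c choose Suc k) + fact k * (b choose k) * (c choose k) * (c - k)"
proof -
  have "Suc k * (c choose Suc k) = (c - k) * (c choose k)"
  proof (cases c)
    case (Suc c')
    have "(c - k) * (c choose k) = Suc c' * (c' choose k)"
      using binomial_absorb_comp[of c k] by (simp only: Suc diff_Suc_1)
    then show ?thesis by (simp only: Suc Suc_times_binomial)
  qed simp
  then have "fact k * (b choose k) * (Suc k * (c choose Suc k)) = fact k * (b choose k) * ((c - k) * (c choose k))"
    by (rule arg_cong)
  then have "fact (Suc k) * (b choose k) * (c choose Suc k) = fact k * (b choose k) * (c choose k) * (c - k)"
    by (simp only: fact_Suc of_nat_id ac_simps)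
  then show ?thesis
    unfolding binomial_Suc_Suc[of b k] add_mult_distrib add_mult_distrib2 by linarith
qed

text \<open>One further v crosses u^(c-k) and leaves (c - k) u^(c-k-1) behind. Terms with k > c have
  truncated exponents, but their coefficient is 0.\<close>

lemma normal_ordering:
  fixes u v :: "'r::ring_1"
  assumes uv: "v * u - u * v = 1"
  shows "v ^ b * u ^ c = (\<Sum>k\<le>b. of_nat (fact k * (b choose k) * (c choose k)) * (u ^ (c - k) * v ^ (b - k)))"
proof (induction b)
  case (Suc b)
  define N :: "nat \<Rightarrow> nat \<Rightarrow> 'r" where "N = (\<lambda>b k. of_nat (fact k * (b choose k) * (c choose k)))"
  have comm: "v * N b k = N b k * v" for b k
    unfolding N_def by (rule mult_of_nat_commute[symmetric])
  have "v ^ Suc b * u ^ c = v * (\<Sum>k\<le>b. N b k * (u ^ (c - k) * v ^ (b - k)))"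
    by (simp only: power_Suc mult.assoc Suc N_def)
  also have "\<dots> = (\<Sum>k\<le>b. N b k * (v * u ^ (c - k) * v ^ (b - k)))"
    unfolding sum_distrib_left by (rule sum.cong) (simp_all only: comm flip: mult.assoc)
  also have "\<dots> = (\<Sum>k\<le>b. N b k * (u ^ (c - k) * v ^ (Suc b - k)) + N b k * of_nat (c - k) * (u ^ (c - Suc k) * v ^ (b - k)))"
    by (rule sum.cong) (simp_all add: commutator_power[OF uv] Suc_diff_le algebra_simps)
  also have "\<dots> = (\<Sum>k\<le>b. N b k * (u ^ (c - k) * v ^ (Suc b - k)))
      + (\<Sum>k\<le>b. N b k * of_nat (c - k) * (u ^ (c - Suc k) * v ^ (b - k)))"
    by (rule sum.distrib)
  also have "(\<Sum>k\<le>b. N b k * (u ^ (c - k) * v ^ (Suc b - k)))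
      = (\<Sum>k\<le>Suc b. N b k * (u ^ (c - k) * v ^ (Suc b - k)))"
  proof -
    have "N b (Suc b) = 0" by (simp add: N_def binomial_eq_0)
    then show ?thesis by simp
  qed
  also have "\<dots> = N b 0 * (u ^ c * v ^ Suc b) + (\<Sum>k\<le>b. N b (Suc k) * (u ^ (c - Suc k) * v ^ (b - k)))"
    by (subst sum.atMost_Suc_shift) simp
  finally have "v ^ Suc b * u ^ c = N b 0 * (u ^ c * v ^ Suc b)
      + (\<Sum>k\<le>b. (N b (Suc k) + N b k * of_nat (c - k)) * (u ^ (c - Suc k) * v ^ (b - k)))"
    by (simp add: sum.distrib algebra_simps)
  moreover have "N b (Suc k) + N b k * of_nat (c - k) = N (Suc b) (Suc k)" for k
    unfolding N_def fact_choose_mult_Suc by (simp only: of_nat_add of_nat_mult)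
  moreover have "N b 0 = N (Suc b) 0" by (simp add: N_def)
  ultimately have "v ^ Suc b * u ^ c = (\<Sum>k\<le>Suc b. N (Suc b) k * (u ^ (c - k) * v ^ (Suc b - k)))"
    by (subst sum.atMost_Suc_shift) simp
  then show ?case by (simp add: N_def)
qed simp

section \<open>The centre\<close>

lemma wc_of_nat: "wc (of_nat n) = of_nat n"
  by (induction n) simp_all

text \<open>Evaluates a normal form at (u, v) in place of (x, d). At (x, d) itself it identifies the
  given model with the ring type; at other pairs it produces endomorphisms.\<close>

definition weval :: "'k::field weyl_algebra \<Rightarrow> 'k weyl_algebra \<Rightarrow> 'k weyl \<Rightarrow> 'k weyl_algebra" where
  "weval u v f = (\<Sum>m\<in>Poly_Mapping.keys f. wc (Poly_Mapping.lookup f m) * u ^ fst m * v ^ snd m)"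

lemma weval_superset:
  assumes "finite S" "Poly_Mapping.keys f \<subseteq> S"
  shows "weval u v f = (\<Sum>m\<in>S. wc (Poly_Mapping.lookup f m) * u ^ fst m * v ^ snd m)"
  unfolding weval_def
  by (rule sum.mono_neutral_left) (use assms in \<open>auto simp: in_keys_iff\<close>)

lemma weval_add: "weval u v (f + g) = weval u v f + weval u v g"
proof -
  define S where "S = Poly_Mapping.keys f \<union> Poly_Mapping.keys g"
  have "finite S" by (simp add: S_def)
  then show ?thesis
    using weval_superset[of S "f + g" u v] weval_superset[of S f u v] weval_superset[of S g u v]
      Poly_Mapping.keys_add[of f g]
    by (simp add: S_def lookup_add algebra_simps sum.distrib)
qed

lemma weval_zero [simp]: "weval u v 0 = 0"
  by (simp add: weval_def)

lemma weval_sum: "weval u v (sum f A) = (\<Sum>a\<in>A. weval u v (f a))"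
  by (induction A rule: infinite_finite_induct) (simp_all add: weval_add)

lemma weval_single: "weval u v (Poly_Mapping.single m c) = wc c * u ^ fst m * v ^ snd m"
  by (cases "c = 0") (simp_all add: weval_def)

lemma weval_const [simp]: "weval u v (weyl_const c) = wc c"
  by (simp add: weyl_const_def weval_single)

lemma weval_mult:
  assumes uv: "v * u - u * v = 1"
  shows "weval u v (weyl_mult f g) = weval u v f * weval u v g"
proof -
  have term_eq: "(\<Sum>k\<le>min b c. wc (r * t * of_nat (fact k * (b choose k) * (c choose k)))
        * u ^ (a + c - k) * v ^ (b + e - k))
      = (wc r * u ^ a * v ^ b) * (wc t * u ^ c * v ^ e)" for a b c e :: nat and r t
  proof -
    define N :: "nat \<Rightarrow> 'a weyl_algebra" where "N = (\<lambda>k. of_nat (fact k * (b choose k) * (c choose k)))"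
    have cm: "x * N k = N k * x" for x k
      unfolding N_def by (rule mult_of_nat_commute[symmetric])
    have "(wc r * u ^ a * v ^ b) * (wc t * u ^ c * v ^ e) = wc r * ((u ^ a * v ^ b) * wc t) * (u ^ c * v ^ e)"
      by (simp only: mult.assoc)
    also have "\<dots> = wc r * wc t * u ^ a * (v ^ b * u ^ c) * v ^ e"
      unfolding wc_central[of t "u ^ a * v ^ b", symmetric] by (simp only: mult.assoc)
    also have "v ^ b * u ^ c = (\<Sum>k\<le>b. N k * (u ^ (c - k) * v ^ (b - k)))"
      unfolding N_def by (rule normal_ordering[OF uv])
    \<comment> \<open>The cut at c matters: beyond it a + c - k and a + (c - k) may differ as
      natural numbers.\<close>
    also have "\<dots> = (\<Sum>k\<le>min b c. N k * (u ^ (c - k) * v ^ (b - k)))"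
    proof (rule sum.mono_neutral_right)
      have "N k = 0" if "c < k" for k using that by (simp add: N_def binomial_eq_0)
      moreover have "c < k" if "k \<in> {..b} - {..min b c}" for k using that by auto
      ultimately show "\<forall>k\<in>{..b} - {..min b c}. N k * (u ^ (c - k) * v ^ (b - k)) = 0" by simp
    qed auto
    also have "wc r * wc t * u ^ a * \<dots> * v ^ e
        = (\<Sum>k\<le>min b c. wc (r * t) * u ^ a * (N k * (u ^ (c - k) * v ^ (b - k))) * v ^ e)"
      by (simp add: sum_distrib_left sum_distrib_right)
    also have "\<dots> = (\<Sum>k\<le>min b c. wc (r * t * of_nat (fact k * (b choose k) * (c choose k)))
        * u ^ (a + c - k) * v ^ (b + e - k))"
    proof (rule sum.cong[OF refl])
      fix k assume k: "k \<in> {..min b c}"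
      have pu: "u ^ (a + c - k) = u ^ a * u ^ (c - k)" and pv: "v ^ (b + e - k) = v ^ (b - k) * v ^ e"
        using k by (simp_all flip: power_add)
      have "wc (r * t) * u ^ a * (N k * (u ^ (c - k) * v ^ (b - k))) * v ^ e
          = wc (r * t) * (u ^ a * N k) * (u ^ (c - k) * (v ^ (b - k) * v ^ e))"
        by (simp only: mult.assoc)
      also have "\<dots> = wc (r * t) * N k * u ^ (a + c - k) * v ^ (b + e - k)"
        by (simp only: cm[of "u ^ a"] pu pv mult.assoc)
      finally show "wc (r * t) * u ^ a * (N k * (u ^ (c - k) * v ^ (b - k))) * v ^ e
          = wc (r * t * of_nat (fact k * (b choose k) * (c choose k))) * u ^ (a + c - k) * v ^ (b + e - k)"
        unfolding wc_simps(4)[of "r * t"] wc_of_nat N_def .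
    qed
    finally show ?thesis by simp
  qed
  show ?thesis
    unfolding weyl_mult_def weval_sum weval_single fst_conv snd_conv term_eq
    by (simp add: weval_def sum_product)
qed

abbreviation rep :: "'k::field weyl \<Rightarrow> 'k weyl_algebra" where
  "rep \<equiv> weval wx wd"

lemma rep_mult: "rep (weyl_mult f g) = rep f * rep g"
  by (rule weval_mult[OF wd_wx])

lemma cf_symbol_rep: "cf (symbol (rep f)) i j = Poly_Mapping.lookup f (i, j)"
proof -
  have "symbol (rep f) = (\<Sum>(a,b)\<in>Poly_Mapping.keys f. mon (Poly_Mapping.lookup f (a, b)) a b)"
    by (simp add: weval_def symbol_sum symbol_normal case_prod_unfold)
  then show ?thesis
    by (simp add: cf_sum_mon[where c = "\<lambda>a b. Poly_Mapping.lookup f (a, b)"] in_keys_iff)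
qed

lemma bij_rep: "bij (rep :: 'k::field weyl \<Rightarrow> _)"
proof (rule bijI)
  show "inj (rep :: 'k weyl \<Rightarrow> _)"
  proof (rule injI)
    fix f g :: "'k weyl"
    assume "rep f = rep g"
    then have "Poly_Mapping.lookup f (i, j) = Poly_Mapping.lookup g (i, j)" for i j
      using cf_symbol_rep[of f j i] cf_symbol_rep[of g j i] by simp
    then show "f = g" by (intro poly_mapping_eqI) auto
  qed
  have "a = rep (\<Sum>(i,j)\<in>supp (symbol a). Poly_Mapping.single (i, j) (cf (symbol a) i j))" for a :: "'k weyl_algebra"
    by (simp add: weval_sum weval_single case_prod_unfold weyl_algebra_expand[of a, unfolded case_prod_unfold, symmetric])
  then show "surj (rep :: 'k weyl \<Rightarrow> _)" unfolding surj_def by blast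
qed

text \<open>The universal property of A_1: \<open>weval_mult\<close> draws only on the Weyl relation
  for (u, v) and on the centrality of scalars.\<close>

lemma weyl_algebra_hom_exists:
  fixes u v :: "'k::field weyl_algebra"
  assumes "v * u - u * v = 1"
  obtains s where "unital_ring_hom s" "\<And>c. s (wc c) = wc c" "s wx = u" "s wd = v"
proof -
  define s where "s = (\<lambda>a. weval u v (inv rep a))"
  have s: "s (rep f) = weval u v f" for f
    by (simp add: s_def inv_f_f[OF bij_is_inj[OF bij_rep]])
  have surj: "\<exists>f. a = rep f" for a :: "'k weyl_algebra"
    using bij_rep by (metis bij_is_surj surj_def)
  have c: "s (wc c) = wc c" for c using s[of "weyl_const c"] by simp
  show thesis
  proof (rule that)
    show "unital_ring_hom s"
    proof
      fix a b :: "'k weyl_algebra"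
      obtain f g where "a = rep f" "b = rep g" using surj by metis
      then show "s (a + b) = s a + s b" "s (a * b) = s a * s b"
        by (simp_all add: s weval_mult[OF assms] flip: weval_add rep_mult)
      show "s 1 = 1" using c[of 1] by simp
    qed
    show "s (wc c) = wc c" for c by fact
    show "s wx = u" using s[of "Poly_Mapping.single (1, 0) 1"] by (simp add: weval_single)
    show "s wd = v" using s[of "Poly_Mapping.single (0, 1) 1"] by (simp add: weval_single)
  qed
qed

definition weyl_algebra_aut :: "('k::field weyl_algebra \<Rightarrow> 'k weyl_algebra) \<Rightarrow> bool" where
  "weyl_algebra_aut s \<longleftrightarrow> unital_ring_hom s \<and> bij s \<and> (\<forall>c. s (wc c) = wc c)"

lemma weyl_aut_conjugate:
  fixes \<sigma> :: "'k::field weyl \<Rightarrow> 'k weyl"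
  assumes "\<And>f. s (rep f) = rep (\<sigma> f)"
  shows "weyl_aut \<sigma> \<longleftrightarrow> weyl_algebra_aut s"
proof -
  have inj: "rep f = rep g \<longleftrightarrow> f = g" for f g :: "'k weyl"
    using bij_rep by (metis bij_is_inj inj_eq)
  have surj: "\<exists>f. a = rep f" for a :: "'k weyl_algebra"
    using bij_rep by (metis bij_is_surj surj_def)
  have all: "(\<forall>a. Q a) \<longleftrightarrow> (\<forall>f. Q (rep f))" for Q :: "'k weyl_algebra \<Rightarrow> bool"
    using surj by metis
  have sr: "s \<circ> rep = rep \<circ> \<sigma>" using assms by (simp add: fun_eq_iff)
  have "bij \<sigma> \<longleftrightarrow> bij s"
  proof
    assume "bij \<sigma>"
    then have "bij (s \<circ> rep)" using bij_rep sr by (metis bij_comp)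
    then show "bij s" using bij_rep by (metis bij_betw_comp_iff)
  next
    assume "bij s"
    then have "bij (rep \<circ> \<sigma>)" using bij_rep sr by (metis bij_comp)
    then show "bij \<sigma>" using bij_rep
      by (metis bij_betw_comp_iff2 subset_UNIV)
  qed
  moreover have "(\<forall>f g. \<sigma> (f + g) = \<sigma> f + \<sigma> g) \<longleftrightarrow> (\<forall>a b. s (a + b) = s a + s b)"
    unfolding all by (simp add: assms inj flip: weval_add)
  moreover have "(\<forall>f g. \<sigma> (weyl_mult f g) = weyl_mult (\<sigma> f) (\<sigma> g)) \<longleftrightarrow> (\<forall>a b. s (a * b) = s a * s b)"
    unfolding all by (simp add: assms inj flip: rep_mult)
  moreover have "(\<forall>c. \<sigma> (weyl_const c) = weyl_const c) \<longleftrightarrow> (\<forall>c. s (wc c) = wc c)"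
    using assms inj weval_const by metis
  moreover have "s 1 = 1" if "\<forall>c. s (wc c) = wc c" using that wc_simps(2) by metis
  ultimately show ?thesis
    unfolding weyl_aut_def weyl_algebra_aut_def unital_ring_hom_def by blast
qed

lemma weyl_algebra_autI:
  assumes "unital_ring_hom s" "\<And>c. s (wc c) = wc c" "unital_ring_hom t" "\<And>c. t (wc c) = wc c"
    and "t (s wx) = wx" "t (s wd) = wd" "s (t wx) = wx" "s (t wd) = wd"
  shows "weyl_algebra_aut s"
proof -
  have "t (s a) = a" "s (t a) = a" for a
    using weyl_hom_unique[OF unital_ring_hom_comp[OF assms(1,3)], of "\<lambda>a. a" a]
      weyl_hom_unique[OF unital_ring_hom_comp[OF assms(3,1)], of "\<lambda>a. a" a] assms
    by (simp_all add: unital_ring_hom_def)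
  then have "bij s" by (metis bijI')
  then show ?thesis using assms by (simp add: weyl_algebra_aut_def)
qed

lemma weyl_algebra_aut_comp:
  "weyl_algebra_aut s \<Longrightarrow> weyl_algebra_aut t \<Longrightarrow> weyl_algebra_aut (s \<circ> t)"
  by (auto simp: weyl_algebra_aut_def unital_ring_hom_def intro: bij_comp)

lemma weyl_algebra_aut_inv:
  assumes "weyl_algebra_aut s"
  shows "weyl_algebra_aut (inv s)"
proof -
  have s: "unital_ring_hom s" "bij s" "\<And>c. s (wc c) = wc c"
    using assms by (auto simp: weyl_algebra_aut_def)
  interpret unital_ring_hom s by (rule s)
  have i: "inv s (s q) = q" "s (inv s q) = q" for q
    using s(2) by (auto simp: bij_is_inj bij_is_surj surj_f_inv_f)
  have "unital_ring_hom (inv s)"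
    by unfold_locales (metis i add, metis i mult, metis i one)
  then show ?thesis
    using bij_imp_bij_inv[OF s(2)] i s(3) by (metis weyl_algebra_aut_def)
qed

section \<open>The centre in characteristic p\<close>

definition power_subst :: "nat \<Rightarrow> 'k::field poly poly \<Rightarrow> 'k poly poly" where
  "power_subst p = bieval zconst (varX ^ p) (varY ^ p)"

lemma unital_ring_hom_power_subst: "unital_ring_hom (power_subst p)"
  by (simp add: power_subst_def unital_ring_hom_subst)

lemma power_subst_expand: "power_subst p q = (\<Sum>(i,j)\<in>supp q. mon (cf q i j) (p * i) (p * j))"
  unfolding power_subst_def bieval_expand[OF unital_ring_hom_zconst]
  by (simp add: mon_eq power_mult)

lemma cf_power_subst:
  assumes "p > 0"
  shows "cf (power_subst p q) i j = (if p dvd i \<and> p dvd j then cf q (i div p) (j div p) else 0)"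
proof -
  have "cf (power_subst p q) i j = (\<Sum>s\<in>supp q. if i = p * fst s \<and> j = p * snd s then cf q (fst s) (snd s) else 0)"
    by (simp add: power_subst_expand cf_sum case_prod_unfold cf_mon)
  also have "\<dots> = (\<Sum>s\<in>supp q. if s = (i div p, j div p) then (if p dvd i \<and> p dvd j then cf q (i div p) (j div p) else 0) else 0)"
    by (rule sum.cong) (use assms in auto)
  also have "\<dots> = (if p dvd i \<and> p dvd j then cf q (i div p) (j div p) else 0)"
    by (simp add: in_supp)
  finally show ?thesis .
qed

text \<open>The monomials x^(p i) d^(p j) are already in normal order; what remains is to replace
  the degree-bounded double sum by a sum over the support.\<close>

lemma symbol_rep_z_emb: "symbol (rep (z_emb p q)) = power_subst p q"
proof -
  have "symbol (rep (z_emb p q)) = (\<Sum>j\<le>degree q. \<Sum>i\<le>degree (coeff q j). mon (cf q i j) (p * i) (p * j))"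
    unfolding z_emb_def weval_sum weval_single symbol_sum fst_conv snd_conv symbol_normal ..
  also have "\<dots> = (\<Sum>s\<in>(SIGMA j:{..degree q}. {..degree (coeff q j)}). mon (cf q (snd s) (fst s)) (p * snd s) (p * fst s))"
    by (simp add: sum.Sigma case_prod_unfold)
  also have "\<dots> = (\<Sum>s\<in>prod.swap ` (SIGMA j:{..degree q}. {..degree (coeff q j)}). mon (cf q (fst s) (snd s)) (p * fst s) (p * snd s))"
    by (subst sum.reindex) (auto simp: inj_on_def)
  also have "\<dots> = (\<Sum>s\<in>supp q. mon (cf q (fst s) (snd s)) (p * fst s) (p * snd s))"
  proof (rule sum.mono_neutral_right)
    show "supp q \<subseteq> prod.swap ` (SIGMA j:{..degree q}. {..degree (coeff q j)})"
    proof
      fix s assume "s \<in> supp q"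
      then have nz: "cf q (fst s) (snd s) \<noteq> 0" by (cases s) (simp add: in_supp)
      then have "snd s \<le> degree q" by (intro le_degree) auto
      moreover have "fst s \<le> degree (coeff q (snd s))" using nz by (rule le_degree)
      ultimately show "s \<in> prod.swap ` (SIGMA j:{..degree q}. {..degree (coeff q j)})"
        by (intro image_eqI[of _ _ "prod.swap s"]) (cases s, auto)+
    qed
    show "\<forall>s\<in>prod.swap ` (SIGMA j:{..degree q}. {..degree (coeff q j)}) - supp q.
        mon (cf q (fst s) (snd s)) (p * fst s) (p * snd s) = 0"
      by (auto simp: in_supp mon_def)
  qed auto
  finally show ?thesis by (simp add: power_subst_expand case_prod_unfold)
qed

definition centre_emb :: "nat \<Rightarrow> 'k::field poly poly \<Rightarrow> 'k weyl_algebra" where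
  "centre_emb p q = of_symbol (power_subst p q)"

lemma rep_z_emb: "rep (z_emb p q) = centre_emb p q"
  by (rule symbol_eqI) (simp add: symbol_rep_z_emb centre_emb_def)

lemma inj_centre_emb:
  assumes "p > 0"
  shows "inj (centre_emb p :: 'k::field poly poly \<Rightarrow> _)"
proof (rule injI)
  fix q r :: "'k poly poly"
  assume "centre_emb p q = centre_emb p r"
  then have "power_subst p q = power_subst p r" by (simp add: centre_emb_def of_symbol_inject)
  then have "cf (power_subst p q) (p * i) (p * j) = cf (power_subst p r) (p * i) (p * j)" for i j by simp
  then show "q = r" using assms by (intro cf_eqI) (simp add: cf_power_subst)
qed

lemma centre_emb_add: "centre_emb p (q + r) = centre_emb p q + centre_emb p r"
  by (rule symbol_eqI) (simp add: centre_emb_def unital_ring_hom.add[OF unital_ring_hom_power_subst])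

lemma centre_emb_simps [simp]:
  "centre_emb p (zconst c) = wc c" "centre_emb p varX = wx ^ p" "centre_emb p varY = wd ^ p"
  by (auto intro!: symbol_eqI simp: centre_emb_def symbol_wd_power_one power_subst_def unital_ring_hom_zconst symbol_wx_power_one)

context
  fixes p :: nat
  assumes char: "CHAR('k::field) = p" and pos: "p > 0"
begin

lemma of_nat_p: "(of_nat p :: 'k weyl_algebra) = 0"
proof -
  have "(of_nat p :: 'k) = 0" using of_nat_CHAR[where 'a = 'k] by (simp add: char)
  then show ?thesis using wc_of_nat[where 'a = 'k, of p] by simp
qed

lemma wd_p_central: "wd ^ p * a = a * (wd ^ p :: 'k weyl_algebra)"
proof (induction a rule: weyl_algebra_induct)
  case (const c)
  then show ?case by (rule wc_central[symmetric])
next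
  case wx
  \<comment> \<open>The commutator formula is applied to the pair (d, -x): [d^p, x] = p d^(p-1) =
    0.\<close>
  have "- wx * wd - wd * (- wx) = (1 :: 'k weyl_algebra)" using wd_wx by (simp add: algebra_simps)
  from commutator_power[OF this, of p] show ?case by (simp add: of_nat_p)
next
  case wd
  then show ?case by (simp add: power_commutes)
next
  case (add a b)
  then show ?case by (simp add: algebra_simps)
next
  case (mult a b)
  then show ?case by (metis mult.assoc)
qed

text \<open>On symbols, powers of x multiply freely from the left and powers of d from the right;
  d^p is central and may change sides. This is what makes \<open>centre_emb\<close>
  multiplicative.\<close>

lemma symbol_centre_emb_mult: "symbol (centre_emb p q * a) = power_subst p q * symbol (a :: 'k weyl_algebra)"
proof -
  interpret ps: unital_ring_hom "power_subst p" by (rule unital_ring_hom_power_subst)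
  show ?thesis
  proof (induction q arbitrary: a rule: bivariate_induct)
    case (const c)
    then show ?case by (simp add: symbol_mult_left power_subst_def unital_ring_hom_zconst)
  next
    case X
    then show ?case by (simp add: symbol_wx_power power_subst_def unital_ring_hom_zconst)
  next
    case Y
    then show ?case
      by (simp add: wd_p_central symbol_wd_power) (simp add: power_subst_def unital_ring_hom_zconst)
  next
    case (add f g)
    then show ?case by (simp add: centre_emb_add ps.add algebra_simps)
  next
    case (mult f g)
    have "centre_emb p (f * g) = centre_emb p f * (centre_emb p g :: 'k weyl_algebra)"
      by (rule symbol_eqI) (simp add: mult, simp add: centre_emb_def ps.mult)
    then show ?case by (simp add: mult ps.mult mult.assoc)
  qed
qed

lemma unital_ring_hom_centre_emb: "unital_ring_hom (centre_emb p :: 'k poly poly \<Rightarrow> _)"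
proof
  interpret ps: unital_ring_hom "power_subst p" by (rule unital_ring_hom_power_subst)
  fix q r :: "'k poly poly"
  show "centre_emb p (q + r) = centre_emb p q + centre_emb p r" by (rule centre_emb_add)
  show "centre_emb p (q * r) = centre_emb p q * centre_emb p r"
    by (rule symbol_eqI) (simp add: symbol_centre_emb_mult, simp add: centre_emb_def ps.mult)
  show "centre_emb p (1 :: 'k poly poly) = 1"
    by (rule symbol_eqI) (simp add: centre_emb_def)
qed

lemma centre_emb_central: "centre_emb p q * a = a * centre_emb p (q :: 'k poly poly)"
proof -
  interpret ce: unital_ring_hom "centre_emb p :: 'k poly poly \<Rightarrow> _" by (rule unital_ring_hom_centre_emb)
  show ?thesis
  proof (induction q rule: bivariate_induct)
    case (const c)
    then show ?case by (simp add: wc_central)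
  next
    case X
    show ?case
    proof (induction a rule: weyl_algebra_induct)
      case wd
      from commutator_power[OF wd_wx[where 'a = 'k], of p] show ?case by (simp add: of_nat_p)
    qed (simp_all add: wc_central power_commutes algebra_simps, metis mult.assoc)
  next
    case Y
    then show ?case by (simp add: wd_p_central)
  next
    case (add f g)
    then show ?case by (simp add: ce.add algebra_simps)
  next
    case (mult f g)
    then show ?case by (metis ce.mult mult.assoc)
  qed
qed

text \<open>Commuting with d and with x makes both partial derivatives of the symbol vanish, and in
  characteristic p this leaves only exponents divisible by p.\<close>

lemma central_in_range:
  assumes "\<And>b. a * b = b * (a :: 'k weyl_algebra)"
  obtains q where "a = centre_emb p q"
proof -
  have "varY * symbol a = varY * symbol a + dX (symbol a)"
    using arg_cong[OF assms[of wd], of symbol] by (simp add: symbol_mult_left symbol_mult_right)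
  then have dX0: "dX (symbol a) = 0" by simp
  have "varX * symbol a + dY (symbol a) = varX * symbol a"
    using arg_cong[OF assms[of wx], of symbol] by (simp add: symbol_mult_left symbol_mult_right)
  then have dY0: "dY (symbol a) = 0" by simp
  have dv: "p dvd i \<and> p dvd j" if nz: "cf (symbol a) i j \<noteq> 0" for i j
  proof
    show "p dvd i"
    proof (cases i)
      case (Suc i')
      have "cf (dX (symbol a)) i' j = of_nat i * cf (symbol a) i j"
        by (simp add: dX_def coeff_map_poly coeff_pderiv Suc)
      then have "(of_nat i :: 'k) = 0" using nz by (simp add: dX0)
      then show ?thesis using char by (simp add: of_nat_eq_0_iff_char_dvd)
    qed simp
    show "p dvd j"
    proof (cases j)
      case (Suc j')
      have "cf (dY (symbol a)) i j' = of_nat j * cf (symbol a) i j"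
        by (simp add: dY_def coeff_pderiv Suc of_nat_poly algebra_simps)
      then have "(of_nat j :: 'k) = 0" using nz by (simp add: dY0)
      then show ?thesis using char by (simp add: of_nat_eq_0_iff_char_dvd)
    qed simp
  qed
  interpret ps: unital_ring_hom "power_subst p" by (rule unital_ring_hom_power_subst)
  define q where "q = (\<Sum>(i,j)\<in>supp (symbol a). mon (cf (symbol a) i j) (i div p) (j div p))"
  have psm: "power_subst p (mon c i j) = mon c (p * i) (p * j)" for c :: 'k and i j
    by (simp add: mon_eq ps.mult ps.power)
      (simp add: power_subst_def unital_ring_hom_zconst power_mult)
  have "power_subst p q = (\<Sum>(i,j)\<in>supp (symbol a). mon (cf (symbol a) i j) i j)"
    unfolding q_def ps.sum case_prod_unfold psm
    by (rule sum.cong) (use dv in \<open>auto simp: in_supp\<close>)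
  then have "power_subst p q = symbol a" by (simp add: sum_mon_supp)
  then show thesis by (intro that[of q] symbol_eqI) (simp add: centre_emb_def)
qed

end

section \<open>Lifting automorphisms of the centre\<close>

text \<open>Normal ordering of d g costs the derivative of g in X, of weight at most
  \<open>a - w\<^sub>1\<close>. This lies strictly below \<open>a + w\<^sub>2\<close> and does not
  show in the top part.\<close>

lemma bi_top_left_d:
  assumes "w\<^sub>1 + w\<^sub>2 > 0" "bi_top w\<^sub>1 w\<^sub>2 a g g'"
  shows "bi_top w\<^sub>1 w\<^sub>2 (a + w\<^sub>2) (left_d g) (varY * g')"
proof -
  interpret top_part "bi_top w\<^sub>1 w\<^sub>2" by (rule top_part_bi_top)
  have "bi_top w\<^sub>1 w\<^sub>2 w\<^sub>2 varY varY"
    unfolding varY_mon by (rule bi_top_mon) simp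
  from mult[OF this assms(2)] have 1: "bi_top w\<^sub>1 w\<^sub>2 (a + w\<^sub>2) (varY * g) (varY * g')"
    by (simp add: add.commute)
  have "w\<^sub>1 * real i + w\<^sub>2 * real j < a + w\<^sub>2" if "cf (dX g) i j \<noteq> 0" for i j
  proof -
    have "cf g (Suc i) j \<noteq> 0" using that by (auto simp: dX_def coeff_map_poly coeff_pderiv)
    then have "w\<^sub>1 * real (Suc i) + w\<^sub>2 * real j \<le> a"
      using assms(2) unfolding bi_top_iff by blast
    then show ?thesis using assms(1) by (simp add: algebra_simps)
  qed
  then have 2: "bi_top w\<^sub>1 w\<^sub>2 (a + w\<^sub>2) (dX g) 0"
    unfolding bi_top_iff by (force intro: less_imp_le)
  show ?thesis using add[OF 1 2] by (simp add: left_d_def)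
qed

lemma symbol_wd_power_left: "symbol (wd ^ j * b) = (left_d ^^ j) (symbol b)"
  by (induction j) (simp_all add: symbol_mult_left left_d_def mult.assoc)

text \<open>The associated graded ring is commutative: all corrections from normal ordering have
  smaller weight.\<close>

lemma bi_top_symbol_mult:
  assumes w: "w\<^sub>1 + w\<^sub>2 > 0" and a: "bi_top w\<^sub>1 w\<^sub>2 a (symbol u) f" and b: "bi_top w\<^sub>1 w\<^sub>2 b (symbol v) g"
  shows "bi_top w\<^sub>1 w\<^sub>2 (a + b) (symbol (u * v)) (f * g)"
proof -
  interpret top_part "bi_top w\<^sub>1 w\<^sub>2" by (rule top_part_bi_top)
  let ?S = "supp (symbol u)"
  have sub: "supp f \<subseteq> ?S"
    using a by (auto simp: bi_top_iff supp_def split: if_splits)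
  have "u * v = (\<Sum>(i,j)\<in>?S. wc (cf (symbol u) i j) * wx ^ i * wd ^ j) * v"
    using weyl_algebra_expand[of u] by simp
  then have 1: "symbol (u * v) = (\<Sum>(i,j)\<in>?S. zconst (cf (symbol u) i j) * (varX ^ i * (left_d ^^ j) (symbol v)))"
    by (simp add: sum_distrib_right symbol_sum case_prod_unfold mult.assoc symbol_mult_left
        symbol_wx_power symbol_wd_power_left)
  have "f = (\<Sum>(i,j)\<in>supp f. mon (cf f i j) i j)" by (simp add: sum_mon_supp)
  also have "\<dots> = (\<Sum>(i,j)\<in>?S. mon (cf f i j) i j)"
    by (rule sum.mono_neutral_left) (use sub in \<open>auto simp: in_supp mon_def\<close>)
  finally have "f * g = (\<Sum>(i,j)\<in>?S. mon (cf f i j) i j) * g" by simp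
  then have 2: "f * g = (\<Sum>(i,j)\<in>?S. zconst (cf f i j) * (varX ^ i * (varY ^ j * g)))"
    by (simp add: sum_distrib_right case_prod_unfold mon_eq mult.assoc)
  have d: "bi_top w\<^sub>1 w\<^sub>2 (b + real j * w\<^sub>2) ((left_d ^^ j) (symbol v)) (varY ^ j * g)" for j
  proof (induction j)
    case (Suc j)
    from bi_top_left_d[OF w Suc] show ?case by (simp add: algebra_simps)
  qed (simp add: b)
  have x: "bi_top w\<^sub>1 w\<^sub>2 w\<^sub>1 varX varX"
    unfolding varX_mon by (rule bi_top_mon) simp
  have "bi_top w\<^sub>1 w\<^sub>2 (a + b) (zconst (cf (symbol u) i j) * (varX ^ i * (left_d ^^ j) (symbol v)))
      (zconst (cf f i j) * (varX ^ i * (varY ^ j * g)))" for i j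
  proof -
    define e where "e = a - (real i * w\<^sub>1 + real j * w\<^sub>2)"
    have "const_top e (cf (symbol u) i j) (cf f i j)"
      using a[unfolded bi_top_iff, rule_format, of j i]
      by (auto simp: const_top_def e_def algebra_simps)
    from mult[OF bi_top_zconst[OF this] mult[OF power[OF x, of i] d[of j]]]
    show ?thesis by (simp add: e_def)
  qed
  then show ?thesis unfolding 1 2 by (intro sum) auto
qed

lemma bi_top_symbol_power:
  assumes "w\<^sub>1 + w\<^sub>2 > 0" "bi_top w\<^sub>1 w\<^sub>2 a (symbol u) f"
  shows "bi_top w\<^sub>1 w\<^sub>2 (real n * a) (symbol (u ^ n)) (f ^ n)"
proof (induction n)
  case 0
  show ?case by (simp add: top_part.one[OF top_part_bi_top])
next
  case (Suc n)
  from bi_top_symbol_mult[OF assms Suc] show ?case by (simp add: algebra_simps)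
qed

lemma bi_top_weight_unique:
  assumes "bi_top w\<^sub>1 w\<^sub>2 a f f'" "bi_top w\<^sub>1 w\<^sub>2 b f f''" "f' \<noteq> 0" "f'' \<noteq> 0"
  shows "a = b"
proof -
  have le: "a \<le> b" if h: "bi_top w\<^sub>1 w\<^sub>2 a f f'" "bi_top w\<^sub>1 w\<^sub>2 b f f''" "f' \<noteq> 0" for a b f' f''
  proof -
    obtain i j where "cf f' i j \<noteq> 0" using h(3) by (metis cf_eqI coeff_0)
    then show ?thesis using h(1,2) unfolding bi_top_iff by metis
  qed
  show ?thesis using le assms by (metis order_antisym)
qed

text \<open>Both sides are additive and obey the same Leibniz rule twisted by \<open>e\<close>, so
  agreement on the generators suffices.\<close>

lemma chain_rule:
  assumes D: "derivation D" "\<And>c. D (zconst c) = 0"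
    and e: "unital_ring_hom e" "\<And>c. e (zconst c) = zconst c"
  shows "D (e f) = e (dX f) * D (e varX) + e (dY f) * D (e varY)"
proof -
  interpret D: derivation D by fact
  interpret e: unital_ring_hom e by fact
  show ?thesis
    by (induction f rule: bivariate_induct)
      (simp_all add: e(2) D(2) e.add e.mult D.add D.mult dX.add dX.mult dY.add dY.mult algebra_simps)
qed

lemma jacobian_comp:
  assumes e: "unital_ring_hom e" "\<And>c. e (zconst c) = zconst c"
  shows "jacobian (e \<circ> \<tau>) = e (jacobian \<tau>) * jacobian e"
proof -
  interpret e: unital_ring_hom e by fact
  note X = chain_rule[OF derivation_dX _ e] and Y = chain_rule[OF derivation_dY _ e]
  show ?thesis
    by (simp add: jacobian_def X[of "\<tau> varX"] X[of "\<tau> varY"] Y[of "\<tau> varX"] Y[of "\<tau> varY"] e.mult e.diff)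
      (simp add: algebra_simps)
qed

lemma dX_map_const: "dX (map_poly (\<lambda>c. [:c:]) f) = 0"
  by (rule cf_eqI) (simp add: dX_def coeff_map_poly coeff_pderiv)

lemma jacobian_generators:
  "jacobian (elementaryX f) = 1" "jacobian (elementaryY f) = 1" "jacobian rotation = 1"
  "\<alpha> \<noteq> 0 \<Longrightarrow> jacobian (diagonal \<alpha>) = 1" "jacobian (dilation c) = zconst c"
  using zconst_simps(4)[of \<alpha> "inverse \<alpha>"]
  by (simp_all add: jacobian_def dX.add dY.add dX.mult dY.mult dX_map_const derivation.diff[OF derivation_dX]
      dX.diff[of 0, simplified] dY.diff[of 0, simplified])
    (simp add: dY_def)

lemma map_const_to_X:
  assumes "unital_ring_hom \<phi>" "\<And>c. \<phi> (zconst c) = zconst c" "\<phi> varY = varX" 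
  shows "\<phi> (map_poly (\<lambda>c. [:c:]) g) = [:g:]"
proof (induction g)
  case (pCons a g)
  have "map_poly (\<lambda>c. [:c:]) (pCons a g) = zconst a + varY * map_poly (\<lambda>c. [:c:]) g"
    by (simp add: map_poly_pCons zconst_def varY_def)
  then have "\<phi> (map_poly (\<lambda>c. [:c:]) (pCons a g)) = zconst a + varX * [:g:]"
    by (simp only: unital_ring_hom.add[OF assms(1)] unital_ring_hom.mult[OF assms(1)] assms pCons)
  then show ?case by (simp add: zconst_def varX_def)
qed (simp add: unital_ring_hom.zero[OF assms(1)])

lemma map_const_fixed:
  assumes "unital_ring_hom \<phi>" "\<And>c. \<phi> (zconst c) = zconst c" "\<phi> varY = varY" 
  shows "\<phi> (map_poly (\<lambda>c. [:c:]) g) = map_poly (\<lambda>c. [:c:]) g"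
proof (induction g)
  case (pCons a g)
  have eq: "map_poly (\<lambda>c. [:c:]) (pCons a g) = zconst a + varY * map_poly (\<lambda>c. [:c:]) g"
    by (simp add: map_poly_pCons zconst_def varY_def)
  show ?case
    unfolding eq by (simp only: unital_ring_hom.add[OF assms(1)] unital_ring_hom.mult[OF assms(1)] assms pCons)
qed (simp add: unital_ring_hom.zero[OF assms(1)])

lemma wc_mult_power: "(wc c * a) ^ n = wc (c ^ n) * a ^ n"
proof (induction n)
  case (Suc n)
  have "(wc c * a) ^ Suc n = wc c * (a * wc (c ^ n)) * a ^ n"
    by (simp only: power_Suc Suc mult.assoc)
  also have "a * wc (c ^ n) = wc (c ^ n) * a" by (rule wc_central[symmetric])
  also have "wc c * (wc (c ^ n) * a) * a ^ n = wc (c ^ Suc n) * a ^ Suc n"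
    by (simp add: mult.assoc)
  finally show ?case .
qed simp

section \<open>Roots of p-th powers and automorphisms that lift\<close>

context
  fixes p :: nat
  assumes char: "CHAR('k::field) = p" and pos: "p > 0"
begin

lemma prime_p: "prime p"
  using prime_CHAR_semidom[where 'a = 'k] char pos by simp

lemma frobenius_add: "(a + b) ^ p = a ^ p + (b :: 'k poly poly) ^ p"
  by (rule freshmans_dream) (use prime_p in \<open>simp_all add: char\<close>)

lemma p_root_unique:
  assumes "a ^ p = (b :: 'k poly poly) ^ p"
  shows "a = b"
proof -
  have "(a - b) ^ p + b ^ p = a ^ p" using frobenius_add[of "a - b" b] by simp
  then show ?thesis using assms pos by simp
qed

text \<open>For total degree the leading symbol of u^p is the p-th power of that of u, and Frobenius
  is injective on K[X,Y]; hence u = \<gamma> v + e with a scalar e, and comparing p-th powers gives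
  e^p = 0. The first hypothesis says that powers of \<gamma> v + e involve no reordering, which
  treats x and d alike.\<close>

lemma p_root_generator:
  fixes u v :: "'k weyl_algebra"
  assumes v: "\<And>e k. symbol ((wc \<gamma> * v + wc e) ^ k) = (mon \<gamma> i j + zconst e) ^ k"
    and ij: "i + j = 1" and \<gamma>: "\<gamma> \<noteq> 0" and u: "symbol (u ^ p) = mon \<gamma> i j ^ p"
  shows "u = wc \<gamma> * v"
proof -
  define U where "U = symbol u"
  define a where "a = weight 1 1 U"
  define U' where "U' = homogeneous_part 1 1 a U"
  have m0: "mon \<gamma> i j \<noteq> 0" using \<gamma> by (simp add: mon_def)
  have "symbol (u ^ p) \<noteq> 0" using u m0 by simp
  then have "u \<noteq> 0" using pos by (auto simp: power_0_left)
  then have U0: "U \<noteq> 0" unfolding U_def using symbol_eqI[of u 0] by auto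
  have top: "bi_top 1 1 a U U'"
    unfolding U'_def a_def by (rule bi_top_homogeneous_part) (rule weight_ge)
  have U'0: "U' \<noteq> 0" unfolding U'_def a_def using U0 by (rule homogeneous_part_weight_nonzero)
  have t1: "bi_top 1 1 (real p * a) (symbol (u ^ p)) (U' ^ p)"
    by (rule bi_top_symbol_power) (use top in \<open>simp_all add: U_def\<close>)
  have "bi_top 1 1 1 (mon \<gamma> i j) (mon \<gamma> i j)" using ij by (intro bi_top_mon) (simp flip: of_nat_add)
  from top_part.power[OF top_part_bi_top this, of p]
  have t2: "bi_top 1 1 (real p) (symbol (u ^ p)) (mon \<gamma> i j ^ p)" by (simp add: u)
  have "real p * a = real p"
    by (rule bi_top_weight_unique[OF t1 t2]) (use U'0 m0 in auto)
  then have a1: "a = 1" using pos by simp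
  have "U' ^ p = mon \<gamma> i j ^ p"
    using top_part.unique[OF top_part_bi_top] t1 t2 a1 by fastforce
  then have U': "U' = mon \<gamma> i j" by (rule p_root_unique)
  define e where "e = cf U 0 0"
  have "U = mon \<gamma> i j + zconst e"
  proof (rule cf_eqI)
    fix k l
    have z: "cf (zconst e) k l = (if k = 0 \<and> l = 0 then e else 0)"
      by (cases k; cases l) (auto simp: zconst_def)
    consider "k + l = 0" | "k + l = 1" | "k + l > 1" by linarith
    then show "cf U k l = cf (mon \<gamma> i j + zconst e) k l"
    proof cases
      case 1
      then have "cf (zconst e) k l = cf U k l" by (simp add: zconst_def e_def)
      then show ?thesis using 1 ij by (auto simp: cf_mon)
    next
      case 2
      then have "cf U k l = cf U' k l"
        by (simp add: U'_def cf_homogeneous_part a1 flip: of_nat_add)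
      then show ?thesis using 2 by (auto simp: z U')
    next
      case 3
      then have "\<not> 1 * real k + 1 * real l \<le> a" by (simp add: a1 flip: of_nat_add)
      then have "cf U k l = 0" using top unfolding bi_top_iff by blast
      then show ?thesis using 3 ij by (auto simp: z cf_mon)
    qed
  qed
  moreover have "symbol (wc \<gamma> * v + wc e) = mon \<gamma> i j + zconst e" using v[of e 1] by simp
  ultimately have ue: "u = wc \<gamma> * v + wc e" by (intro symbol_eqI) (simp add: U_def)
  then have "(mon \<gamma> i j + zconst e) ^ p = mon \<gamma> i j ^ p" using u v by simp
  then have "zconst e ^ p = 0" by (simp add: frobenius_add)
  then show ?thesis using ue by simp
qed

lemma p_root_wx:
  fixes u :: "'k weyl_algebra"
  assumes "\<gamma> \<noteq> 0" "u ^ p = wc (\<gamma> ^ p) * wx ^ p"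
  shows "u = wc \<gamma> * wx"
proof (rule p_root_generator[where i = 1 and j = 0])
  fix e k
  show "symbol ((wc \<gamma> * wx + wc e) ^ k) = (mon \<gamma> 1 0 + zconst e) ^ k"
    by (induction k) (simp_all add: distrib_right symbol_mult_left mult.assoc mon_eq algebra_simps)
  show "symbol (u ^ p) = mon \<gamma> 1 0 ^ p"
    by (simp add: assms symbol_mult_left symbol_wx_power_one mon_eq power_mult_distrib)
qed (use assms in auto)

lemma p_root_wd:
  fixes u :: "'k weyl_algebra"
  assumes "\<gamma> \<noteq> 0" "u ^ p = wc (\<gamma> ^ p) * wd ^ p"
  shows "u = wc \<gamma> * wd"
proof (rule p_root_generator[where i = 0 and j = 1])
  fix e k
  have r: "symbol (a * (wc \<gamma> * wd + wc e)) = (mon \<gamma> 0 1 + zconst e) * symbol a" for a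
  proof -
    have "a * (wc \<gamma> * wd + wc e) = (a * wc \<gamma>) * wd + a * wc e" by (simp only: distrib_left mult.assoc)
    then have "symbol (a * (wc \<gamma> * wd + wc e)) = varY * (zconst \<gamma> * symbol a) + zconst e * symbol a"
      by (simp only: symbol_simps symbol_mult_right)
    then show ?thesis by (simp add: mon_eq algebra_simps)
  qed
  show "symbol ((wc \<gamma> * wd + wc e) ^ k) = (mon \<gamma> 0 1 + zconst e) ^ k"
  proof (induction k)
    case (Suc k)
    show ?case unfolding power_Suc2[of "wc \<gamma> * wd + wc e"] r by (simp add: Suc)
  qed simp
  show "symbol (u ^ p) = mon \<gamma> 0 1 ^ p"
    by (simp add: assms symbol_mult_left symbol_wd_power_one mon_eq power_mult_distrib)
qed (use assms in auto)

definition lifts :: "('k poly poly \<Rightarrow> 'k poly poly) \<Rightarrow> ('k weyl_algebra \<Rightarrow> 'k weyl_algebra) \<Rightarrow> bool" where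
  "lifts \<tau> s \<longleftrightarrow> weyl_algebra_aut s \<and> (\<forall>q. centre_emb p (\<tau> q) = s (centre_emb p q))"

text \<open>Uniqueness of p-th roots gives s x = \<gamma> x and s d = d, and then [d, x] = 1 reads
  \<gamma> = 1. Applied to the identity of the centre, the second conclusion yields injectivity of
  restriction.\<close>

lemma lifts_dilation:
  assumes s: "lifts (dilation (\<gamma> ^ p)) s" and \<gamma>: "\<gamma> \<noteq> 0"
  shows "\<gamma> = 1" "s a = a"
proof -
  interpret s: unital_ring_hom s using s by (simp add: lifts_def weyl_algebra_aut_def)
  have sc: "s (wc c) = wc c" for c using s by (simp add: lifts_def weyl_algebra_aut_def)
  interpret ce: unital_ring_hom "centre_emb p :: 'k poly poly \<Rightarrow> _"
    by (rule unital_ring_hom_centre_emb[OF char pos])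
  have lift: "centre_emb p (dilation (\<gamma> ^ p) q) = s (centre_emb p q)" for q
    using s unfolding lifts_def by blast
  have "s wx ^ p = wc (\<gamma> ^ p) * wx ^ p" "s wd ^ p = wc (1 ^ p) * wd ^ p"
    using lift[of varX] lift[of varY] by (simp_all add: s.power ce.mult del: zconst_simps)
  then have sx: "s wx = wc \<gamma> * wx" and sd: "s wd = wd"
    using p_root_wx[OF \<gamma>] p_root_wd[of 1 "s wd"] by auto
  have "s (wd * wx - wx * wd) = wc \<gamma> * (wd * wx - wx * wd)"
    by (simp add: s.diff s.mult sx sd mult.assoc right_diff_distrib)
      (simp add: wc_central[of \<gamma> "wd * wx"] wc_central[of \<gamma> wx] mult.assoc)
  then have "wc \<gamma> = 1" by (simp add: wd_wx)
  then have "symbol (wc \<gamma>) = symbol 1" by (rule arg_cong)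
  then have "zconst \<gamma> = 1" by (simp only: symbol_gens symbol_simps)
  then show g1: "\<gamma> = 1" using zconst_simps(2,7) by metis
  show "s a = a"
    by (rule weyl_hom_unique[OF s.unital_ring_hom_axioms, of "\<lambda>a. a"])
      (simp_all add: sc sx sd g1 unital_ring_hom_def)
qed

text \<open>An automorphism preserves the centre, which \<open>centre_emb\<close> identifies with
  K[X,Y]. The same construction for the inverse of \<open>s\<close> provides the inverse of
  \<tau>.\<close>

lemma lifts_exists:
  assumes s: "weyl_algebra_aut s"
  obtains \<tau> where "z_aut \<tau>" "lifts \<tau> s"
proof -
  let ?Z = "centre_emb p :: 'k poly poly \<Rightarrow> _"
  interpret ce: unital_ring_hom ?Z by (rule unital_ring_hom_centre_emb[OF char pos])
  have inj: "?Z q = ?Z r \<longleftrightarrow> q = r" for q r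
    using inj_centre_emb[OF pos] by (metis inj_eq)
  have ex: "\<exists>r. ?Z r = s (?Z q)" if s: "weyl_algebra_aut s" for s q
  proof -
    interpret s: unital_ring_hom s using s by (simp add: weyl_algebra_aut_def)
    have "s (?Z q) * b = b * s (?Z q)" for b
    proof -
      obtain b' where b': "b = s b'" using s by (auto simp: weyl_algebra_aut_def bij_def surj_def)
      show ?thesis using centre_emb_central[OF char pos, of q b'] by (simp add: b' flip: s.mult)
    qed
    then show ?thesis using central_in_range[OF char pos] by metis
  qed
  define \<tau> where "\<tau> = (\<lambda>s q. SOME r. ?Z r = s (?Z q))"
  have \<tau>: "?Z (\<tau> s q) = s (?Z q)" if "weyl_algebra_aut s" for s q
    unfolding \<tau>_def by (rule someI_ex) (rule ex[OF that])
  note s' = weyl_algebra_aut_inv[OF s]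
  interpret s: unital_ring_hom s using s by (simp add: weyl_algebra_aut_def)
  have sc: "s (wc c) = wc c" for c using s by (simp add: weyl_algebra_aut_def)
  have i: "inv s (s a) = a" "s (inv s a) = a" for a
    using s by (auto simp: weyl_algebra_aut_def bij_is_inj bij_is_surj surj_f_inv_f)
  have "\<tau> (inv s) (\<tau> s q) = q" "\<tau> s (\<tau> (inv s) q) = q" for q
    by (simp_all add: \<tau>[OF s] \<tau>[OF s'] i flip: inj)
  then have "bij (\<tau> s)" by (metis bijI')
  moreover have "unital_ring_hom (\<tau> s)"
    by unfold_locales (simp_all add: \<tau>[OF s] ce.add ce.mult s.add s.mult flip: inj)
  moreover have "\<tau> s (zconst c) = zconst c" for c
    by (simp add: \<tau>[OF s] sc flip: inj)
  ultimately have "z_aut (\<tau> s)" by (intro z_autI)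
  moreover have "lifts (\<tau> s) s" using s \<tau>[OF s] by (simp add: lifts_def)
  ultimately show thesis by (rule that)
qed

lemma lifts_comp: "lifts \<tau> s \<Longrightarrow> lifts \<tau>' s' \<Longrightarrow> lifts (\<tau> \<circ> \<tau>') (s \<circ> s')"
  by (simp add: lifts_def weyl_algebra_aut_comp)

lemma lifts_inv:
  assumes "lifts \<tau> s" "bij \<tau>"
  shows "lifts (inv \<tau>) (inv s)"
proof -
  have s: "weyl_algebra_aut s" using assms(1) by (simp add: lifts_def)
  have "centre_emb p (inv \<tau> q) = inv s (centre_emb p q)" for q
  proof -
    have "s (centre_emb p (inv \<tau> q)) = centre_emb p (\<tau> (inv \<tau> q))"
      using assms(1) by (simp add: lifts_def)
    also have "\<tau> (inv \<tau> q) = q" using assms(2) by (simp add: bij_is_surj surj_f_inv_f)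
    finally have "inv s (s (centre_emb p (inv \<tau> q))) = inv s (centre_emb p q)" by simp
    then show ?thesis using s by (simp add: weyl_algebra_aut_def bij_is_inj)
  qed
  then show ?thesis using weyl_algebra_aut_inv[OF s] by (simp add: lifts_def)
qed

definition special_liftable :: "('k poly poly \<Rightarrow> 'k poly poly) set" where
  "special_liftable = {e. z_aut e \<and> jacobian e = 1 \<and> (\<exists>s. lifts e s)}"

text \<open>The restriction of \<open>s\<close> is already known to be an automorphism of K[X,Y], so
  it only has to be compared with \<open>e\<close> on X and Y; bijectivity of \<open>e\<close> comes
  for free.\<close>

lemma special_liftableI:
  assumes e: "unital_ring_hom e" "\<And>c. e (zconst c) = zconst c" "jacobian e = 1"
    and s: "weyl_algebra_aut s" "s (wx ^ p) = centre_emb p (e varX)" "s (wd ^ p) = centre_emb p (e varY)"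
  shows "e \<in> special_liftable"
proof -
  obtain \<tau> where \<tau>: "z_aut \<tau>" "lifts \<tau> s" using lifts_exists[OF s(1)] .
  have "centre_emb p (\<tau> varX) = centre_emb p (e varX)" "centre_emb p (\<tau> varY) = centre_emb p (e varY)"
    using \<tau>(2) s by (simp_all add: lifts_def)
  then have var: "\<tau> varX = e varX" "\<tau> varY = e varY"
    using inj_centre_emb[OF pos] by (metis injD)+
  have "\<tau> q = e q" for q
    by (rule bivariate_hom_unique[OF z_autD(1)[OF \<tau>(1)] e(1)])
      (use e(2) z_autD(3)[OF \<tau>(1)] var in simp_all)
  then have "\<tau> = e" by (rule ext)
  then show ?thesis using \<tau> e(3) by (auto simp: special_liftable_def)
qed

lemma special_liftable_comp:
  assumes "e \<in> special_liftable" "e' \<in> special_liftable"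
  shows "e \<circ> e' \<in> special_liftable"
proof -
  have e: "z_aut e" "z_aut e'" "jacobian e = 1" "jacobian e' = 1"
    using assms by (auto simp: special_liftable_def)
  obtain s s' where "lifts e s" "lifts e' s'" using assms by (auto simp: special_liftable_def)
  then have "lifts (e \<circ> e') (s \<circ> s')" by (rule lifts_comp)
  moreover have "jacobian (e \<circ> e') = 1"
    using jacobian_comp[OF z_autD(1)[OF e(1)] z_autD(3)[OF e(1)]] e
    by (simp add: unital_ring_hom.one[OF z_autD(1)[OF e(1)]])
  ultimately show ?thesis
    using z_aut_comp[OF e(1,2)] by (auto simp: special_liftable_def)
qed

lemma wd_minus_wx: "wx * (- wd) - (- wd) * wx = (1 :: 'k weyl_algebra)"
  using wd_wx by (simp add: algebra_simps)

lemma rotation_liftable: "rotation \<in> special_liftable"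
proof -
  obtain s where s: "unital_ring_hom s" "\<And>c. s (wc c) = wc (c :: 'k)" "s wx = - wd" "s wd = wx"
    by (rule weyl_algebra_hom_exists[OF wd_minus_wx]) blast
  have "- wx * wd - wd * (- wx) = (1 :: 'k weyl_algebra)" using wd_wx by (simp add: algebra_simps)
  then obtain t
    where t: "unital_ring_hom t" "\<And>c. t (wc c) = wc (c :: 'k)" "t wx = wd" "t wd = - wx"
    by (rule weyl_algebra_hom_exists) blast
  have "weyl_algebra_aut s"
    by (rule weyl_algebra_autI[OF s(1,2) t(1,2)])
      (simp_all add: s t unital_ring_hom.minus[OF s(1)] unital_ring_hom.minus[OF t(1)])
  \<comment> \<open>Frobenius applied to 1 + (-1) gives (-1)^p = -1 for odd p and for p = 2
    alike.\<close>
  moreover have "(1 + (- 1 :: 'k)) ^ p = 1 ^ p + (- 1) ^ p"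
    by (rule freshmans_dream) (use prime_p in \<open>simp_all add: char\<close>)
  then have m1: "(- 1 :: 'k) ^ p = - 1" using pos by (simp add: eq_neg_iff_add_eq_0 add.commute power_0_left)
  have "(- wd :: 'k weyl_algebra) ^ p = - (wd ^ p)"
    using wc_mult_power[of "- 1 :: 'k" wd p] by (simp add: m1)
  ultimately show ?thesis
    by (intro special_liftableI[of _ s])
      (simp_all add: unital_ring_hom_generators jacobian_generators unital_ring_hom.power[OF s(1)] s
        unital_ring_hom.minus[OF unital_ring_hom_centre_emb[OF char pos]])
qed

text \<open>A p-th root \<gamma> of \<alpha> scales x by \<gamma> and d by its inverse; taking p-th
  powers of the images turns \<gamma> into \<alpha>.\<close>

lemma diagonal_liftable:
  assumes perfect: "surj (\<lambda>a::'k. a ^ p)" and \<alpha>: "\<alpha> \<noteq> 0"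
  shows "diagonal \<alpha> \<in> special_liftable"
proof -
  obtain \<gamma> where \<gamma>: "\<alpha> = \<gamma> ^ p" using perfect by (auto simp: surj_def)
  have \<gamma>0: "\<gamma> \<noteq> 0" using \<alpha> \<gamma> pos by auto
  have inv: "wc a * (wc b * v) = v" if "a * b = 1" for a b :: 'k and v
    using that by (metis mult.assoc mult_1 wc_simps(2,4))
  have comm: "(wc (inverse a) * wd) * (wc a * wx) - (wc a * wx) * (wc (inverse a) * wd) = 1"
    if "a \<noteq> 0" for a :: 'k
  proof -
    have "(wc (inverse a) * wd) * (wc a * wx) = wc (inverse a) * (wd * wc a) * wx" by (simp only: mult.assoc)
    also have "\<dots> = wd * wx"
      unfolding wc_central[of a wd, symmetric] using that by (simp add: mult.assoc inv)
    finally have 1: "(wc (inverse a) * wd) * (wc a * wx) = wd * wx" .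
    have "(wc a * wx) * (wc (inverse a) * wd) = wc a * (wx * wc (inverse a)) * wd" by (simp only: mult.assoc)
    also have "\<dots> = wx * wd"
      unfolding wc_central[of "inverse a" wx, symmetric] using that by (simp add: mult.assoc inv)
    finally show ?thesis using 1 wd_wx by simp
  qed
  obtain s where s: "unital_ring_hom s" "\<And>c. s (wc c) = wc (c :: 'k)" "s wx = wc \<gamma> * wx" "s wd = wc (inverse \<gamma>) * wd"
    by (rule weyl_algebra_hom_exists[OF comm[OF \<gamma>0]]) blast
  obtain t where t: "unital_ring_hom t" "\<And>c. t (wc c) = wc (c :: 'k)" "t wx = wc (inverse \<gamma>) * wx" "t wd = wc \<gamma> * wd"
    by (rule weyl_algebra_hom_exists[OF comm[of "inverse \<gamma>"]]) (use \<gamma>0 in auto)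
  have "weyl_algebra_aut s"
    by (rule weyl_algebra_autI[OF s(1,2) t(1,2)])
      (simp_all add: s t \<gamma>0 inv unital_ring_hom.mult[OF s(1)] unital_ring_hom.mult[OF t(1)])
  then show ?thesis
    using jacobian_generators(4)[OF \<alpha>]
    by (intro special_liftableI[of _ s])
      (simp_all add: unital_ring_hom_generators unital_ring_hom.power[OF s(1)] s
        wc_mult_power unital_ring_hom.mult[OF unital_ring_hom_centre_emb[OF char pos]] \<gamma> power_inverse
        del: zconst_simps)
qed

text \<open>For the weights n and 1 the element x + c d^n is homogeneous, so Frobenius gives the top
  part of its p-th power. This power is central; every further monomial X^i Y^j of the corresponding
  polynomial satisfies n i + j < n, hence i = 0, and the remainder involves Y only.\<close>

lemma elementaryX_liftable_leading:
  "\<exists>f. (\<forall>j>n. coeff f j = 0) \<and> coeff f n = (c :: 'k) ^ p \<and> elementaryX f \<in> special_liftable"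
proof -
  have comm: "wd * (wx + wc b * wd ^ n) - (wx + wc b * wd ^ n) * wd = 1" for b :: 'k
  proof -
    have "wd * (wc b * wd ^ n) = wc b * wd ^ n * wd"
      by (metis mult.assoc wc_central power_commutes)
    then show ?thesis using wd_wx by (simp add: distrib_left distrib_right)
  qed
  obtain s where s: "unital_ring_hom s" "\<And>c. s (wc c) = wc (c :: 'k)" "s wx = wx + wc c * wd ^ n" "s wd = wd"
    by (rule weyl_algebra_hom_exists[OF comm]) blast
  obtain t where t: "unital_ring_hom t" "\<And>c. t (wc c) = wc (c :: 'k)" "t wx = wx + wc (- c) * wd ^ n" "t wd = wd"
    by (rule weyl_algebra_hom_exists[OF comm]) blast
  have aut: "weyl_algebra_aut s"
    by (rule weyl_algebra_autI[OF s(1,2) t(1,2)])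
      (simp_all add: s t unital_ring_hom.mult[OF s(1)] unital_ring_hom.mult[OF t(1)]
        unital_ring_hom.add[OF s(1)] unital_ring_hom.add[OF t(1)] unital_ring_hom.diff[OF s(1)]
        unital_ring_hom.power[OF s(1)] unital_ring_hom.power[OF t(1)])
  obtain \<tau> where \<tau>: "z_aut \<tau>" "lifts \<tau> s" using lifts_exists[OF aut] .
  define q where "q = \<tau> varX"
  have "centre_emb p q = s (centre_emb p varX)" using \<tau>(2) by (simp add: lifts_def q_def)
  then have q: "centre_emb p q = (wx + wc c * wd ^ n) ^ p"
    by (simp add: unital_ring_hom.power[OF s(1)] s)
  have sym: "symbol (wx + wc c * wd ^ n) = mon 1 1 0 + mon c 0 n"
    using symbol_normal[of c 0 n] by (simp add: varX_mon)
  have "bi_top (real n) 1 (real n) (mon 1 1 0 + mon c 0 n) (mon 1 1 0 + mon c 0 n)"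
    by (rule top_part.add[OF top_part_bi_top bi_top_mon bi_top_mon]) auto
  then have "bi_top (real n) 1 (real p * real n) (symbol ((wx + wc c * wd ^ n) ^ p)) ((mon 1 1 0 + mon c 0 n) ^ p)"
    by (intro bi_top_symbol_power) (simp, simp only: sym)
  moreover have "(mon 1 1 0 + mon c 0 n) ^ p = mon 1 p 0 + mon (c ^ p) 0 (n * p)"
    unfolding frobenius_add by (simp add: mon_eq power_mult_distrib power_mult)
  moreover have "symbol ((wx + wc c * wd ^ n) ^ p) = power_subst p q"
    by (simp add: centre_emb_def flip: q)
  ultimately have top: "bi_top (real n) 1 (real p * real n) (power_subst p q) (mon 1 p 0 + mon (c ^ p) 0 (n * p))"
    by simp
  have cfps: "cf (power_subst p q) (p * i) (p * j) = cf q i j" for i j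
    using pos by (simp add: cf_power_subst)
  have le: "n * i + j \<le> n" if "cf q i j \<noteq> 0" for i j
  proof -
    have "cf (power_subst p q) (p * i) (p * j) \<noteq> 0" using that cfps[of j i] by simp
    then have "real n * real (p * i) + 1 * real (p * j) \<le> real p * real n"
      using top unfolding bi_top_iff by blast
    then have "real (p * (n * i + j)) \<le> real (p * n)" by (simp add: algebra_simps)
    then have "p * (n * i + j) \<le> p * n" by (simp only: of_nat_le_iff)
    then show ?thesis using pos by simp
  qed
  have eq: "cf q i j = (if i = 1 \<and> j = 0 then 1 else 0) + (if i = 0 \<and> j = n then c ^ p else 0)"
    if "n * i + j = n" for i j
  proof -
    have "real n * real (p * i) + 1 * real (p * j) = real (p * (n * i + j))" by (simp add: algebra_simps)
    also have "\<dots> = real p * real n" by (simp add: that)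
    finally have "cf (mon 1 p 0 + mon (c ^ p) 0 (n * p)) (p * i) (p * j) = cf q i j"
      using top cfps[of j i] unfolding bi_top_iff by metis
    then show ?thesis using pos by (auto simp: cf_mon mult.commute[of n p])
  qed
  define f where "f = (\<Sum>j\<le>n. monom (cf q 0 j) j)"
  have cof: "coeff f j = (if j \<le> n then cf q 0 j else 0)" for j
    by (auto simp: f_def coeff_sum)
  have "q = varX + map_poly (\<lambda>c. [:c:]) f"
  proof (rule cf_eqI)
    fix i j
    have R: "cf (varX + map_poly (\<lambda>c. [:c:]) f) i j = (if i = 1 \<and> j = 0 then 1 else 0) + (if i = 0 then coeff f j else 0)"
      by (cases i) (auto simp: varX_mon cf_mon coeff_map_poly)
    consider "n * i + j = n" | "n * i + j < n" | "n * i + j > n" by linarith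
    then show "cf q i j = cf (varX + map_poly (\<lambda>c. [:c:]) f) i j"
    proof cases
      case 1
      show ?thesis
      proof (cases "i = 0")
        case True
        then show ?thesis using 1 unfolding R by (simp add: cof)
      next
        case False
        then show ?thesis using eq[OF 1] unfolding R by simp
      qed
    next
      case 2
      then have "i = 0" by (cases i) auto
      then show ?thesis using 2 unfolding R by (simp add: cof)
    next
      case 3
      then have "cf q i j = 0" using le[of j i] by linarith
      moreover have "cf q 0 j = 0" if "j > n" using le[of j 0] that by auto
      ultimately show ?thesis using 3 unfolding R by (auto simp: cof)
    qed
  qed
  moreover have "coeff f n = c ^ p" using eq[of 0 n] by (simp add: cof)
  moreover have "centre_emb p (\<tau> varY) = centre_emb p varY"
    using \<tau>(2) by (simp add: lifts_def unital_ring_hom.power[OF s(1)] s)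
  ultimately have "elementaryX f \<in> special_liftable"
    by (intro special_liftableI[of _ s])
      (simp_all add: unital_ring_hom_generators jacobian_generators aut unital_ring_hom.power[OF s(1)] s q[symmetric])
  then show ?thesis using cof \<open>coeff f n = c ^ p\<close> by (intro exI[of _ f]) auto
qed

text \<open>The leading coefficients of the lifted elementary automorphisms exhaust the field because it is
  perfect, so all of them are reached by induction on the degree.\<close>
lemma elementaryX_liftable:
  assumes perfect: "surj (\<lambda>a::'k. a ^ p)"
  shows "elementaryX f \<in> special_liftable"
proof -
  have "elementaryX f \<in> special_liftable" if "\<forall>j\<ge>n. coeff f j = 0" for n f
    using that
  proof (induction n arbitrary: f)
    case 0
    then have "f = 0" by (simp add: poly_eq_iff)
    moreover have "weyl_algebra_aut (\<lambda>a :: 'k weyl_algebra. a)"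
      by (simp add: weyl_algebra_aut_def unital_ring_hom_def bij_id[unfolded id_def])
    ultimately show ?case
      by (intro special_liftableI[of _ "\<lambda>a. a"]) (simp_all add: unital_ring_hom_generators jacobian_generators)
  next
    case (Suc n)
    obtain c where c: "coeff f n = c ^ p" using perfect by (auto simp: surj_def)
    obtain g where g: "\<forall>j>n. coeff g j = 0" "coeff g n = c ^ p" "elementaryX g \<in> special_liftable"
      using elementaryX_liftable_leading by blast
    have "\<forall>j\<ge>n. coeff (f - g) j = 0"
    proof (intro allI impI)
      fix j assume "j \<ge> n"
      then consider "j = n" | "j > n" by linarith
      then show "coeff (f - g) j = 0" by cases (use Suc.prems g c in auto)
    qed
    \<comment> \<open>The uncontrolled lower terms of g are charged to f - g, which has no
      coefficient at n or above.\<close>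
    from special_liftable_comp[OF g(3) Suc.IH[OF this]]
    have "elementaryX g \<circ> elementaryX (f - g) \<in> special_liftable" .
    moreover have "(elementaryX g \<circ> elementaryX (f - g)) q = elementaryX f q" for q
    proof (rule bivariate_hom_unique[of "elementaryX g \<circ> elementaryX (f - g)" "elementaryX f"])
      show "unital_ring_hom (elementaryX g \<circ> elementaryX (f - g))"
        using unital_ring_hom_comp[OF unital_ring_hom_generators(1) unital_ring_hom_generators(1)]
        by (simp add: comp_def)
      have hom: "unital_ring_hom (map_poly (\<lambda>c::'k. [:c:]))"
        by (rule unital_ring_hom_map_poly[OF unital_ring_hom_const])
      show "(elementaryX g \<circ> elementaryX (f - g)) varX = elementaryX f varX"
        by (simp add: unital_ring_hom.add[OF unital_ring_hom_generators(1)]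
          map_const_fixed[OF unital_ring_hom_generators(1)]) (simp add: unital_ring_hom.diff[OF hom])
    qed (simp_all add: unital_ring_hom_generators)
    ultimately show ?case by (metis ext)
  qed
  from this[of "Suc (degree f)" f] show ?thesis by (simp add: coeff_eq_0)
qed

text \<open>Conjugation by \<open>rotation\<close> exchanges the two kinds of elementary maps. The
  fourth power of \<open>rotation\<close> is the identity, so its cube is the inverse; the sign of f
  comes from X \<mapsto> -Y.\<close>

lemma elementaryY_liftable:
  assumes perfect: "surj (\<lambda>a::'k. a ^ p)"
  shows "elementaryY f \<in> special_liftable"
proof -
  let ?e = "rotation \<circ> (elementaryX (- f) \<circ> (rotation \<circ> (rotation \<circ> rotation)))"
  have in_L: "?e \<in> special_liftable"
    by (intro special_liftable_comp rotation_liftable elementaryX_liftable perfect)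
  then have aut: "z_aut ?e" by (simp add: special_liftable_def)
  have hom: "unital_ring_hom (map_poly (\<lambda>c::'k. [:c:]))"
    by (rule unital_ring_hom_map_poly[OF unital_ring_hom_const])
  note m = unital_ring_hom.minus[OF unital_ring_hom_generators(3)]
    unital_ring_hom.minus[OF unital_ring_hom_generators(1)] unital_ring_hom.add[OF unital_ring_hom_generators(3)]
    unital_ring_hom.diff[OF unital_ring_hom_generators(3)] unital_ring_hom.minus[OF hom]
    map_const_to_X[OF unital_ring_hom_generators(3)]
  have "?e q = elementaryY f q" for q
    by (rule bivariate_hom_unique[OF z_autD(1)[OF aut] unital_ring_hom_generators(2)])
      (simp_all add: m)
  then have "?e = elementaryY f" by (rule ext)
  then show ?thesis using in_L by simp
qed

lemma tame_monoid_special_liftable: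
  assumes perfect: "surj (\<lambda>a::'k. a ^ p)"
  shows "tame_monoid special_liftable"
proof
  show "z_aut e" if "e \<in> special_liftable" for e using that by (simp add: special_liftable_def)
  show "CHAR('k) > 0" using char pos by simp
qed (simp_all add: special_liftable_comp elementaryX_liftable elementaryY_liftable rotation_liftable
    diagonal_liftable perfect)

end

section \<open>The restriction map\<close>

lemma dilation_1: "dilation 1 = (\<lambda>q. q)"
  by (rule ext, rule bivariate_hom_unique[OF unital_ring_hom_generators(5)])
    (simp_all add: unital_ring_hom_def)

lemma weyl_centre_eq_range:
  fixes p :: nat
  assumes char: "CHAR('k::field) = p" and pos: "p > 0"
  shows "range (z_emb p) = (weyl_centre :: 'k weyl set)"
proof -
  have inj: "rep f = rep g \<longleftrightarrow> f = g" for f g :: "'k weyl"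
    using bij_rep by (metis bij_is_inj inj_eq)
  have surj: "\<exists>f. a = rep f" for a :: "'k weyl_algebra"
    using bij_rep by (metis bij_is_surj surj_def)
  have "a \<in> weyl_centre \<longleftrightarrow> a \<in> range (z_emb p)" for a :: "'k weyl"
  proof
    assume a: "a \<in> weyl_centre"
    have "rep a * b = b * rep a" for b
    proof -
      obtain g where "b = rep g" using surj by blast
      then show ?thesis using a by (simp add: weyl_centre_def flip: rep_mult)
    qed
    then obtain q where "rep a = centre_emb p q" using central_in_range[OF char pos] by metis
    then have "a = z_emb p q" by (simp add: inj flip: rep_z_emb)
    then show "a \<in> range (z_emb p)" by simp
  next
    assume "a \<in> range (z_emb p)"
    then obtain q where "rep a = centre_emb p q" by (auto simp: rep_z_emb)
    then have "rep (weyl_mult a b) = rep (weyl_mult b a)" for b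
      using centre_emb_central[OF char pos, of q "rep b"] by (simp add: rep_mult)
    then show "a \<in> weyl_centre" by (simp add: weyl_centre_def inj)
  qed
  then show ?thesis by blast
qed

theorem theorem1p1:
  fixes p :: nat
  assumes char: "CHAR('k::field) = p"
    and pos: "p > 0"
    and perfect: "surj (\<lambda>a::'k. a ^ p)"
  shows "range (z_emb p :: 'k poly poly \<Rightarrow> 'k weyl) = weyl_centre
    \<and> inj (z_emb p :: 'k poly poly \<Rightarrow> 'k weyl)
    \<and> (\<forall>\<sigma>::'k weyl \<Rightarrow> 'k weyl. weyl_aut \<sigma> \<longrightarrow>
          z_aut (res p \<sigma>) \<and> (\<forall>q. z_emb p (res p \<sigma> q) = \<sigma> (z_emb p q)))
    \<and> (\<forall>\<sigma> \<sigma>'::'k weyl \<Rightarrow> 'k weyl. weyl_aut \<sigma> \<longrightarrow> weyl_aut \<sigma>' \<longrightarrow>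
          res p (\<sigma> \<circ> \<sigma>') = res p \<sigma> \<circ> res p \<sigma>')
    \<and> inj_on (res p) {\<sigma>::'k weyl \<Rightarrow> 'k weyl. weyl_aut \<sigma>}
    \<and> res p ` {\<sigma>::'k weyl \<Rightarrow> 'k weyl. weyl_aut \<sigma>} = {\<tau>. z_aut \<tau> \<and> jacobian \<tau> = 1}"
proof -
  have inj_rep: "rep f = rep g \<longleftrightarrow> f = g" for f g :: "'k weyl"
    using bij_rep by (metis bij_is_inj inj_eq)
  have inj_emb: "z_emb p q = z_emb p r \<longleftrightarrow> q = r" for q r :: "'k poly poly"
  proof -
    have "z_emb p q = z_emb p r \<longleftrightarrow> centre_emb p q = centre_emb p r"
      by (simp add: inj_rep flip: rep_z_emb)
    then show ?thesis by (simp only: inj_eq[OF inj_centre_emb[OF pos]])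
  qed
  define cj :: "('k weyl \<Rightarrow> 'k weyl) \<Rightarrow> 'k weyl_algebra \<Rightarrow> 'k weyl_algebra"
    where "cj = (\<lambda>\<sigma> a. rep (\<sigma> (inv rep a)))"
  have inv_rep: "inv rep (rep f) = f" "rep (inv rep a) = a" for f :: "'k weyl" and a
    by (simp_all add: inv_f_f[OF bij_is_inj[OF bij_rep]] surj_f_inv_f[OF bij_is_surj[OF bij_rep]])
  have cj: "cj \<sigma> (rep f) = rep (\<sigma> f)" for \<sigma> f by (simp add: cj_def inv_rep)
  have aut: "weyl_aut \<sigma> \<longleftrightarrow> weyl_algebra_aut (cj \<sigma>)" for \<sigma> by (rule weyl_aut_conjugate) (rule cj)
  \<comment> \<open>The definite description in \<open>res\<close> is resolved by injectivity of
    \<open>z_emb\<close>: any \<tau> intertwined with \<sigma> is the restriction.\<close>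
  have res_eq: "res p \<sigma> = \<tau>" if "lifts p \<tau> (cj \<sigma>)" for \<sigma> \<tau>
  proof
    fix q
    have "rep (z_emb p (\<tau> q)) = rep (\<sigma> (z_emb p q))"
      using that by (simp add: lifts_def[OF char pos] rep_z_emb flip: cj)
    then have "z_emb p (\<tau> q) = \<sigma> (z_emb p q)" by (simp add: inj_rep)
    then show "res p \<sigma> q = \<tau> q"
      unfolding res_def by (rule the_equality) (simp add: inj_emb flip: \<open>z_emb p (\<tau> q) = \<sigma> (z_emb p q)\<close>)
  qed
  have res: "z_aut (res p \<sigma>)" "lifts p (res p \<sigma>) (cj \<sigma>)" if "weyl_aut \<sigma>" for \<sigma>
  proof -
    have "weyl_algebra_aut (cj \<sigma>)" using that by (simp add: aut)
    from lifts_exists[OF char pos this] obtain \<tau> where \<tau>: "z_aut \<tau>" "lifts p \<tau> (cj \<sigma>)" .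
    then show "z_aut (res p \<sigma>)" "lifts p (res p \<sigma>) (cj \<sigma>)" by (simp_all add: res_eq[OF \<tau>(2)])
  qed
  interpret special: tame_monoid "special_liftable p :: ('k poly poly \<Rightarrow> 'k poly poly) set"
    by (rule tame_monoid_special_liftable[OF char pos perfect])
  have e_props: "z_aut e" "jacobian e = 1" "\<exists>s. lifts p e s"
    if "e \<in> special_liftable p" for e :: "'k poly poly \<Rightarrow> 'k poly poly"
    using that by (auto simp: special_liftable_def[OF char pos])
  have jac: "jacobian (e \<circ> \<tau>) = e (jacobian \<tau>)"
    if "e \<in> special_liftable p" for e \<tau> :: "'k poly poly \<Rightarrow> 'k poly poly"
    using jacobian_comp[OF z_autD(1,3)[OF e_props(1)[OF that]]] e_props(2)[OF that] by simp
  show ?thesis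
  proof (intro conjI allI impI)
    show "range (z_emb p) = (weyl_centre :: 'k weyl set)" by (rule weyl_centre_eq_range[OF char pos])
    show "inj (z_emb p :: 'k poly poly \<Rightarrow> _)" by (rule injI) (simp add: inj_emb)
  next
    fix \<sigma> :: "'k weyl \<Rightarrow> 'k weyl" and q
    assume \<sigma>: "weyl_aut \<sigma>"
    show "z_aut (res p \<sigma>)" using res(1)[OF \<sigma>] .
    have "rep (z_emb p (res p \<sigma> q)) = rep (\<sigma> (z_emb p q))"
      using res(2)[OF \<sigma>] by (simp add: lifts_def[OF char pos] rep_z_emb flip: cj)
    then show "z_emb p (res p \<sigma> q) = \<sigma> (z_emb p q)" by (simp add: inj_rep)
  next
    fix \<sigma> \<sigma>' :: "'k weyl \<Rightarrow> 'k weyl"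
    assume "weyl_aut \<sigma>" "weyl_aut \<sigma>'"
    from lifts_comp[OF char pos res(2)[OF this(1)] res(2)[OF this(2)]]
    show "res p (\<sigma> \<circ> \<sigma>') = res p \<sigma> \<circ> res p \<sigma>'"
      by (intro res_eq) (simp add: cj_def comp_def inv_rep)
  next
    show "inj_on (res p) {\<sigma>::'k weyl \<Rightarrow> 'k weyl. weyl_aut \<sigma>}"
    proof (rule inj_onI)
      fix \<sigma> \<sigma>' :: "'k weyl \<Rightarrow> 'k weyl"
      assume "\<sigma> \<in> {\<sigma>. weyl_aut \<sigma>}" "\<sigma>' \<in> {\<sigma>. weyl_aut \<sigma>}" and eq: "res p \<sigma> = res p \<sigma>'"
      then have \<sigma>: "weyl_aut \<sigma>" "weyl_aut \<sigma>'" by auto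
      note b = z_autD(2)[OF res(1)[OF \<sigma>(2)]]
      \<comment> \<open>The quotient of two automorphisms with equal restriction lifts the identity,
        which is the dilation by 1 = 1^p.\<close>
      have "lifts p (inv (res p \<sigma>') \<circ> res p \<sigma>) (inv (cj \<sigma>') \<circ> cj \<sigma>)"
        by (intro lifts_comp[OF char pos] lifts_inv[OF char pos] res \<sigma> b)
      moreover have "inv (res p \<sigma>') \<circ> res p \<sigma> = dilation (1 ^ p)"
        using b by (simp add: eq dilation_1 fun_eq_iff bij_is_inj)
      ultimately have "lifts p (dilation (1 ^ p)) (inv (cj \<sigma>') \<circ> cj \<sigma>)" by simp
      from lifts_dilation(2)[OF char pos this] have "inv (cj \<sigma>') (cj \<sigma> a) = a" for a by simp
      moreover have "surj (cj \<sigma>')"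
        using aut[of \<sigma>'] \<sigma>(2) by (simp add: weyl_algebra_aut_def bij_is_surj)
      ultimately have "cj \<sigma> a = cj \<sigma>' a" for a by (metis surj_f_inv_f)
      then show "\<sigma> = \<sigma>'" by (metis cj inj_rep ext)
    qed
  next
    show "res p ` {\<sigma>::'k weyl \<Rightarrow> 'k weyl. weyl_aut \<sigma>} = {\<tau>. z_aut \<tau> \<and> jacobian \<tau> = 1}"
    proof (intro equalityI subsetI)
      fix \<tau> assume "\<tau> \<in> res p ` {\<sigma>::'k weyl \<Rightarrow> 'k weyl. weyl_aut \<sigma>}"
      then obtain \<sigma> :: "'k weyl \<Rightarrow> 'k weyl" where "weyl_aut \<sigma>" "\<tau> = res p \<sigma>" by auto
      then have \<tau>: "z_aut \<tau>" "lifts p \<tau> (cj \<sigma>)" using res by auto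
      \<comment> \<open>Both e and \<tau> lift, hence so does the dilation e \<circ> \<tau>, and
        only c = 1 is possible. The Jacobian of \<tau> follows because e is injective and has
        Jacobian 1.\<close>
      obtain e c where e: "e \<in> special_liftable p" "c \<noteq> 0" "e \<circ> \<tau> = dilation c"
        using special.tame[OF \<tau>(1)] .
      obtain \<gamma> where \<gamma>: "c = \<gamma> ^ p" using perfect by (auto simp: surj_def)
      obtain s where "lifts p e s" using e_props(3)[OF e(1)] ..
      from lifts_comp[OF char pos this \<tau>(2)] have "lifts p (dilation (\<gamma> ^ p)) (s \<circ> cj \<sigma>)"
        by (simp add: e \<gamma>)
      then have "\<gamma> = 1" using lifts_dilation(1)[OF char pos] e(2) \<gamma> pos by auto
      then have "jacobian (e \<circ> \<tau>) = 1" by (simp add: e \<gamma> jacobian_generators)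
      then have "e (jacobian \<tau>) = e 1"
        using jac[OF e(1)] unital_ring_hom.one[OF z_autD(1)[OF e_props(1)[OF e(1)]]] by simp
      then have "jacobian \<tau> = 1"
        using z_autD(2)[OF e_props(1)[OF e(1)]] by (simp add: bij_is_inj inj_eq)
      then show "\<tau> \<in> {\<tau>. z_aut \<tau> \<and> jacobian \<tau> = 1}" using \<tau> by simp
    next
      fix \<tau> :: "'k poly poly \<Rightarrow> 'k poly poly"
      assume "\<tau> \<in> {\<tau>. z_aut \<tau> \<and> jacobian \<tau> = 1}"
      then have \<tau>: "z_aut \<tau>" "jacobian \<tau> = 1" by auto
      \<comment> \<open>Now the Jacobian is given and determines c = 1. Thus \<tau> is the inverse
        of e and is lifted by the inverse of a lift of e.\<close>
      obtain e c where e: "e \<in> special_liftable p" "c \<noteq> 0" "e \<circ> \<tau> = dilation c"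
        using special.tame[OF \<tau>(1)] .
      have be: "bij e" by (rule z_autD(2)[OF e_props(1)[OF e(1)]])
      have "jacobian (e \<circ> \<tau>) = 1"
        unfolding jac[OF e(1)] \<tau>(2) by (rule unital_ring_hom.one[OF z_autD(1)[OF e_props(1)[OF e(1)]]])
      then have "zconst c = zconst 1" by (simp add: e jacobian_generators del: zconst_simps(7))
      then have "e \<circ> \<tau> = (\<lambda>q. q)" using e dilation_1 by (metis zconst_simps(7))
      then have "e (\<tau> q) = q" for q by (metis comp_apply)
      then have \<tau>e: "\<tau> = inv e" using be by (metis bij_is_inj ext inv_f_f)
      obtain s where s: "lifts p e s" using e_props(3)[OF e(1)] ..
      from lifts_inv[OF char pos s be] have l: "lifts p \<tau> (inv s)" by (simp add: \<tau>e)
      define \<sigma> where "\<sigma> = (\<lambda>f. inv rep (inv s (rep f)))"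
      have "cj \<sigma> = inv s" by (simp add: cj_def \<sigma>_def inv_rep fun_eq_iff)
      then have "weyl_aut \<sigma>" "res p \<sigma> = \<tau>"
        using l res_eq[of \<tau> \<sigma>] aut[of \<sigma>] by (simp_all add: lifts_def[OF char pos])
      then show "\<tau> \<in> res p ` {\<sigma>. weyl_aut \<sigma>}" by auto
    qed
  qed
qed

end
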